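(* Assume the Generalized Riemann Hypothesis for Dirichlet $L$-functions. Let $B_0$ be a sufficiently large absolute constant, let $K$ be sufficiently large compared to $B_0$, and let $B_0\le B\le 2(\log\log K)^{1/2}$. Set, for a positive integer $k$, $$N_k=\prod_{p\le k}p^{\lfloor \frac{\log k}{\log p}\rfloor+1}$$ (product over primes). Then there exist an integer $k$ with $K/2<k\le K$ and a residue class $\alpha_k \pmod{N_k}$ such that for every integer $n>k$ with $n\equiv\alpha_k\pmod{N_k}$, the binomial coefficient $\binom nk=\frac{n(n-1)\cdots(n-(k-1))}{k!}$ is not divisible by any prime $\le k$, and moreover each term $n-i$ with $0\le i\le k-1$ is divisible by a prime $p\ge B$. *)

theory Defs
  imports "HOL-Complex_Analysis.Complex_Analysis" "HOL-Number_Theory.Cong"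
begin

definition dirichlet_character :: "nat \<Rightarrow> (nat \<Rightarrow> complex) \<Rightarrow> bool" where
  "dirichlet_character q chi \<longleftrightarrow>
     q > 0 \<and> chi 1 = 1 \<and>
     (\<forall>a b. chi (a * b) = chi a * chi b) \<and>
     (\<forall>a. chi (a + q) = chi a) \<and>
     (\<forall>a. chi a \<noteq> 0 \<longleftrightarrow> coprime a q)"

text \<open>
  The L-function of a character is the meromorphic continuation to the whole plane of
  the Dirichlet series, which converges for real part greater than 1. By the identity theorem
  there is at most one nicely meromorphic continuation (continuous at every point that is not
  a pole, with the value 0 at the poles); that there is one is the classical continuation
  theorem. The only possible pole is 1 (for the principal characters).
\<close>
definition dirichlet_L :: "(nat \<Rightarrow> complex) \<Rightarrow> complex \<Rightarrow> complex" where
  "dirichlet_L chi = (THE f. f nicely_meromorphic_on UNIV \<and>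
     (\<forall>s. Re s > 1 \<longrightarrow> (\<lambda>n. chi (Suc n) * of_nat (Suc n) powr (- s)) sums f s))"

text \<open>
  Principal characters (hence the Riemann zeta function, for modulus 1) and imprimitive
  characters are included. The zeros of the Euler factors by which imprimitive characters differ
  from primitive ones have real part 0 and so lie outside the open critical strip.
\<close>
definition GRH :: bool where
  "GRH \<longleftrightarrow> (\<forall>q chi s. dirichlet_character q chi \<longrightarrow> 0 < Re s \<longrightarrow> Re s < 1 \<longrightarrow>
     dirichlet_L chi s = 0 \<longrightarrow> Re s = 1 / 2)"

definition prime_power_modulus :: "nat \<Rightarrow> nat" where
  "prime_power_modulus k = (\<Prod>p \<in> {p. prime p \<and> p \<le> k}. p ^ (nat \<lfloor>ln (real k) / ln (real p)\<rfloor> + 1))"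

end

theory Submission
  imports Defs "HOL-Real_Asymp.Real_Asymp"
begin

text \<open>
  Write j = k - i. For every prime p up to k choose a residue s(p) with s(p) = 0 or
  k mod p < s(p) < p. By Lucas' theorem, taking n congruent to k - s(p) (raised by p if s(p) > 0, so
  that only the last base p digit of k changes, and it grows) modulo the power of p in N(k) keeps p
  from dividing the binomial coefficient, while p divides n - i exactly when j is congruent to s(p).
  So the numbers 1, ..., k have to be covered by the classes s(p) modulo primes p with B \<le> p.

  The choice s(p) = 0 for all p leaves only the numbers composed of primes below B, which are few.
  They are covered by giving some primes q a nonzero class; the price is that numbers composed of
  such q and of primes below B lose their cover. This is done in stages, by the distance d of
  j from the ends of the interval from 1 to k. A prime q can cover any j with k mod q < d < q, and the numbers
  uncovered by changing its class are multiples of q, hence belong to a later stage: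
  prime divisors of k serve d < y1; primes q of size U with k mod q < y1 or k mod q < y2
  serve d < y2 and d < y4; primes q slightly above Z with k mod q < y4 serve d < Z. The remaining
  numbers have d at least Z and are covered by primes P between k - Z and k, one for each. These P are
  available because a suitable nonzero class s modulo one further prime divisor q0 of k covers
  many of them.

  That a k with all these primes exists follows by averaging over the multiples of a fixed Q:
  the residues of k modulo primes of size U are controlled by a second moment, and the pairs (P, q) are
  counted by rounding P up to a multiple of q. The only input on primes is a lower bound of
  Chebyshev type for the number of primes between x and 2x.
\<close>

section \<open>Lucas' theorem and coverings\<close>

text \<open>The stages are forced: a usable prime of size q with k mod q < d is rare unless d is
  large, and every class that is given up uncovers more numbers. So each distance scale has to
  dominate the number of exceptions that its primes serve. Write l = ln K and L = ln l. At most 2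
  sqrt L primes lie below B, so up to K there are only exp(O(L^(3/2))) numbers composed of them, far
  fewer than y1 = exp(L^2). Below y1 itself there are at most l^(1/10), few enough to give each a
  prime divisor of k that is forced by Q dividing k, at the price Q = K^o(1). These divisors have
  size exp(l^(3/4)), so a number up to K contains about l^(1/4) of them at most, and the exceptions
  grow only to exp(l^(1/2)), below y2 = exp(l^(3/4)). For U = K^(2/5), U^3 > K allows at most two
  primes of size U in one number, which merely raises the count of exceptions to a bounded power,
  while U^2 remains below K / Q, as the second moment requires. Finally Z is K divided by a power of
  l, so that cofactors of primes above Z are bounded by a power of l and hence lie below all primes
  whose class is changed.\<close>

lemma prime_dvd_binomial_self:
  fixes p i :: nat
  assumes "prime p" "0 < i" "i < p"
  shows "p dvd (p choose i)"
proof -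
  have "i * (p choose i) = p * ((p - 1) choose (i - 1))"
    using assms by (metis Suc_diff_1 Suc_times_binomial_eq mult.commute prime_gt_0_nat)
  then have "p dvd i * (p choose i)" by simp
  moreover have "\<not> p dvd i" using assms by (simp add: nat_dvd_not_less)
  ultimately show ?thesis using assms(1) by (simp add: prime_dvd_mult_iff)
qed

text \<open>In Vandermonde's sum only the terms that take 0 or \<open>p\<close> elements from the
  added block survive modulo \<open>p\<close>.\<close>

lemma binomial_add_prime_cong:
  fixes p m r :: nat
  assumes p: "prime p" and r: "r \<ge> p"
  shows "[(p + m) choose r = (m choose r) + (m choose (r - p))] (mod p)"
proof -
  have "(p + m) choose r = (\<Sum>k\<le>r. (p choose k) * (m choose (r - k)))"
    by (rule vandermonde[symmetric])
  also have "\<dots> = (\<Sum>k\<in>{0,p}. (p choose k) * (m choose (r - k)))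
      + (\<Sum>k\<in>{..r} - {0,p}. (p choose k) * (m choose (r - k)))"
    using r by (subst sum.subset_diff[of "{0,p}"]) auto
  also have "(\<Sum>k\<in>{0,p}. (p choose k) * (m choose (r - k))) = (m choose r) + (m choose (r - p))"
    using prime_gt_0_nat[OF p] by simp
  finally have "(p + m) choose r = (m choose r) + (m choose (r - p))
      + (\<Sum>k\<in>{..r} - {0,p}. (p choose k) * (m choose (r - k)))" .
  moreover have "p dvd (\<Sum>k\<in>{..r} - {0,p}. (p choose k) * (m choose (r - k)))"
  proof (rule dvd_sum)
    fix k assume "k \<in> {..r} - {0,p}"
    then have "k > p \<or> (0 < k \<and> k < p)" by auto
    then have "p dvd (p choose k)"
      using prime_dvd_binomial_self[OF p] by (auto simp: binomial_eq_0)
    then show "p dvd (p choose k) * (m choose (r - k))" by simp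
  qed
  ultimately show ?thesis
    by (metis (no_types, lifting) cong_0_iff cong_add_lcancel_0_nat)
qed

lemma binomial_add_prime_cong_less:
  fixes p m r :: nat
  assumes p: "prime p" and r: "r < p"
  shows "[(p + m) choose r = m choose r] (mod p)"
proof -
  have "(p + m) choose r = (\<Sum>k\<le>r. (p choose k) * (m choose (r - k)))"
    by (rule vandermonde[symmetric])
  also have "\<dots> = (m choose r) + (\<Sum>k\<in>{..r} - {0}. (p choose k) * (m choose (r - k)))"
    by (subst sum.remove[of _ 0]) auto
  finally have "(p + m) choose r = (m choose r)
      + (\<Sum>k\<in>{..r} - {0}. (p choose k) * (m choose (r - k)))" .
  moreover have "p dvd (\<Sum>k\<in>{..r} - {0}. (p choose k) * (m choose (r - k)))"
    using prime_dvd_binomial_self[OF p] r by (intro dvd_sum) auto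
  ultimately show ?thesis
    by (metis (no_types, lifting) cong_0_iff cong_add_lcancel_0_nat)
qed

text \<open>Modulo \<open>p\<close>, raising the upper index by \<open>p\<close> acts on the leading
  parts as Pascal's rule, so induction on \<open>a\<close> with \<open>c\<close> free rebuilds
  \<open>a choose c\<close>.\<close>

lemma Lucas_step:
  fixes p a b c d :: nat
  assumes p: "prime p" and b: "b < p" and d: "d < p"
  shows "[(p * a + b) choose (p * c + d) = (a choose c) * (b choose d)] (mod p)"
proof (induction a arbitrary: c)
  case 0
  show ?case
  proof (cases "c = 0")
    case False
    then have "p * c + d > b" using b
      by (metis add.commute less_le_trans mult.right_neutral mult_le_mono2 not_gr0 trans_le_add2 Suc_leI One_nat_def)
    then show ?thesis using False by (simp add: binomial_eq_0)
  qed simp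
next
  case (Suc a)
  show ?case
  proof (cases c)
    case 0
    have "[(p + (p * a + b)) choose d = (p * a + b) choose d] (mod p)"
      by (rule binomial_add_prime_cong_less[OF p d])
    also have "[(p * a + b) choose d = (b choose d)] (mod p)"
      using Suc.IH[of 0] by simp
    finally show ?thesis by (simp add: 0 algebra_simps)
  next
    case c: (Suc c')
    have "[(p + (p * a + b)) choose (p * c + d)
       = ((p * a + b) choose (p * c + d)) + ((p * a + b) choose (p * c + d - p))] (mod p)"
      by (rule binomial_add_prime_cong[OF p]) (simp add: c)
    also have "p * c + d - p = p * c' + d" by (simp add: c)
    also have "[((p * a + b) choose (p * c + d)) + ((p * a + b) choose (p * c' + d))
       = (a choose c) * (b choose d) + (a choose c') * (b choose d)] (mod p)"
      by (intro cong_add Suc.IH)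
    finally show ?thesis by (simp add: c algebra_simps)
  qed
qed

lemma prime_not_dvd_binomial_small:
  fixes p a b :: nat
  assumes "prime p" "a < p" "b \<le> a"
  shows "\<not> p dvd (a choose b)"
proof
  assume "p dvd (a choose b)"
  then have "p dvd fact a"
    using assms(3) by (metis binomial_fact_lemma dvd_mult)
  then show False using assms by (simp add: prime_dvd_fact_iff)
qed

lemma prime_not_dvd_binomial_step:
  fixes p n k :: nat
  assumes p: "prime p" and m: "k mod p \<le> n mod p"
    and d: "\<not> p dvd ((n div p) choose (k div p))"
  shows "\<not> p dvd (n choose k)"
proof -
  have lt: "n mod p < p" "k mod p < p" using prime_gt_0_nat[OF p] by auto
  have "[(p * (n div p) + n mod p) choose (p * (k div p) + k mod p)
    = ((n div p) choose (k div p)) * ((n mod p) choose (k mod p))] (mod p)"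
    by (rule Lucas_step[OF p lt])
  then have "[n choose k = ((n div p) choose (k div p)) * ((n mod p) choose (k mod p))] (mod p)"
    by simp
  moreover have "\<not> p dvd ((n div p) choose (k div p)) * ((n mod p) choose (k mod p))"
    using d prime_not_dvd_binomial_small[OF p lt(1) m] p by (simp add: prime_dvd_mult_iff)
  ultimately show ?thesis using cong_dvd_iff by blast
qed

lemma cong_div_power:
  fixes n v p :: nat
  assumes "[n = v] (mod p ^ Suc d)" "p > 0"
  shows "[n div p = v div p] (mod p ^ d)"
proof -
  have "(x mod (p * p ^ d)) div p = x div p mod p ^ d" for x
    using assms(2) by (simp add: mod_mult2_eq)
  then show ?thesis using assms(1) by (metis cong_def power_Suc)
qed

text \<open>Equal last digits contribute a factor prime to \<open>p\<close>; the induction strips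
  them one at a time, and \<open>k < p ^ d\<close> ensures that no digit of \<open>k\<close> is left
  at the end.\<close>

lemma prime_not_dvd_binomial_cong_self:
  fixes p n k :: nat
  assumes p: "prime p"
  shows "k < p ^ d \<Longrightarrow> [n = k] (mod p ^ d) \<Longrightarrow> \<not> p dvd (n choose k)"
proof (induction d arbitrary: n k)
  case 0
  then show ?case using prime_gt_1_nat[OF p] by simp
next
  case (Suc d)
  have "[n = k] (mod p)" using Suc.prems(2)
    by (metis cong_dvd_modulus_nat dvd_triv_left power_Suc)
  then have m: "k mod p \<le> n mod p" by (simp add: cong_def)
  have "k div p < p ^ d" using Suc.prems(1)
    by (simp add: less_mult_imp_div_less mult.commute)
  then show ?case
    using prime_not_dvd_binomial_step[OF p m] Suc.IH cong_div_power[OF Suc.prems(2)]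
      prime_gt_0_nat[OF p] by blast
qed

text \<open>The exponent of \<open>p\<close> in the modulus is the number of base \<open>p\<close>
  digits of \<open>k\<close>, so a congruence modulo that power fixes every position that
  \<open>k\<close> occupies.\<close>

lemma less_power_digits:
  fixes k p :: nat
  assumes "k > 0" "p > 1"
  shows "k < p ^ (nat \<lfloor>ln (real k) / ln (real p)\<rfloor> + 1)"
proof -
  define d where "d = nat \<lfloor>ln (real k) / ln (real p)\<rfloor> + 1"
  have lp: "ln (real p) > 0" using assms by simp
  have "ln (real k) / ln (real p) < real d" unfolding d_def
    by linarith
  then have "ln (real k) < real d * ln (real p)"
    using lp by (simp add: field_simps)
  also have "\<dots> = ln (real (p ^ d))" using assms by (simp add: ln_realpow)
  finally have "real k < real (p ^ d)" using assms by (subst (asm) ln_less_cancel_iff) auto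
  then show ?thesis unfolding d_def by linarith
qed

section \<open>From a covering of 1, ..., k to a residue class\<close>

lemma residue_class_of_covering:
  fixes k :: nat and sh :: "nat \<Rightarrow> nat" and B :: real
  assumes k: "k > 0"
    and sh: "\<And>p. prime p \<Longrightarrow> p \<le> k \<Longrightarrow> sh p = 0 \<or> (k mod p < sh p \<and> sh p < p)"
    and cover: "\<And>j. 1 \<le> j \<Longrightarrow> j \<le> k \<Longrightarrow> \<exists>p. prime p \<and> p \<le> k \<and> B \<le> real p \<and> j mod p = sh p"
  shows "\<exists>\<alpha>::nat. \<forall>n::nat. n > k \<and> [n = \<alpha>] (mod prime_power_modulus k) \<longrightarrow>
        (\<forall>p. prime p \<and> p \<le> k \<longrightarrow> \<not> p dvd (n choose k)) \<and>
        (\<forall>i<k. \<exists>p. prime p \<and> real p \<ge> B \<and> p dvd (n - i))"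
proof -
  define A where "A = {p. prime p \<and> p \<le> k}"
  define d where "d = (\<lambda>p::nat. nat \<lfloor>ln (real k) / ln (real p)\<rfloor>)"
  define v where "v = (\<lambda>p. if sh p = 0 then k else k + p - sh p)"
  have fin: "finite A" unfolding A_def by simp
  have cop: "coprime (p ^ (d p + 1)) (q ^ (d q + 1))" if "p \<in> A" "q \<in> A" "p \<noteq> q" for p q
    using that unfolding A_def by (simp add: primes_coprime)
  obtain \<alpha> where \<alpha>: "\<forall>p\<in>A. [\<alpha> = v p] (mod p ^ (d p + 1))"
    using chinese_remainder_nat[OF fin, of "\<lambda>p. p ^ (d p + 1)" v] cop by blast
  have M: "prime_power_modulus k = (\<Prod>p\<in>A. p ^ (d p + 1))"
    unfolding prime_power_modulus_def A_def d_def ..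
  show ?thesis
  proof (intro exI[of _ \<alpha>] allI impI)
    fix n :: nat
    assume n: "n > k \<and> [n = \<alpha>] (mod prime_power_modulus k)"
    have nv: "[n = v p] (mod p ^ Suc (d p))" if p: "p \<in> A" for p
    proof -
      have "p ^ (d p + 1) dvd prime_power_modulus k"
        unfolding M using p fin by (rule dvd_prodI[rotated])
      then have "[n = \<alpha>] (mod p ^ (d p + 1))" using n cong_dvd_modulus_nat by blast
      then show ?thesis using \<alpha> p by (auto intro: cong_trans)
    qed
    have ndvd: "\<not> p dvd (n choose k)" if p: "prime p" "p \<le> k" for p
    proof -
      have pA: "p \<in> A" using p by (simp add: A_def)
      have lt: "k < p ^ Suc (d p)"
        using less_power_digits[OF k prime_gt_1_nat[OF p(1)]] by (simp add: d_def)
      show ?thesis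
      proof (cases "sh p = 0")
        case True
        then show ?thesis using prime_not_dvd_binomial_cong_self[OF p(1) lt] nv[OF pA]
          by (simp add: v_def)
      next
        case False
        then have s: "k mod p < sh p" "sh p < p" using sh[OF p] by auto
        \<comment> \<open>The new last digit: \<open>k mod p < sh p\<close> keeps it below
          \<open>p\<close>, so that no carry changes the higher digits, and \<open>sh p < p\<close>
          keeps it at least \<open>k mod p\<close>.\<close>
        define e where "e = k mod p + p - sh p"
        have e: "e < p" "k mod p \<le> e" using s unfolding e_def by auto
        have ve: "v p = e + p * (k div p)"
          using False s unfolding v_def e_def
          using mult_div_mod_eq[of p k] by simp
        have vm: "v p mod p = e" and vd: "v p div p = k div p"
          using e(1) by (simp_all add: ve)
        have "[n = v p] (mod p)" using nv[OF pA]
          by (metis cong_dvd_modulus_nat dvd_triv_left power_Suc)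
        then have m: "k mod p \<le> n mod p" using vm e(2) by (simp add: cong_def)
        have "[n div p = k div p] (mod p ^ d p)"
          using cong_div_power[OF nv[OF pA]] prime_gt_0_nat[OF p(1)] vd by simp
        moreover have "k div p < p ^ d p" using lt
          by (simp add: less_mult_imp_div_less mult.commute)
        ultimately show ?thesis
          using prime_not_dvd_binomial_step[OF p(1) m] prime_not_dvd_binomial_cong_self[OF p(1)]
          by blast
      qed
    qed
    have "\<exists>p. prime p \<and> real p \<ge> B \<and> p dvd (n - i)" if i: "i < k" for i
    proof -
      obtain p where p: "prime p" "p \<le> k" "B \<le> real p" "(k - i) mod p = sh p"
        using cover[of "k - i"] i by fastforce
      then have pA: "p \<in> A" by (simp add: A_def)
      have nvp: "[n = v p] (mod p)" using nv[OF pA]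
        by (metis cong_dvd_modulus_nat dvd_triv_left power_Suc)
      have shp: "sh p \<le> k + p" using sh[OF p(1,2)] by auto
      have "[int (v p) = int k - int (sh p)] (mod int p)"
        using shp by (auto simp: v_def of_nat_diff cong_iff_dvd_diff)
      moreover have "[int n = int (v p)] (mod int p)" using nvp by (simp add: cong_int_iff)
      moreover have "[int (k - i) = int (sh p)] (mod int p)"
        using p(4) by (simp add: cong_def zmod_int[symmetric]) (metis mod_mod_trivial zmod_int)
      then have "[int k - int (sh p) = int i] (mod int p)"
        using i by (simp add: of_nat_diff cong_iff_dvd_diff algebra_simps)
      ultimately have "[int n = int i] (mod int p)" using cong_trans by blast
      then have "int p dvd int n - int i" by (simp add: cong_iff_dvd_diff)
      then have "int p dvd int (n - i)" using i n by (simp add: of_nat_diff)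
      then show ?thesis using p by (auto simp: int_dvd_int_iff)
    qed
    with ndvd show "(\<forall>p. prime p \<and> p \<le> k \<longrightarrow> \<not> p dvd (n choose k)) \<and>
        (\<forall>i<k. \<exists>p. prime p \<and> real p \<ge> B \<and> p dvd (n - i))" by blast
  qed
qed

section \<open>Primes between n and 2n\<close>

lemma prime_power_dvd_lcm_iff:
  fixes p x y :: nat
  assumes "prime p" "x > 0" "y > 0"
  shows "p ^ a dvd lcm x y \<longleftrightarrow> p ^ a dvd x \<or> p ^ a dvd y"
proof
  assume d: "p ^ a dvd lcm x y"
  have "a \<le> multiplicity p (lcm x y)"
    using d assms prime_gt_1_nat[OF assms(1)] by (intro multiplicity_geI) (auto simp: lcm_eq_0_iff)
  also have "\<dots> = max (multiplicity p x) (multiplicity p y)"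
    using assms by (intro multiplicity_lcm) auto
  finally show "p ^ a dvd x \<or> p ^ a dvd y"
    by (auto simp: le_max_iff_disj intro: multiplicity_dvd')
qed (auto intro: dvd_lcmI1 dvd_lcmI2)

lemma prime_power_dvd_Lcm:
  fixes p :: nat
  assumes "prime p" "finite A" "0 \<notin> A" "p ^ a dvd Lcm A" "a > 0"
  shows "\<exists>x\<in>A. p ^ a dvd x"
  using assms(2,3,4)
proof (induction A rule: finite_induct)
  case empty
  then show ?case using assms(1,5) by (simp add: prime_nat_iff)
next
  case (insert x A)
  have "Lcm A > 0" using insert by (metis Lcm_0_iff_nat gr0I insertCI)
  moreover have "x > 0" using insert by (auto intro: gr0I)
  ultimately show ?case using insert prime_power_dvd_lcm_iff[OF assms(1), of x "Lcm A" a]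
    by auto
qed

text \<open>
  The numbers 1 / (k (m choose k)) form the Leibniz harmonic triangle, in which each entry is a difference
  of two entries with smaller k.
\<close>

lemma Lcm_div_Leibniz_Ints:
  fixes k m M :: nat
  shows "k \<le> m \<Longrightarrow> m \<le> M \<Longrightarrow> k > 0 \<Longrightarrow> real (Lcm {1..M}) / (real k * real (m choose k)) \<in> \<int>"
proof (induction k arbitrary: m)
  case (Suc k)
  show ?case
  proof (cases "k = 0")
    case True
    have "m dvd Lcm {1..M}" using Suc.prems by (intro dvd_Lcm) auto
    then show ?thesis using True Suc.prems
      by (simp add: real_of_nat_div[symmetric])
  next
    case False
    define D where "D = real ((m - 1) choose k)"
    have D: "D > 0" unfolding D_def using Suc.prems by (simp add: zero_less_binomial)
    have m: "m > 0" "m > k" using Suc.prems by auto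
    have 1: "real (Suc k) * real (m choose Suc k) = real m * D"
      unfolding D_def using Suc_times_binomial_eq[of "m - 1" k] m
      by (metis Suc_diff_1 of_nat_mult mult.commute)
    have "(m - k) * (m choose k) = m * ((m - 1) choose k)"
      using m by (simp add: binomial_absorb_comp)
    then have 2: "(real m - real k) * real (m choose k) = real m * D"
      unfolding D_def using m by (metis of_nat_diff of_nat_mult less_imp_le)
    have C: "real (m choose k) > 0" using m by (simp add: zero_less_binomial)
    have e: "real (m choose k) = real m * D / (real m - real k)" using 2 m by (simp add: field_simps)
    have "1 / (real (Suc k) * real (m choose Suc k))
        = 1 / (real k * D) - 1 / (real k * real (m choose k))"
      unfolding 1 e using D m False by (simp add: field_simps)
    then have "real (Lcm {1..M}) / (real (Suc k) * real (m choose Suc k))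
      = real (Lcm {1..M}) / (real k * D) - real (Lcm {1..M}) / (real k * real (m choose k))"
      by (metis (no_types, lifting) mult.right_neutral right_diff_distrib times_divide_eq_right)
    moreover have "real (Lcm {1..M}) / (real k * D) \<in> \<int>"
      unfolding D_def using False Suc.prems by (intro Suc.IH) auto
    moreover have "real (Lcm {1..M}) / (real k * real (m choose k)) \<in> \<int>"
      using False Suc.prems by (intro Suc.IH) auto
    ultimately show ?thesis by simp
  qed
qed simp

lemma binomial_dvd_Lcm:
  fixes k m :: nat
  assumes "0 < k" "k \<le> m"
  shows "(m choose k) dvd Lcm {1..m}"
proof -
  have "real (Lcm {1..m}) / (real k * real (m choose k)) \<in> \<int>"
    using Lcm_div_Leibniz_Ints[of k m m] assms by simp
  then obtain z :: int where z: "real (Lcm {1..m}) / (real k * real (m choose k)) = of_int z"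
    by (auto elim: Ints_cases)
  have pos: "real k * real (m choose k) > 0" using assms by (simp add: zero_less_binomial)
  have "real (Lcm {1..m}) = of_int z * (real k * real (m choose k))"
    using z pos by (metis less_irrefl nonzero_eq_divide_eq)
  then have "of_int (int (Lcm {1..m})) = (of_int (z * int k * int (m choose k)) :: real)"
    by simp
  then have "int (Lcm {1..m}) = z * int k * int (m choose k)" by (simp only: of_int_eq_iff)
  then have "int (m choose k) dvd int (Lcm {1..m})" by simp
  then show ?thesis by (simp add: int_dvd_int_iff)
qed

text \<open>A prime power dividing the least common multiple of 1, ..., m divides one of these
  numbers. This bounds its size without Legendre's formula for the exponent.\<close>

lemma prime_power_dvd_binomial_le:
  fixes p k m :: nat
  assumes "prime p" "0 < k" "k \<le> m" "p ^ a dvd (m choose k)"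
  shows "p ^ a \<le> m"
proof (cases "a = 0")
  case False
  have "p ^ a dvd Lcm {1..m}" using assms binomial_dvd_Lcm dvd_trans by blast
  then obtain x where "x \<in> {1..m}" and "p ^ a dvd x"
    using prime_power_dvd_Lcm[OF assms(1), of "{1..m}" a] False by auto
  then have "0 < x" "x \<le> m" by auto
  then show ?thesis using dvd_imp_le[OF \<open>p ^ a dvd x\<close>] by linarith
qed (use assms in simp)

section \<open>The primorial bound\<close>

lemma prod_primes_dvd:
  fixes c :: nat
  assumes "finite A" "\<And>p. p \<in> A \<Longrightarrow> prime p" "\<And>p. p \<in> A \<Longrightarrow> p dvd c"
  shows "\<Prod>A dvd c"
  using assms
proof (induction A rule: finite_induct)
  case (insert x A)
  have "coprime x (\<Prod>A)" using insert by (intro prod_coprime_right) (metis insertCI primes_coprime)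
  then show ?case using insert by (simp add: divides_mult)
qed simp

text \<open>The coefficients up to the middle make up half of the row sum 2^(2m+1).\<close>

lemma binomial_odd_le: "((2 * m + 1) choose m) \<le> 4 ^ m"
proof -
  have "((2 * m + 1) choose m) \<le> (\<Sum>k\<le>m. (2 * m + 1 choose k))"
    by (rule member_le_sum) auto
  also have "\<dots> = 4 ^ m" by (simp only: binomial_r_part_sum power_mult) simp
  finally show ?thesis .
qed

text \<open>Erdos' induction: for odd \<open>n = 2 * m + 1\<close> the primes above
  \<open>m + 1\<close> all divide the middle coefficient, which is at most \<open>4 ^ m\<close>, and
  the induction hypothesis takes the primes up to \<open>m + 1\<close>. An even \<open>n > 2\<close>
  is not prime and reduces to \<open>n - 1\<close>.\<close>

lemma primorial_le: "\<Prod>{p::nat. prime p \<and> p \<le> n} \<le> 4 ^ n"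
proof (induction n rule: less_induct)
  case (less n)
  consider "n \<le> 1" | "n = 2" | "n > 2" "even n" | "n > 2" "odd n" by linarith
  then show ?case
  proof cases
    case 1
    then have e: "{p::nat. prime p \<and> p \<le> n} = {}" by (auto dest: prime_gt_1_nat)
    show ?thesis by (simp only: e) simp
  next
    case 2
    have "{p::nat. prime p \<and> p \<le> 2} = {2}"
      by (auto intro!: antisym dest: prime_ge_2_nat)
    then show ?thesis by (simp add: 2)
  next
    case 3
    have "\<not> prime n" using 3 prime_odd_nat by blast
    then have "{p::nat. prime p \<and> p \<le> n} = {p. prime p \<and> p \<le> n - 1}"
    proof (intro Collect_cong conj_cong refl)
      fix p :: nat assume "prime p"
      then have "p \<noteq> n" using \<open>\<not> prime n\<close> by auto
      then show "(p \<le> n) = (p \<le> n - 1)" using 3 by linarith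
    qed
    moreover have "\<Prod>{p::nat. prime p \<and> p \<le> n - 1} \<le> 4 ^ (n - 1)" using 3 by (intro less) auto
    moreover have "(4::nat) ^ (n - 1) \<le> 4 ^ n" by (rule power_increasing) auto
    ultimately show ?thesis by (simp only:)
  next
    case 4
    then obtain m where m: "n = 2 * m + 1" by (elim oddE)
    have m1: "m \<ge> 1" using 4 m by simp
    define R where "R = {p::nat. prime p \<and> m + 1 < p \<and> p \<le> n}"
    have fin: "finite R" unfolding R_def by simp
    have eq: "{p::nat. prime p \<and> p \<le> n} = {p. prime p \<and> p \<le> m + 1} \<union> R"
      unfolding R_def m using m1 by auto
    have "\<Prod>R dvd ((2 * m + 1) choose m)"
    proof (rule prod_primes_dvd[OF fin])
      fix p assume "p \<in> R"
      then have p: "prime p" "m + 1 < p" "p \<le> 2 * m + 1" unfolding R_def m by auto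
      have "fact m * fact (m + 1) * ((2 * m + 1) choose m) = (fact (2 * m + 1) :: nat)"
        using binomial_fact_lemma[of m "2 * m + 1"] by (simp del: fact_Suc)
      moreover have "p dvd fact (2 * m + 1)" using p by (simp add: prime_dvd_fact_iff del: fact_Suc)
      ultimately have "p dvd fact m * fact (m + 1) * ((2 * m + 1) choose m)" by simp
      then show "p dvd ((2 * m + 1) choose m)"
        using p by (auto simp: prime_dvd_mult_iff prime_dvd_fact_iff simp del: fact_Suc)
    qed (simp add: R_def)
    then have "\<Prod>R \<le> ((2 * m + 1) choose m)" by (rule dvd_imp_le) (simp add: zero_less_binomial)
    also have "\<dots> \<le> 4 ^ m" by (rule binomial_odd_le)
    finally have R: "\<Prod>R \<le> 4 ^ m" .
    have "\<Prod>{p::nat. prime p \<and> p \<le> n} = \<Prod>{p. prime p \<and> p \<le> m + 1} * \<Prod>R"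
      unfolding eq by (rule prod.union_disjoint) (auto simp: R_def)
    also have "\<dots> \<le> 4 ^ (m + 1) * 4 ^ m"
      using m1 m by (intro mult_le_mono R less) auto
    also have "\<dots> = 4 ^ n" by (simp add: m mult_2 power_add)
    finally show ?thesis .
  qed
qed

section \<open>Chebyshev's lower bound\<close>

lemma prime_not_dvd_central_binomial:
  fixes p n :: nat
  assumes "prime p" "2 * n < 3 * p" "p \<le> n" "2 < p"
  shows "\<not> p dvd ((2 * n) choose n)"
proof -
  define r where "r = n - p"
  have n: "n = p + r" and r: "2 * r < p" using assms by (auto simp: r_def)
  have e: "2 * n = 2 * r + 2 * p" using n by simp
  have "(2 * n) mod p = 2 * r" unfolding e using r by simp
  moreover have "(2 * n) div p = 2" unfolding e using r by (subst div_mult_self1) auto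
  moreover have "n mod p = r" unfolding n using r by simp
  moreover have "n div p = 1" unfolding n using r by (simp add: div_add_self1)
  moreover have "\<not> p dvd (2 choose 1)" using assms(4) by (auto dest: dvd_imp_le)
  ultimately show ?thesis
    by (metis prime_not_dvd_binomial_step[OF assms(1)] le_add1 mult_2)
qed

text \<open>The three factors belong to three ranges of primes. Every prime power in the coefficient
  is at most \<open>2 * n\<close>, so a prime whose square exceeds \<open>2 * n\<close> enters at
  most once. Of these, the ones up to \<open>n\<close> are at most \<open>2 * n div 3\<close> by the
  preceding lemma, and the primorial bound applies to them.\<close>

lemma central_binomial_prime_bound:
  fixes n :: nat
  assumes n: "n \<ge> 5"
  shows "((2 * n) choose n) \<le> (2 * n) ^ card {p::nat. prime p \<and> p * p \<le> 2 * n} * 4 ^ (2 * n div 3)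
      * (2 * n) ^ card {p. prime p \<and> n < p \<and> p \<le> 2 * n}"
proof -
  define C where "C = ((2 * n) choose n)"
  define A1 where "A1 = {p::nat. prime p \<and> p * p \<le> 2 * n}"
  define A2 where "A2 = {p::nat. prime p \<and> p \<le> 2 * n div 3}"
  define A3 where "A3 = {p::nat. prime p \<and> n < p \<and> p \<le> 2 * n}"
  have C0: "C > 0" unfolding C_def by (simp add: zero_less_binomial)
  have fin: "finite A1" "finite A2" "finite A3"
  proof -
    have "A1 \<subseteq> {..2 * n}" unfolding A1_def
      by (auto intro: le_trans[OF le_square])
    then show "finite A1" by (rule finite_subset) simp
  qed (simp_all add: A2_def A3_def)
  define t where "t = (\<lambda>p. p ^ multiplicity p C)"
  have pw: "t p \<le> 2 * n" if "prime p" for p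
    unfolding t_def using that n by (intro prime_power_dvd_binomial_le[of p n "2 * n"])
      (auto simp: C_def multiplicity_dvd)
  have m1: "t p \<le> p" if p: "prime p" "p \<notin> A1" for p
  proof (rule ccontr)
    assume "\<not> t p \<le> p"
    then have "multiplicity p C \<noteq> 0 \<and> multiplicity p C \<noteq> 1" unfolding t_def
      using prime_ge_1_nat[OF p(1)] by (intro conjI notI) auto
    then have "2 \<le> multiplicity p C" by simp
    then have "p ^ 2 \<le> t p" unfolding t_def
      using prime_gt_0_nat[OF p(1)] by (intro power_increasing) auto
    then show False using pw[OF p(1)] p by (auto simp: A1_def power2_eq_square)
  qed
  have sub: "prime_factors C \<subseteq> A1 \<union> A2 \<union> A3"
  proof
    fix p assume "p \<in> prime_factors C"
    then have p: "prime p" "p dvd C" by auto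
    have "p \<le> 2 * n" using prime_power_dvd_binomial_le[of p n "2 * n" 1] p n by (simp add: C_def)
    moreover have "p \<in> A2 \<or> p \<in> A1" if "p \<le> n"
    proof (cases "2 * n < 3 * p")
      case True
      have "p \<le> 2" using prime_not_dvd_central_binomial[OF p(1) True that] p(2)
        unfolding C_def using not_le by blast
      then have "p * p \<le> 2 * n" using n mult_le_mono[of p 2 p 2] by linarith
      then show ?thesis using p by (simp add: A1_def)
    qed (use p in \<open>auto simp: A2_def\<close>)
    ultimately show "p \<in> A1 \<union> A2 \<union> A3" using p by (auto simp: A3_def)
  qed
  define P where "P = prime_factors C"
  have finP: "finite P" unfolding P_def by simp
  have Pp: "prime p" if "p \<in> P" for p using that unfolding P_def by auto
  have "C = (\<Prod>p\<in>P. t p)" unfolding P_def t_def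
    using prod_prime_factors[of C] C0 by simp
  also have "P = (P \<inter> A1) \<union> ((P - A1) \<inter> A2 \<union> (P - A1 - A2))" by auto
  also have "(\<Prod>p\<in>\<dots>. t p) = (\<Prod>p\<in>P \<inter> A1. t p) * ((\<Prod>p\<in>(P - A1) \<inter> A2. t p) * (\<Prod>p\<in>P - A1 - A2. t p))"
    using finP by (subst prod.union_disjoint, auto)+
  also have "\<dots> \<le> (2 * n) ^ card A1 * (4 ^ (2 * n div 3) * (2 * n) ^ card A3)"
  proof (intro mult_le_mono)
    have "(\<Prod>p\<in>P \<inter> A1. t p) \<le> (\<Prod>p\<in>P \<inter> A1. 2 * n)"
      using pw Pp by (intro prod_mono) auto
    also have "\<dots> = (2 * n) ^ card (P \<inter> A1)" by (rule prod_constant)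
    also have "\<dots> \<le> (2 * n) ^ card A1" using n fin(1)
      by (intro power_increasing card_mono) auto
    finally show "(\<Prod>p\<in>P \<inter> A1. t p) \<le> (2 * n) ^ card A1" .
    have "(\<Prod>p\<in>(P - A1) \<inter> A2. t p) \<le> (\<Prod>p\<in>(P - A1) \<inter> A2. p)"
      using m1 Pp by (intro prod_mono) auto
    also have "\<dots> \<le> \<Prod>A2" using fin(2)
      by (intro dvd_imp_le prod_dvd_prod_subset) (auto simp: A2_def dest: prime_gt_0_nat)
    also have "\<dots> \<le> 4 ^ (2 * n div 3)" unfolding A2_def by (rule primorial_le)
    finally show "(\<Prod>p\<in>(P - A1) \<inter> A2. t p) \<le> 4 ^ (2 * n div 3)" .
    have "(\<Prod>p\<in>P - A1 - A2. t p) \<le> (\<Prod>p\<in>P - A1 - A2. 2 * n)"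
      using pw Pp by (intro prod_mono) auto
    also have "\<dots> = (2 * n) ^ card (P - A1 - A2)" by (rule prod_constant)
    also have "\<dots> \<le> (2 * n) ^ card A3" using n fin(3) sub
      by (intro power_increasing card_mono) (auto simp: P_def)
    finally show "(\<Prod>p\<in>P - A1 - A2. t p) \<le> (2 * n) ^ card A3" .
  qed
  finally show ?thesis unfolding C_def A1_def A3_def by (simp add: mult.assoc)
qed

lemma card_primes_square_le:
  "real (card {p::nat. prime p \<and> p * p \<le> n}) \<le> sqrt (real n)"
proof -
  have "{p::nat. prime p \<and> p * p \<le> n} \<subseteq> {1..nat \<lfloor>sqrt (real n)\<rfloor>}"
  proof
    fix p assume "p \<in> {p::nat. prime p \<and> p * p \<le> n}"
    then have p: "prime p" "p * p \<le> n" by auto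
    have "real p ^ 2 \<le> real n" using p(2) by (metis of_nat_le_iff of_nat_mult power2_eq_square)
    then have "real p \<le> sqrt (real n)" by (rule real_le_rsqrt)
    then show "p \<in> {1..nat \<lfloor>sqrt (real n)\<rfloor>}" using prime_ge_1_nat[OF p(1)]
      by (auto simp: le_nat_floor)
  qed
  then have "card {p::nat. prime p \<and> p * p \<le> n} \<le> card {1..nat \<lfloor>sqrt (real n)\<rfloor>}"
    by (rule card_mono[rotated]) simp
  then have "card {p::nat. prime p \<and> p * p \<le> n} \<le> nat \<lfloor>sqrt (real n)\<rfloor>" by simp
  then have "real (card {p::nat. prime p \<and> p * p \<le> n}) \<le> real (nat \<lfloor>sqrt (real n)\<rfloor>)"
    by (simp only: of_nat_le_iff)
  also have "\<dots> \<le> sqrt (real n)" by (rule of_nat_floor) simp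
  finally show ?thesis .
qed

text \<open>Against the lower bound 4^n / (2n), the factor \<open>4 ^ (2 * n div 3)\<close> leaves a
  third of the logarithm; ln 4 \<ge> 1 simplifies the constant.\<close>

lemma card_primes_dyadic_lower:
  fixes n :: nat
  assumes n: "n \<ge> 5"
  shows "real (card {p::nat. prime p \<and> n < p \<and> p \<le> 2 * n})
     \<ge> (real n / 3) / ln (2 * real n) - sqrt (2 * real n) - 1"
proof -
  define x where "x = real (card {p::nat. prime p \<and> n < p \<and> p \<le> 2 * n})"
  define y where "y = real (card {p::nat. prime p \<and> p * p \<le> 2 * n})"
  have l: "ln (2 * real n) > 0" using n by simp
  have "4 ^ n / (2 * real n) \<le> real ((2 * n) choose n)"
    using n by (intro central_binomial_lower_bound) auto
  also have "\<dots> \<le> real ((2 * n) ^ card {p::nat. prime p \<and> p * p \<le> 2 * n} * 4 ^ (2 * n div 3)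
      * (2 * n) ^ card {p::nat. prime p \<and> n < p \<and> p \<le> 2 * n})"
    using central_binomial_prime_bound[OF n] by (simp only: of_nat_le_iff)
  finally have "ln (4 ^ n / (2 * real n)) \<le> ln (real ((2 * n) ^ card {p::nat. prime p \<and> p * p \<le> 2 * n} * 4 ^ (2 * n div 3)
      * (2 * n) ^ card {p::nat. prime p \<and> n < p \<and> p \<le> 2 * n}))"
    using n by (subst ln_le_cancel_iff) auto
  then have "real n * ln 4 - ln (2 * real n) \<le> y * ln (2 * real n) + real (2 * n div 3) * ln 4 + x * ln (2 * real n)"
    using n by (simp add: ln_mult ln_div ln_realpow x_def y_def distrib_left)
  also have "real (2 * n div 3) * ln 4 \<le> (2 * real n / 3) * ln 4"
    by (intro mult_right_mono) (use of_nat_div_le_of_nat[of "2 * n" 3, where ?'a = real] in auto)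
  finally have "real n / 3 * ln 4 \<le> (x + y + 1) * ln (2 * real n)"
    by (simp add: algebra_simps)
  moreover have "real n / 3 \<le> real n / 3 * ln 4"
  proof -
    have "ln 4 = 2 * ln (2::real)" using ln_realpow[of 2 2] by simp
    then have "1 \<le> ln (4::real)" using ln2_ge_two_thirds by simp
    then show ?thesis using mult_left_mono[of 1 "ln 4" "real n / 3"] by simp
  qed
  ultimately have "(real n / 3) / ln (2 * real n) \<le> x + y + 1"
    using l by (simp add: pos_divide_le_eq)
  moreover have "y \<le> sqrt (2 * real n)"
    using card_primes_square_le[of "2 * n"] by (simp add: y_def)
  ultimately show ?thesis by (simp add: x_def)
qed

text \<open>The loss from 1/3 to 1/4 absorbs the summand ln 2 in the denominator and the square
  root.\<close>

lemma eventually_card_primes_dyadic: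
  "eventually (\<lambda>n::nat. real (card {p::nat. prime p \<and> n < p \<and> p \<le> 2 * n}) \<ge> real n / (4 * ln (real n))) at_top"
proof -
  have "eventually (\<lambda>x::real. (x / 3) / ln (2 * x) - sqrt (2 * x) - 1 \<ge> x / (4 * ln x)) at_top"
    by real_asymp
  then have "eventually (\<lambda>n::nat. (real n / 3) / ln (2 * real n) - sqrt (2 * real n) - 1
      \<ge> real n / (4 * ln (real n))) at_top"
    using filterlim_real_sequentially by (rule eventually_compose_filterlim)
  with eventually_ge_at_top[of 5] show ?thesis
    by eventually_elim (use card_primes_dyadic_lower in fastforce)
qed

section \<open>Smooth numbers\<close>

text \<open>The numbers that the zero classes of the primes outside \<open>V\<close> leave
  uncovered. \<open>V\<close> is a set and not a bound, because primes with a changed class join the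
  small ones.\<close>

definition smooth_upto :: "nat set \<Rightarrow> nat \<Rightarrow> nat set" where
  "smooth_upto V N = {j. 1 \<le> j \<and> j \<le> N \<and> (\<forall>p. prime p \<and> p dvd j \<longrightarrow> p \<in> V)}"

lemma finite_smooth_upto [simp]: "finite (smooth_upto V N)"
  by (rule finite_subset[of _ "{1..N}"]) (auto simp: smooth_upto_def)

lemma smooth_upto_mono: "V \<subseteq> V' \<Longrightarrow> N \<le> N' \<Longrightarrow> smooth_upto V N \<subseteq> smooth_upto V' N'"
  by (auto simp: smooth_upto_def)

lemma smooth_upto_dvd:
  assumes "j \<in> smooth_upto V N" "m dvd j"
  shows "m \<in> smooth_upto V N"
proof -
  have "m \<le> j" "m > 0" using assms by (auto simp: smooth_upto_def intro: dvd_imp_le gr0I)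
  then show ?thesis using assms by (auto simp: smooth_upto_def intro: dvd_trans)
qed

text \<open>A count by exponents, each below \<open>e\<close>, which is good for few and small
  primes.\<close>

lemma card_smooth_upto_le_power:
  assumes "finite V" "N < 2 ^ e"
  shows "card (smooth_upto V N) \<le> e ^ card V"
  using assms(1)
proof (induction V rule: finite_induct)
  case empty
  have "smooth_upto {} N \<subseteq> {1}"
    by (auto simp: smooth_upto_def) (metis One_nat_def prime_factor_nat)
  then show ?case using card_mono[of "{1::nat}"] by fastforce
next
  case (insert p V)
  have sub: "smooth_upto (insert p V) N \<subseteq> (\<lambda>(a, m). p ^ a * m) ` ({..<e} \<times> smooth_upto V N)"
  proof
    fix j assume j: "j \<in> smooth_upto (insert p V) N"
    show "j \<in> (\<lambda>(a, m). p ^ a * m) ` ({..<e} \<times> smooth_upto V N)"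
    proof (cases "prime p")
      case False
      then have "j \<in> smooth_upto V N" using j by (auto simp: smooth_upto_def)
      moreover have "e > 0" using j assms(2) by (cases e) (auto simp: smooth_upto_def)
      ultimately show ?thesis by (intro image_eqI[of _ _ "(0, j)"]) auto
    next
      case True
      define a where "a = multiplicity p j"
      define m where "m = j div p ^ a"
      have j0: "j > 0" using j by (simp add: smooth_upto_def)
      have jm: "j = p ^ a * m" unfolding m_def a_def by (simp add: multiplicity_dvd)
      have nd: "\<not> p dvd m" unfolding m_def a_def using j0 True
        by (intro multiplicity_decompose) auto
      have "m \<in> smooth_upto (insert p V) N" using smooth_upto_dvd[OF j, of m] jm by simp
      then have m: "m \<in> smooth_upto V N" using nd by (auto simp: smooth_upto_def)
      have "m > 0" using m by (simp add: smooth_upto_def)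
      have "2 ^ a \<le> p ^ a" using prime_ge_2_nat[OF True] by (rule power_mono) simp
      also have "\<dots> \<le> p ^ a * m" using \<open>m > 0\<close> by simp
      also have "\<dots> = j" using jm by simp
      also have "\<dots> < 2 ^ e" using j assms(2) by (simp add: smooth_upto_def)
      finally have "a < e" by simp
      then show ?thesis using m jm by (intro image_eqI[of _ _ "(a, m)"]) auto
    qed
  qed
  have "card (smooth_upto (insert p V) N) \<le> card ((\<lambda>(a, m). p ^ a * m) ` ({..<e} \<times> smooth_upto V N))"
    using sub by (rule card_mono[rotated]) simp
  also have "\<dots> \<le> card ({..<e} \<times> smooth_upto V N)" by (rule card_image_le) simp
  also have "\<dots> \<le> e * e ^ card V" using insert.IH by (simp add: card_cartesian_product)
  finally show ?case using insert by simp
qed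

text \<open>A count by factors: a number below \<open>Y ^ Suc e\<close> contains at most
  \<open>e\<close> primes of size at least \<open>Y\<close>, and the added 1 stands for an absent
  factor. It is good for many large primes.\<close>

lemma card_smooth_upto_le_large:
  assumes V: "finite V" "\<And>v. v \<in> V \<Longrightarrow> Y \<le> v" and Y: "Y > 0"
  shows "N < Y ^ Suc e \<Longrightarrow> card (smooth_upto V N) \<le> (card V + 1) ^ e"
proof (induction e arbitrary: N)
  case 0
  have "smooth_upto V N \<subseteq> {1}"
  proof
    fix j assume j: "j \<in> smooth_upto V N"
    show "j \<in> {1}"
    proof (rule ccontr)
      assume "j \<notin> {1}"
      then obtain p where p: "prime p" "p dvd j" using prime_factor_nat[of j] by auto
      then have "p \<in> V" "p \<le> j" using j by (auto simp: smooth_upto_def dvd_imp_le)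
      then show False using V(2)[of p] j 0 by (auto simp: smooth_upto_def)
    qed
  qed
  then show ?case using card_mono[of "{1::nat}"] by fastforce
next
  case (Suc e)
  define M where "M = Y ^ Suc e - 1"
  have M: "M < Y ^ Suc e" using zero_less_power[OF Y, of "Suc e"] unfolding M_def by linarith
  have sub: "smooth_upto V N \<subseteq> (\<lambda>(v, m). v * m) ` (insert 1 V \<times> smooth_upto V M)"
  proof
    fix j assume j: "j \<in> smooth_upto V N"
    show "j \<in> (\<lambda>(v, m). v * m) ` (insert 1 V \<times> smooth_upto V M)"
    proof (cases "j = 1")
      case True
      then show ?thesis
      \<comment> \<open>For \<open>Y = 1\<close> the bound \<open>M\<close> is 0 and would exclude
        1, but then \<open>N\<close> is 0 and there is no \<open>j\<close> at all.\<close>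
      proof (cases "Y = 1")
        case True
        then show ?thesis using Suc.prems j by (auto simp: smooth_upto_def)
      next
        case False
        then have "Y ^ Suc e > 1" using Y by (intro one_less_power) auto
        then have "1 \<in> smooth_upto V M" unfolding M_def by (auto simp: smooth_upto_def)
        then show ?thesis using \<open>j = 1\<close> by (intro image_eqI[of _ _ "(1, 1)"]) auto
      qed
    next
      case False
      then obtain p where p: "prime p" "p dvd j" using prime_factor_nat[of j] by auto
      then obtain m where m: "j = p * m" by auto
      have pV: "p \<in> V" using p j by (auto simp: smooth_upto_def)
      have "Y * m \<le> p * m" using V(2)[OF pV] by simp
      also have "\<dots> < Y * Y ^ Suc e" using m j Suc.prems by (simp add: smooth_upto_def)
      finally have "m < Y ^ Suc e" using Y by (simp only: nat_mult_less_cancel1)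
      then have "m \<le> M" unfolding M_def by simp
      moreover have "m \<in> smooth_upto V N" using smooth_upto_dvd[OF j] m by simp
      ultimately have "m \<in> smooth_upto V M" by (simp add: smooth_upto_def)
      then show ?thesis using m pV by (intro image_eqI[of _ _ "(p, m)"]) auto
    qed
  qed
  have "card (smooth_upto V N) \<le> card ((\<lambda>(v, m). v * m) ` (insert 1 V \<times> smooth_upto V M))"
    using sub V(1) by (intro card_mono) auto
  also have "\<dots> \<le> card (insert 1 V \<times> smooth_upto V M)" using V(1) by (intro card_image_le) simp
  also have "\<dots> = card (insert 1 V) * card (smooth_upto V M)" by (rule card_cartesian_product)
  also have "\<dots> \<le> (card V + 1) * (card V + 1) ^ e"
    using V(1) Suc.IH[OF M] by (intro mult_le_mono) (auto simp: card_insert_if)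
  finally show ?case by simp
qed

lemma smooth_upto_Un_decompose:
  "j \<in> smooth_upto (V \<union> V') N \<Longrightarrow> \<exists>a\<in>smooth_upto V N. \<exists>b\<in>smooth_upto V' N. j = a * b"
proof (induction j rule: less_induct)
  case (less j)
  show ?case
  proof (cases "j = 1")
    case True
    then have "1 \<in> smooth_upto V N" "1 \<in> smooth_upto V' N" using less.prems
      by (auto simp: smooth_upto_def)
    then show ?thesis using True by (metis mult_1)
  next
    case False
    then obtain p where p: "prime p" "p dvd j" using prime_factor_nat[of j] by auto
    then obtain m where m: "j = p * m" by auto
    have j: "j > 0" "j \<le> N" using less.prems by (auto simp: smooth_upto_def)
    then have "m > 0" using m by (auto intro: gr0I)
    then have "m < j" using m prime_gt_1_nat[OF p(1)] by simp
    moreover have "m \<in> smooth_upto (V \<union> V') N" using smooth_upto_dvd[OF less.prems] m by simp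
    ultimately obtain a b where ab: "a \<in> smooth_upto V N" "b \<in> smooth_upto V' N" "m = a * b"
      using less.IH by blast
    have pV: "p \<in> V \<or> p \<in> V'" using p less.prems by (auto simp: smooth_upto_def)
    have ab0: "a > 0" "b > 0" using ab by (auto simp: smooth_upto_def)
    have pp: "r = p" if "prime r" "r dvd p" for r
      using that p(1) by (simp add: primes_dvd_imp_eq)
    have le: "p * a \<le> N" "p * b \<le> N"
    proof -
      have "p * a \<le> j" "p * b \<le> j" using ab0 m ab(3) by auto
      then show "p * a \<le> N" "p * b \<le> N" using j by auto
    qed
    from pV show ?thesis
    proof
      assume "p \<in> V"
      then have "r \<in> V" if "prime r" "r dvd p * a" for r
        using that pp[of r] ab by (auto simp: smooth_upto_def prime_dvd_mult_iff)
      then have "p * a \<in> smooth_upto V N" using le ab0 prime_gt_0_nat[OF p(1)]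
        by (auto simp: smooth_upto_def)
      then show ?thesis using ab m by (metis mult.assoc)
    next
      assume "p \<in> V'"
      then have "r \<in> V'" if "prime r" "r dvd p * b" for r
        using that pp[of r] ab by (auto simp: smooth_upto_def prime_dvd_mult_iff)
      then have "p * b \<in> smooth_upto V' N" using le ab0 prime_gt_0_nat[OF p(1)]
        by (auto simp: smooth_upto_def)
      then show ?thesis using ab m by (metis mult.left_commute)
    qed
  qed
qed

text \<open>Lets the count by exponents for the primes below \<open>B\<close> be multiplied with the
  count by factors for the large primes.\<close>

lemma card_smooth_upto_Un:
  "card (smooth_upto (V \<union> V') N) \<le> card (smooth_upto V N) * card (smooth_upto V' N)"
proof -
  have "smooth_upto (V \<union> V') N \<subseteq> (\<lambda>(a, b). a * b) ` (smooth_upto V N \<times> smooth_upto V' N)"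
    using smooth_upto_Un_decompose by fastforce
  then have "card (smooth_upto (V \<union> V') N)
      \<le> card ((\<lambda>(a, b). a * b) ` (smooth_upto V N \<times> smooth_upto V' N))"
    by (rule card_mono[rotated]) simp
  also have "\<dots> \<le> card (smooth_upto V N \<times> smooth_upto V' N)" by (rule card_image_le) simp
  finally show ?thesis by (simp add: card_cartesian_product)
qed


section \<open>A second moment for residues\<close>

lemma card_mod_in_block:
  fixes m :: nat
  assumes "m > 0" "R \<subseteq> {..<m}"
  shows "card {t. m * a \<le> t \<and> t < m * a + m \<and> t mod m \<in> R} = card R"
proof (rule bij_betw_same_card[symmetric, of "\<lambda>x. m * a + x"])
  show "bij_betw (\<lambda>x. m * a + x) R {t. m * a \<le> t \<and> t < m * a + m \<and> t mod m \<in> R}"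
  proof (rule bij_betwI[where g = "\<lambda>t. t - m * a"])
    show "(\<lambda>x. m * a + x) \<in> R \<rightarrow> {t. m * a \<le> t \<and> t < m * a + m \<and> t mod m \<in> R}"
      using assms(2) by auto
    show "(\<lambda>t. t - m * a) \<in> {t. m * a \<le> t \<and> t < m * a + m \<and> t mod m \<in> R} \<rightarrow> R"
    proof
      fix t assume "t \<in> {t. m * a \<le> t \<and> t < m * a + m \<and> t mod m \<in> R}"
      then obtain s where "t = m * a + s" "s < m" "t mod m \<in> R"
        by (auto simp: le_iff_add)
      then show "t - m * a \<in> R" by simp
    qed
  qed auto
qed

lemma card_mod_in_multiple:
  fixes m :: nat
  assumes "m > 0" "R \<subseteq> {..<m}"
  shows "card {t. t < m * a \<and> t mod m \<in> R} = card R * a"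
proof (induction a)
  case (Suc a)
  have "{t. t < m * Suc a \<and> t mod m \<in> R} = {t. t < m * a \<and> t mod m \<in> R}
      \<union> {t. m * a \<le> t \<and> t < m * a + m \<and> t mod m \<in> R}" by auto
  moreover have "card \<dots> = card {t. t < m * a \<and> t mod m \<in> R}
      + card {t. m * a \<le> t \<and> t < m * a + m \<and> t mod m \<in> R}"
    by (rule card_Un_disjoint) auto
  ultimately show ?case using Suc card_mod_in_block[OF assms] by simp
qed simp

lemma card_mod_in_bounds:
  fixes m H :: nat
  assumes m: "m > 0" and R: "R \<subseteq> {..<m}"
  shows "real (card {t. t < H \<and> t mod m \<in> R}) \<le> real (card R) * (real H / real m + 1)"
    and "real (card R) * (real H / real m - 1) \<le> real (card {t. t < H \<and> t mod m \<in> R})"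
proof -
  define a where "a = H div m"
  have a: "m * a \<le> H" "H < m * Suc a" using m unfolding a_def
    by (auto simp: dividend_less_times_div)
  have ra: "real a \<le> real H / real m" "real H / real m - 1 \<le> real a"
  proof -
    have "real m * real a \<le> real H" using a(1) by (metis of_nat_le_iff of_nat_mult)
    then show "real a \<le> real H / real m" using m by (simp add: field_simps)
    have "real H \<le> real m * (real a + 1)" using a(2)
      by (metis less_imp_le of_nat_Suc of_nat_le_iff of_nat_mult add.commute)
    then show "real H / real m - 1 \<le> real a" using m by (simp add: field_simps)
  qed
  have "card {t. t < H \<and> t mod m \<in> R} \<le> card {t. t < m * Suc a \<and> t mod m \<in> R}"
    using a(2) by (intro card_mono) auto
  then have "real (card {t. t < H \<and> t mod m \<in> R}) \<le> real (card R * Suc a)"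
    unfolding card_mod_in_multiple[OF assms] by (simp only: of_nat_le_iff)
  also have "real (card R * Suc a) = real (card R) * (real a + 1)" by (simp add: algebra_simps)
  also have "\<dots> \<le> real (card R) * (real H / real m + 1)"
    using ra by (intro mult_left_mono) auto
  finally show "real (card {t. t < H \<and> t mod m \<in> R}) \<le> real (card R) * (real H / real m + 1)" .
  have "card {t. t < m * a \<and> t mod m \<in> R} \<le> card {t. t < H \<and> t mod m \<in> R}"
    using a(1) by (intro card_mono) auto
  then have "real (card R * a) \<le> real (card {t. t < H \<and> t mod m \<in> R})"
    unfolding card_mod_in_multiple[OF assms] by (simp only: of_nat_le_iff)
  moreover have "real (card R) * (real H / real m - 1) \<le> real (card R * a)"
    using ra by (simp add: mult_left_mono)
  ultimately show "real (card R) * (real H / real m - 1) \<le> real (card {t. t < H \<and> t mod m \<in> R})"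
    by linarith
qed

lemma inj_on_mult_mod:
  fixes Q m :: nat
  assumes "coprime Q m"
  shows "inj_on (\<lambda>t. Q * t mod m) {..<m}"
proof (rule inj_onI)
  fix s t assume st: "s \<in> {..<m}" "t \<in> {..<m}" "Q * s mod m = Q * t mod m"
  then have "[Q * s = Q * t] (mod m)" by (simp add: cong_def)
  then have "[s = t] (mod m)" using assms cong_mult_lcancel_nat by blast
  then show "s = t" using st by (simp add: cong_def)
qed

text \<open>Multiplication by the unit \<open>Q\<close> permutes the residues modulo
  \<open>q\<close>, so the condition becomes \<open>t mod q \<in> R\<close> for a set
  \<open>R\<close> of the same size as \<open>A\<close>.\<close>

lemma card_mult_mod_bounds:
  fixes Q q H :: nat
  assumes q: "q > 0" "coprime Q q" and A: "A \<subseteq> {..<q}"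
  shows "real (card {t. t < H \<and> Q * t mod q \<in> A}) \<le> real (card A) * (real H / real q + 1)"
    and "real (card A) * (real H / real q - 1) \<le> real (card {t. t < H \<and> Q * t mod q \<in> A})"
proof -
  define R where "R = {t. t < q \<and> Q * t mod q \<in> A}"
  have img: "(\<lambda>t. Q * t mod q) ` {..<q} = {..<q}"
    using q by (intro card_subset_eq) (auto simp: card_image[OF inj_on_mult_mod[OF q(2)]])
  have "(\<lambda>t. Q * t mod q) ` R = A"
  proof
    show "A \<subseteq> (\<lambda>t. Q * t mod q) ` R"
    proof
      fix x assume x: "x \<in> A"
      then have "x \<in> (\<lambda>t. Q * t mod q) ` {..<q}" using A img by auto
      then show "x \<in> (\<lambda>t. Q * t mod q) ` R" using x by (auto simp: R_def)
    qed
  qed (auto simp: R_def)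
  moreover have "inj_on (\<lambda>t. Q * t mod q) R"
    by (rule inj_on_subset[OF inj_on_mult_mod[OF q(2)]]) (auto simp: R_def)
  ultimately have cR: "card R = card A" using card_image by fastforce
  have eq: "{t. t < H \<and> Q * t mod q \<in> A} = {t. t < H \<and> t mod q \<in> R}"
    using q by (auto simp: R_def mod_mult_right_eq)
  have RR: "R \<subseteq> {..<q}" by (auto simp: R_def)
  show "real (card {t. t < H \<and> Q * t mod q \<in> A}) \<le> real (card A) * (real H / real q + 1)"
    using card_mod_in_bounds(1)[OF q(1) RR, of H] unfolding eq cR .
  show "real (card A) * (real H / real q - 1) \<le> real (card {t. t < H \<and> Q * t mod q \<in> A})"
    using card_mod_in_bounds(2)[OF q(1) RR, of H] unfolding eq cR .
qed

text \<open>By the Chinese remainder theorem the two residues determine \<open>t\<close> modulo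
  \<open>q * q'\<close>, so the number of classes is at most the square of
  \<open>card A\<close>.\<close>

lemma card_mult_mod_pair_bound:
  fixes Q q q' H :: nat
  assumes q: "q > 0" "q' > 0" "coprime Q q" "coprime Q q'" "coprime q q'" and A: "finite A"
  shows "real (card {t. t < H \<and> Q * t mod q \<in> A \<and> Q * t mod q' \<in> A})
    \<le> (real (card A))\<^sup>2 * (real H / (real q * real q') + 1)"
proof -
  define m where "m = q * q'"
  have m: "m > 0" using q by (simp add: m_def)
  define R where "R = {t. t < m \<and> Q * t mod q \<in> A \<and> Q * t mod q' \<in> A}"
  define f where "f = (\<lambda>t. (Q * t mod q, Q * t mod q'))"
  have "inj_on f R"
  proof (rule inj_onI)
    fix s t assume st: "s \<in> R" "t \<in> R" "f s = f t"
    have "[Q * s = Q * t] (mod q)" "[Q * s = Q * t] (mod q')"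
      using st(3) by (auto simp: f_def cong_def)
    then have "[s = t] (mod q)" "[s = t] (mod q')" using q(3,4) cong_mult_lcancel_nat by blast+
    then have "[s = t] (mod m)" using q(5) unfolding m_def by (simp add: coprime_cong_mult_nat)
    then show "s = t" using st(1,2) by (simp add: cong_def R_def)
  qed
  moreover have "f ` R \<subseteq> A \<times> A" by (auto simp: R_def f_def)
  ultimately have "card R \<le> card (A \<times> A)" using A by (intro card_inj_on_le) auto
  then have "real (card R) \<le> real (card A * card A)" by (simp add: card_cartesian_product del: of_nat_mult)
  then have cR: "real (card R) \<le> (real (card A))\<^sup>2" by (simp add: power2_eq_square)
  have eq: "{t. t < H \<and> Q * t mod q \<in> A \<and> Q * t mod q' \<in> A} = {t. t < H \<and> t mod m \<in> R}"
  proof -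
    have "Q * (t mod m) mod q = Q * t mod q" "Q * (t mod m) mod q' = Q * t mod q'" for t
      unfolding m_def by (metis mod_mult_right_eq mod_mod_cancel dvd_triv_left dvd_triv_right)+
    then show ?thesis using m by (auto simp: R_def)
  qed
  have RR: "R \<subseteq> {..<m}" by (auto simp: R_def)
  have "real (card {t. t < H \<and> Q * t mod q \<in> A \<and> Q * t mod q' \<in> A})
      \<le> real (card R) * (real H / real m + 1)"
    using card_mod_in_bounds(1)[OF m RR, of H] unfolding eq .
  also have "\<dots> \<le> (real (card A))\<^sup>2 * (real H / real m + 1)"
    using cR by (intro mult_right_mono) auto
  finally show ?thesis by (simp add: m_def)
qed

text \<open>Chebyshev's inequality for the number of q with \<open>Q * t mod q \<in> A\<close>,
  where t is uniform below \<open>H\<close> and the mean is about \<mu>. Distinct primes are nearly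
  independent, so the main terms of order H \<mu>^2 cancel. What is left comes from the diagonal and
  from incomplete periods.\<close>

lemma residue_count_second_moment:
  fixes Q H :: nat and \<Q> A :: "nat set" and \<mu> :: real
  assumes fin: "finite \<Q>" and pr: "\<And>q. q \<in> \<Q> \<Longrightarrow> prime q \<and> coprime Q q \<and> A \<subseteq> {..<q}"
    and finA: "finite A"
  defines "\<mu> \<equiv> (\<Sum>q\<in>\<Q>. real (card A) / real q)"
  shows "real (card {t. t < H \<and> real (card {q \<in> \<Q>. Q * t mod q \<in> A}) < \<mu> / 2}) * \<mu>\<^sup>2
    \<le> 4 * real H * \<mu> + 16 * (real (card A) * real (card \<Q>))\<^sup>2"
proof -
  define h where "h = real (card A)"
  define z where "z = real (card \<Q>)"
  define I where "I = (\<lambda>q t. if Q * t mod q \<in> A then 1 else 0 :: real)"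
  define X where "X = (\<lambda>t. real (card {q \<in> \<Q>. Q * t mod q \<in> A}))"
  have X: "X t = (\<Sum>q\<in>\<Q>. I q t)" for t
    unfolding X_def I_def using fin by (simp add: sum.If_cases Int_def)
  have h0: "h \<ge> 0" "z \<ge> 0" by (auto simp: h_def z_def)
  have mu0: "\<mu> \<ge> 0" unfolding \<mu>_def by (intro sum_nonneg) auto
  have muh: "\<mu> = (\<Sum>q\<in>\<Q>. h / real q)" by (simp add: \<mu>_def h_def)
  have q1: "real q \<ge> 1" if "q \<in> \<Q>" for q using pr[OF that] prime_ge_1_nat[of q] by simp
  have muz: "\<mu> \<le> h * z"
  proof -
    have "\<mu> \<le> (\<Sum>q\<in>\<Q>. h)" unfolding muh
    proof (rule sum_mono)
      fix q assume "q \<in> \<Q>"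
      then show "h / real q \<le> h" using q1[of q] h0 by (simp add: divide_le_eq mult_le_cancel_left1)
    qed
    then show ?thesis by (simp add: z_def mult.commute)
  qed
  have sI: "(\<Sum>t<H. I q t) = real (card {t. t < H \<and> Q * t mod q \<in> A})" for q
    unfolding I_def by (simp add: sum.If_cases Int_def lessThan_def)
  have sII: "(\<Sum>t<H. I q t * I q' t) = real (card {t. t < H \<and> Q * t mod q \<in> A \<and> Q * t mod q' \<in> A})" for q q'
  proof -
    have "(\<Sum>t<H. I q t * I q' t) = (\<Sum>t<H. if Q * t mod q \<in> A \<and> Q * t mod q' \<in> A then 1 else 0)"
      unfolding I_def by (intro sum.cong) auto
    then show ?thesis by (simp add: sum.If_cases Int_def lessThan_def)
  qed
  have lower: "(\<Sum>t<H. X t) \<ge> real H * \<mu> - h * z"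
  proof -
    have "(\<Sum>t<H. X t) = (\<Sum>q\<in>\<Q>. \<Sum>t<H. I q t)" unfolding X by (rule sum.swap)
    also have "\<dots> \<ge> (\<Sum>q\<in>\<Q>. h * (real H / real q - 1))"
    proof (rule sum_mono)
      fix q assume "q \<in> \<Q>"
      then show "h * (real H / real q - 1) \<le> (\<Sum>t<H. I q t)" unfolding sI h_def
        using pr[of q] prime_gt_0_nat by (intro card_mult_mod_bounds(2)) auto
    qed
    also have "(\<Sum>q\<in>\<Q>. h * (real H / real q - 1)) = real H * \<mu> - h * z"
      unfolding muh by (simp add: sum_subtractf right_diff_distrib sum_distrib_left z_def mult.commute)
    finally show ?thesis .
  qed
  have upper: "(\<Sum>t<H. (X t)\<^sup>2) \<le> real H * \<mu> + h * z + real H * \<mu>\<^sup>2 + (h * z)\<^sup>2"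
  proof -
    have "(\<Sum>t<H. (X t)\<^sup>2) = (\<Sum>t<H. \<Sum>q\<in>\<Q>. \<Sum>q'\<in>\<Q>. I q t * I q' t)"
      unfolding X power2_eq_square sum_product ..
    also have "\<dots> = (\<Sum>q\<in>\<Q>. \<Sum>t<H. \<Sum>q'\<in>\<Q>. I q t * I q' t)" by (rule sum.swap)
    also have "\<dots> = (\<Sum>q\<in>\<Q>. \<Sum>q'\<in>\<Q>. \<Sum>t<H. I q t * I q' t)"
      by (intro sum.cong refl sum.swap)
    \<comment> \<open>The off-diagonal bound is added on the diagonal as well, so that its main part
      factors into the square of \<mu>.\<close>
    also have "\<dots> \<le> (\<Sum>q\<in>\<Q>. \<Sum>q'\<in>\<Q>. (if q = q' then h * (real H / real q + 1) else 0)
        + h\<^sup>2 * (real H / (real q * real q') + 1))"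
    proof (intro sum_mono)
      fix q q' assume qq: "q \<in> \<Q>" "q' \<in> \<Q>"
      show "(\<Sum>t<H. I q t * I q' t) \<le> (if q = q' then h * (real H / real q + 1) else 0)
        + h\<^sup>2 * (real H / (real q * real q') + 1)"
      proof (cases "q = q'")
        case True
        have "(\<Sum>t<H. I q t * I q' t) \<le> h * (real H / real q + 1)"
          unfolding sII h_def using pr[OF qq(1)] prime_gt_0_nat card_mult_mod_bounds(1)[of q Q A H]
          by (auto simp: True)
        moreover have "h\<^sup>2 * (real H / (real q * real q') + 1) \<ge> 0" by simp
        ultimately show ?thesis unfolding if_P[OF True] by linarith
      next
        case False
        then have "coprime q q'" using pr qq by (simp add: primes_coprime)
        then show ?thesis using False pr[OF qq(1)] pr[OF qq(2)] prime_gt_0_nat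
          card_mult_mod_pair_bound[of q q' Q A H] finA
          by (simp add: sII h_def)
      qed
    qed
    also have "\<dots> = (\<Sum>q\<in>\<Q>. h * (real H / real q + 1)) + (\<Sum>q\<in>\<Q>. \<Sum>q'\<in>\<Q>. h\<^sup>2 * (real H / (real q * real q') + 1))"
      using fin by (simp add: sum.distrib)
    also have "(\<Sum>q\<in>\<Q>. h * (real H / real q + 1)) = real H * \<mu> + h * z"
      unfolding muh by (simp add: sum.distrib distrib_left sum_distrib_left z_def mult.commute)
    also have "(\<Sum>q\<in>\<Q>. \<Sum>q'\<in>\<Q>. h\<^sup>2 * (real H / (real q * real q') + 1))
       = real H * \<mu>\<^sup>2 + (h * z)\<^sup>2"
    proof -
      have "real H * \<mu>\<^sup>2 = real H * (\<Sum>q\<in>\<Q>. \<Sum>q'\<in>\<Q>. (h / real q) * (h / real q'))"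
        by (simp only: muh power2_eq_square sum_product)
      also have "\<dots> = (\<Sum>q\<in>\<Q>. \<Sum>q'\<in>\<Q>. real H * ((h / real q) * (h / real q')))"
        by (simp only: sum_distrib_left)
      also have "\<dots> = (\<Sum>q\<in>\<Q>. \<Sum>q'\<in>\<Q>. h\<^sup>2 * (real H / (real q * real q')))"
        by (intro sum.cong refl) (simp add: power2_eq_square)
      finally have "real H * \<mu>\<^sup>2 = \<dots>" .
      moreover have "(h * z)\<^sup>2 = (\<Sum>q\<in>\<Q>. \<Sum>q'\<in>\<Q>. h\<^sup>2)" by (simp add: z_def power2_eq_square)
      ultimately show ?thesis by (simp add: distrib_left sum.distrib)
    qed
    finally show ?thesis by (simp add: add.assoc)
  qed
  have var: "(\<Sum>t<H. (X t - \<mu>)\<^sup>2) \<le> real H * \<mu> + 4 * (h * z)\<^sup>2"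
  proof -
    have "(\<Sum>t<H. (X t - \<mu>)\<^sup>2) = (\<Sum>t<H. (X t)\<^sup>2) - 2 * \<mu> * (\<Sum>t<H. X t) + real H * \<mu>\<^sup>2"
      by (simp add: power2_diff sum.distrib sum_subtractf sum_distrib_left sum_distrib_right algebra_simps)
    also have "\<dots> \<le> (real H * \<mu> + h * z + real H * \<mu>\<^sup>2 + (h * z)\<^sup>2) - 2 * \<mu> * (real H * \<mu> - h * z) + real H * \<mu>\<^sup>2"
      using upper mult_left_mono[OF lower, of "2 * \<mu>"] mu0 by linarith
    also have "\<dots> = real H * \<mu> + h * z + (h * z)\<^sup>2 + 2 * (\<mu> * (h * z))"
      by (simp add: algebra_simps power2_eq_square)
    finally have v: "(\<Sum>t<H. (X t - \<mu>)\<^sup>2) \<le> real H * \<mu> + h * z + (h * z)\<^sup>2 + 2 * (\<mu> * (h * z))" .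
    have v1: "\<mu> * (h * z) \<le> (h * z)\<^sup>2" unfolding power2_eq_square
      using muz h0 by (intro mult_right_mono) auto
    \<comment> \<open>Both cardinalities are natural numbers, and a natural number is at most its
      square.\<close>
    have v2: "h * z \<le> (h * z)\<^sup>2"
    proof -
      have "h * z = real (card A * card \<Q>)" by (simp add: h_def z_def)
      also have "\<dots> \<le> real ((card A * card \<Q>)\<^sup>2)" by (subst of_nat_le_iff) (simp add: power2_eq_square)
      finally show ?thesis by (simp add: h_def z_def)
    qed
    show ?thesis using v v1 v2 by linarith
  qed
  define Bad where "Bad = {t. t < H \<and> X t < \<mu> / 2}"
  have "real (card Bad) * (\<mu>\<^sup>2 / 4) = (\<Sum>t\<in>Bad. \<mu>\<^sup>2 / 4)" by simp
  also have "\<dots> \<le> (\<Sum>t\<in>Bad. (X t - \<mu>)\<^sup>2)"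
  proof (rule sum_mono)
    fix t assume "t \<in> Bad"
    then have "\<mu> / 2 \<le> \<mu> - X t" by (simp add: Bad_def)
    then have "(\<mu> / 2)\<^sup>2 \<le> (\<mu> - X t)\<^sup>2" using mu0 by (intro power_mono) auto
    then show "\<mu>\<^sup>2 / 4 \<le> (X t - \<mu>)\<^sup>2" by (simp add: power_divide power2_commute)
  qed
  also have "\<dots> \<le> (\<Sum>t<H. (X t - \<mu>)\<^sup>2)" by (rule sum_mono2) (auto simp: Bad_def)
  finally have "real (card Bad) * (\<mu>\<^sup>2 / 4) \<le> real H * \<mu> + 4 * (h * z)\<^sup>2" using var by linarith
  then show ?thesis unfolding Bad_def X_def h_def z_def by simp
qed

section \<open>The covering\<close>

text \<open>Gives each uncovered number a prime of its own, which then takes the class of that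
  number.\<close>

lemma obtain_assignment:
  fixes E :: "'a set" and S :: "'b set"
  assumes "finite E" "finite S" "card E \<le> card S"
  obtains T \<tau> where "T \<subseteq> S" "\<tau> ` T = E" "card T = card E"
proof -
  obtain f where f: "f ` E \<subseteq> S" "inj_on f E" using card_le_inj[OF assms] by blast
  have "inv_into E f ` (f ` E) = E" using f(2) by (auto simp: image_image)
  with f that[of "f ` E" "inv_into E f"] show ?thesis by (simp add: card_image)
qed

text \<open>
  C2, ..., C5 are the supplies of primes for the later stages. The condition that r divides both k and
  k mod q makes the multiple of q next to k divisible by r, so it stays covered; the prime divisor
  outside W of k div q plays the same role for C4.
\<close>

lemma covering_assignment:
  fixes k Z y1 y2 y4 U r q0 s0 M :: nat and B :: real and W T1 C2 C3 C4 C5 :: "nat set"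
  defines "W \<equiv> {p. prime p \<and> real p < B}"
  defines "n1 \<equiv> card (smooth_upto W k)" and "n2 \<equiv> card (smooth_upto (W \<union> insert q0 T1) k)"
  assumes k: "k > 0" and finT1: "finite T1" and q0: "q0 \<notin> T1"
    and T1: "\<And>q. q \<in> insert q0 T1 \<Longrightarrow> prime q \<and> y2 < q \<and> q < U \<and> q dvd k"
    and r: "prime r" "B \<le> real r" "r \<le> y2" "r dvd k"
    and ord: "y1 \<le> y2" "y2 \<le> y4" "y4 \<le> U" "2 * U < Z" "2 * Z \<le> k" "k < U ^ 3"
    and cT1: "card {j \<in> smooth_upto W k. j < y1} \<le> card T1"
    and C2: "\<And>q. q \<in> C2 \<Longrightarrow> prime q \<and> U < q \<and> q \<le> 2 * U \<and> k mod q < y1 \<and> r dvd k mod q"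
    and cC2: "n1 \<le> card C2"
    and C3: "\<And>q. q \<in> C3 \<Longrightarrow> prime q \<and> U < q \<and> q \<le> 2 * U \<and> k mod q < y2 \<and> r dvd k mod q"
    and cC3: "n1 + n2 \<le> card C3"
    and top: "\<And>j. j \<in> smooth_upto (W \<union> insert q0 T1) k \<Longrightarrow> j + y4 \<le> k"
    and C4: "\<And>q. q \<in> C4 \<Longrightarrow> prime q \<and> Z \<le> q \<and> k mod q < y4 \<and> k div q \<le> y2
        \<and> (\<exists>p. prime p \<and> p \<notin> W \<and> p dvd k div q)"
    and cC4: "n2 * (n1 + n2 + 1)\<^sup>2 \<le> M" "M \<le> card C4"
    and s0: "0 < s0" "s0 < q0"
    and C5: "\<And>p. p \<in> C5 \<Longrightarrow> prime p \<and> k < 2 * p \<and> p \<le> k \<and> k < p + Z \<and> p mod q0 = s0"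
    and cC5: "M * (1 + k div Z) \<le> card C5"
  obtains sh where "\<And>p. prime p \<Longrightarrow> p \<le> k \<Longrightarrow> sh p = 0 \<or> (k mod p < sh p \<and> sh p < p)"
    and "\<And>j. 1 \<le> j \<Longrightarrow> j \<le> k \<Longrightarrow> \<exists>p. prime p \<and> p \<le> k \<and> B \<le> real p \<and> j mod p = sh p"
proof -
  define V where "V = W \<union> insert q0 T1"
  have qk: "q \<le> k" if "q dvd k" for q using that k by (simp add: dvd_imp_le)
  have UZ: "U < Z" "Z \<le> k" "2 * U < k" "2 * U < Z" "2 * Z \<le> k" using ord by linarith+
  have fC2: "finite C2" by (rule finite_subset[of _ "{..2 * U}"]) (use C2 in auto)
  have fC3: "finite C3" by (rule finite_subset[of _ "{..2 * U}"]) (use C3 in auto)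
  have C4k: "q \<le> k" if "q \<in> C4" for q
  proof (rule ccontr)
    assume "\<not> q \<le> k"
    then have "k div q = 0" "k mod q = k" by auto
    then show False using C4[OF that] ord by auto
  qed
  have fC4: "finite C4" by (rule finite_subset[of _ "{..k}"]) (use C4k in auto)
  have fC5: "finite C5" by (rule finite_subset[of _ "{..k}"]) (use C5 in auto)

  \<comment> \<open>Near 0 only those given-up primes matter that do not exceed \<open>j\<close>:
    the ones in \<open>insert q0 T1\<close> exceed \<open>y2\<close>, the ones of size
    \<open>U\<close> exceed \<open>y4\<close>, and those of the fourth stage are at least
    \<open>Z\<close>.\<close>
  define E1 where "E1 = {j \<in> smooth_upto W k. j < y1}"
  define E2 where "E2 = {j \<in> smooth_upto W k. y1 \<le> j \<and> j < y2}"
  define E3 where "E3 = {j \<in> smooth_upto V k. y2 \<le> j \<and> j < y4}"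
  have fE: "finite E1" "finite E2" "finite E3" by (auto simp: E1_def E2_def E3_def)
  obtain T1a \<tau>1 where T1a: "T1a \<subseteq> T1" "\<tau>1 ` T1a = E1" "card T1a = card E1"
    using obtain_assignment[OF fE(1) finT1] cT1 unfolding E1_def by blast
  have "card E2 \<le> n1" unfolding n1_def E2_def by (intro card_mono) auto
  then obtain T2 \<tau>2 where T2: "T2 \<subseteq> C2" "\<tau>2 ` T2 = E2" "card T2 = card E2"
    using obtain_assignment[OF fE(2) fC2] cC2 by (metis le_trans)
  have fT2: "finite T2" using T2(1) fC2 finite_subset by blast
  have E3c: "card E3 \<le> n2" unfolding n2_def E3_def V_def by (intro card_mono) auto
  \<comment> \<open>\<open>C2\<close> and \<open>C3\<close> may share primes. At most
    \<open>n1\<close> of them are already used in \<open>T2\<close>, whence the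
    \<open>n1 + n2\<close> demanded of \<open>C3\<close>.\<close>
  have "n2 \<le> card (C3 - T2)"
    using diff_card_le_card_Diff[OF fT2, of C3] cC3 T2(3) \<open>card E2 \<le> n1\<close> by linarith
  then obtain T3 \<tau>3 where T3: "T3 \<subseteq> C3 - T2" "\<tau>3 ` T3 = E3" "card T3 = card E3"
    using obtain_assignment[OF fE(3), of "C3 - T2"] fC3 E3c by (metis le_trans finite_Diff)
  have fT3: "finite T3" using T3(1) fC3 finite_subset by blast
  define T23 where "T23 = T2 \<union> T3"
  have fT23: "finite T23" using fT2 fT3 by (simp add: T23_def)
  have T23: "prime q \<and> U < q \<and> q \<le> 2 * U \<and> k mod q < y2 \<and> r dvd k mod q" if "q \<in> T23" for q
  proof (cases "q \<in> T2")
    case True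
    then have "q \<in> C2" using T2(1) by auto
    from C2[OF this] ord(1) show ?thesis by auto
  next
    case False
    then have "q \<in> C3" using that T3(1) by (auto simp: T23_def)
    from C3[OF this] show ?thesis by auto
  qed
  have cT23: "card T23 \<le> n1 + n2"
    using card_Un_le[of T2 T3] T2(3) T3(3) E3c \<open>card E2 \<le> n1\<close> unfolding T23_def by linarith
  define E4 where "E4 = {j \<in> smooth_upto (V \<union> T23) k. y4 \<le> j \<and> j + y4 \<le> k \<and> (j < Z \<or> k < j + Z)}"
  \<comment> \<open>As \<open>k < U ^ 3\<close>, a number up to \<open>k\<close> has at most two
    factors from \<open>T23\<close>; this is the square in the bound for \<open>M\<close>.\<close>
  have cV23: "card (smooth_upto (V \<union> T23) k) \<le> M"
  proof -
    have 1: "card (smooth_upto (V \<union> T23) k) \<le> n2 * card (smooth_upto T23 k)"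
      unfolding n2_def V_def by (rule card_smooth_upto_Un)
    have "U > 0" using ord by (intro gr0I) auto
    moreover have "k < U ^ Suc 2" using ord by (simp add: eval_nat_numeral)
    moreover have "\<And>v. v \<in> T23 \<Longrightarrow> U \<le> v" using T23 by (auto intro: less_imp_le)
    ultimately have "card (smooth_upto T23 k) \<le> (card T23 + 1) ^ 2"
      using card_smooth_upto_le_large[OF fT23, of U k 2] by blast
    also have "\<dots> \<le> (n1 + n2 + 1)\<^sup>2" using cT23 by (intro power_mono) auto
    finally have "n2 * card (smooth_upto T23 k) \<le> n2 * (n1 + n2 + 1)\<^sup>2" by (rule mult_le_mono2)
    then show ?thesis using 1 cC4(1) by linarith
  qed
  have fE4: "finite E4" by (simp add: E4_def)
  have cE4: "card E4 \<le> M"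
  proof -
    have "card E4 \<le> card (smooth_upto (V \<union> T23) k)"
      unfolding E4_def by (intro card_mono) auto
    then show ?thesis using cV23 by linarith
  qed
  obtain T4 \<tau>4 where T4: "T4 \<subseteq> C4" "\<tau>4 ` T4 = E4" "card T4 = card E4"
    using obtain_assignment[OF fE4 fC4] cE4 cC4(2) by (metis le_trans)
  have fT4: "finite T4" using T4(1) fC4 finite_subset by blast
  define E5 where "E5 = {j \<in> smooth_upto (V \<union> T23 \<union> T4) k. Z \<le> j \<and> j + Z \<le> k}"
  have fE5: "finite E5" by (simp add: E5_def)
  have "card E5 \<le> M * (1 + k div Z)"
  proof -
    \<comment> \<open>Either no prime of \<open>T4\<close> divides \<open>j\<close>, or j = q m with
      q \<ge> Z, which leaves at most \<open>k div Z\<close> cofactors.\<close>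
    have sub: "E5 \<subseteq> smooth_upto (V \<union> T23) k \<union> (\<lambda>(q, m). q * m) ` (T4 \<times> {1..k div Z})"
    proof
      fix j assume j: "j \<in> E5"
      show "j \<in> smooth_upto (V \<union> T23) k \<union> (\<lambda>(q, m). q * m) ` (T4 \<times> {1..k div Z})"
      proof (cases "\<exists>q\<in>T4. q dvd j")
        case True
        then obtain q m where q: "q \<in> T4" "j = q * m" by (blast elim: dvdE)
        have jk: "j \<le> k" "j > 0" using j UZ by (auto simp: E5_def smooth_upto_def)
        have "Z \<le> q" using q T4(1) C4 by auto
        then have "Z * m \<le> k" using q(2) jk by (meson le_trans mult_le_mono1)
        then have "m \<le> k div Z" using UZ(1) by (simp add: less_eq_div_iff_mult_less_eq mult.commute)
        moreover have "m \<ge> 1" using q(2) jk by (cases m) auto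
        ultimately show ?thesis using q by (intro UnI2 image_eqI[of _ _ "(q, m)"]) auto
      next
        case False
        then show ?thesis using j by (auto simp: E5_def smooth_upto_def)
      qed
    qed
    have "card E5 \<le> card (smooth_upto (V \<union> T23) k \<union> (\<lambda>(q, m). q * m) ` (T4 \<times> {1..k div Z}))"
      using sub fT4 by (intro card_mono) auto
    also have "\<dots> \<le> card (smooth_upto (V \<union> T23) k) + card ((\<lambda>(q, m). q * m) ` (T4 \<times> {1..k div Z}))"
      by (rule card_Un_le)
    finally have 1: "card E5 \<le> card (smooth_upto (V \<union> T23) k) + card ((\<lambda>(q, m). q * m) ` (T4 \<times> {1..k div Z}))" .
    have "card ((\<lambda>(q, m). q * m) ` (T4 \<times> {1..k div Z})) \<le> card (T4 \<times> {1..k div Z})"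
      using fT4 by (intro card_image_le) auto
    also have "\<dots> \<le> M * (k div Z)" using cE4 T4(3) by (simp add: card_cartesian_product)
    finally have "card ((\<lambda>(q, m). q * m) ` (T4 \<times> {1..k div Z})) \<le> M * (k div Z)" .
    with 1 cV23 show ?thesis unfolding distrib_left mult_1_right by linarith
  qed
  then obtain T5 \<tau>5 where T5: "T5 \<subseteq> C5" "\<tau>5 ` T5 = E5" "card T5 = card E5"
    using obtain_assignment[OF fE5 fC5] cC5 by (metis le_trans)

  \<comment> \<open>The reduction modulo \<open>p\<close> has an effect only on \<open>T4\<close>,
    where the assigned number may lie near \<open>k\<close> and exceed \<open>p\<close>; in all
    other stages it is already below \<open>p\<close>.\<close>
  define sh where "sh = (\<lambda>p. if p \<in> T1a then \<tau>1 p mod p else if p \<in> T2 then \<tau>2 p mod p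
    else if p \<in> T3 then \<tau>3 p mod p else if p \<in> T4 then \<tau>4 p mod p
    else if p \<in> T5 then \<tau>5 p mod p else if p = q0 then s0 else 0)"
  have pT1a: "prime q \<and> y2 < q \<and> q < U \<and> q dvd k \<and> q \<noteq> q0" if "q \<in> T1a" for q
    using that T1a(1) T1[of q] q0 by blast
  have pq0: "prime q0 \<and> y2 < q0 \<and> q0 < U \<and> q0 dvd k" using T1 by auto
  have pT4: "prime q \<and> Z \<le> q \<and> k mod q < y4 \<and> k div q \<le> y2 \<and> 2 \<le> k div q" if "q \<in> T4" for q
  proof -
    have q: "q \<in> C4" using that T4(1) by auto
    obtain p where p: "prime p" "p dvd k div q" using C4[OF q] by blast
    have "k div q > 0" using C4k[OF q] C4[OF q] UZ by (simp add: div_greater_zero_iff)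
    then have "p \<le> k div q" using p dvd_imp_le by blast
    then show ?thesis using C4[OF q] prime_ge_2_nat[OF p(1)] by auto
  qed
  have pT5: "prime p \<and> k < 2 * p \<and> p \<le> k \<and> k < p + Z \<and> p mod q0 = s0" if "p \<in> T5" for p
    using that T5(1) C5 by blast
  have T45: "q \<notin> T5" if "q \<in> T4" for q
  proof
    assume "q \<in> T5"
    then have "k < 2 * q" using pT5 by blast
    then have "k div q < 2" by (simp add: less_mult_imp_div_less)
    then show False using pT4[OF that] by simp
  qed
  have sh1: "sh q = \<tau>1 q mod q" if "q \<in> T1a" for q using that by (simp add: sh_def)
  have sh2: "sh q = \<tau>2 q mod q" if "q \<in> T2" for q
    using that pT1a[of q] T23[of q] by (auto simp: sh_def T23_def)
  have sh3: "sh q = \<tau>3 q mod q" if "q \<in> T3" for q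
    using that pT1a[of q] T23[of q] T3(1) by (auto simp: sh_def T23_def)
  have sh4: "sh q = \<tau>4 q mod q" if "q \<in> T4" for q
    using that pT1a[of q] T23[of q] pT4[of q] ord UZ by (auto simp: sh_def T23_def)
  have sh5: "sh q = \<tau>5 q mod q" if "q \<in> T5" for q
    using that pT1a[of q] T23[of q] pT5[of q] T45[of q] UZ by (auto simp: sh_def T23_def)
  have shq0: "sh q0 = s0"
    using pT1a[of q0] T23[of q0] pT5[of q0] pT4[of q0] pq0 UZ by (auto simp: sh_def T23_def)
  define S where "S = T1a \<union> T2 \<union> T3 \<union> T4 \<union> T5 \<union> {q0}"
  have sh0: "sh q = 0" if "q \<notin> S" for q using that by (simp add: sh_def S_def)
  have bigS: "q > y2 \<and> q \<le> k \<and> prime q" if "q \<in> S" for q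
    using that pT1a[of q] T23[of q] pT5[of q] pT4[of q] pq0 UZ ord(1-3) C4k[of q] T4(1) qk[of q]
    by (auto simp: S_def T23_def)
  have BS: "B \<le> real q" if "q \<in> S" for q using bigS[OF that] r by linarith

  have "sh p = 0 \<or> (k mod p < sh p \<and> sh p < p)" if p: "prime p" "p \<le> k" for p
  proof -
    consider "p \<in> T1a" | "p \<in> T2" | "p \<in> T3" | "p \<in> T4" | "p \<in> T5" | "p = q0" | "p \<notin> S"
      by (auto simp: S_def)
    then show ?thesis
    proof cases
      case 1
      then have j: "\<tau>1 p \<in> E1" using T1a by auto
      then have "\<tau>1 p < p" "\<tau>1 p > 0" using pT1a[OF 1] ord(1) by (auto simp: E1_def smooth_upto_def)
      then show ?thesis using sh1[OF 1] pT1a[OF 1] by (simp add: mod_eq_0_iff_dvd)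
    next
      case 2
      then have j: "\<tau>2 p \<in> E2" using T2 by auto
      have c: "k mod p < y1" "U < p" using 2 T2(1) C2 by auto
      then have "\<tau>2 p < p" "k mod p < \<tau>2 p" using j ord(1-3) by (auto simp: E2_def)
      then show ?thesis using sh2[OF 2] by simp
    next
      case 3
      then have j: "\<tau>3 p \<in> E3" using T3 by auto
      have c: "k mod p < y2" "U < p" using 3 T3(1) C3 by auto
      then have "\<tau>3 p < p" "k mod p < \<tau>3 p" using j ord(1-3) by (auto simp: E3_def)
      then show ?thesis using sh3[OF 3] by simp
    next
      case 4
      define j where "j = \<tau>4 p"
      have j: "j \<in> E4" using T4 4 by (auto simp: j_def)
      note q = pT4[OF 4]
      show ?thesis
      proof (cases "j < Z")
        case True
        then have "j < p" "k mod p < j" using q j by (auto simp: E4_def)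
        then show ?thesis using sh4[OF 4] by (simp add: j_def)
      next
        \<comment> \<open>Near the right end, j = k - i has residue \<open>p + k mod p - i\<close>.
          Here i \<ge> y4 > k mod p keeps it below \<open>p\<close>, and i < Z \<le> p keeps it
          above \<open>k mod p\<close>.\<close>
        case False
        then have jj: "k < j + Z" "j + y4 \<le> k" using j by (auto simp: E4_def)
        define i where "i = k - j"
        have i: "k = j + i" "y4 \<le> i" "i < Z" using jj by (auto simp: i_def)
        obtain d where d: "k div p = Suc d" using q by (cases "k div p") auto
        have "p * Suc d + k mod p = k" using mult_div_mod_eq[of p k] unfolding d .
        then have "j + i = (p + k mod p) + p * d" using i(1) mult_Suc_right[of p d] by linarith
        then have "j = (p + k mod p - i) + p * d" using i q by linarith
        moreover have "p + k mod p - i < p" using i q by linarith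
        ultimately have "j mod p = p + k mod p - i" by simp
        then have "sh p = p + k mod p - i" using sh4[OF 4] by (simp add: j_def)
        then show ?thesis using i q by linarith
      qed
    next
      case 5
      then have j: "\<tau>5 p \<in> E5" using T5 by auto
      note q = pT5[OF 5]
      have "k div p = 1" using q by (intro div_nat_eqI) auto
      then have "k mod p = k - p" by (simp add: modulo_nat_def)
      then have "\<tau>5 p < p" "k mod p < \<tau>5 p" using q j by (auto simp: E5_def)
      then show ?thesis using sh5[OF 5] by simp
    next
      case 6
      then show ?thesis using shq0 s0 pq0 by (simp add: mod_eq_0_iff_dvd)
    next
      case 7
      then show ?thesis using sh0 by simp
    qed
  qed
  moreover have "\<exists>p. prime p \<and> p \<le> k \<and> B \<le> real p \<and> j mod p = sh p" if j: "1 \<le> j" "j \<le> k" for j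
  proof (cases "\<exists>p. prime p \<and> p dvd j \<and> p \<notin> W \<and> p \<notin> S")
    case True
    then obtain p where p: "prime p" "p dvd j" "p \<notin> W" "p \<notin> S" by blast
    have "p \<le> j" using p(2) j(1) by (simp add: dvd_imp_le)
    then show ?thesis using p sh0[OF p(4)] j(2) by (intro exI[of _ p]) (auto simp: W_def)
  next
    case False
    have dn: ?thesis if "q \<in> S" "j mod q = sh q" for q
      using that bigS[of q] BS[of q] by blast
    have cov: ?thesis if h: "j \<in> E" "\<tau> ` T = E" "T \<subseteq> S" "\<And>q. q \<in> T \<Longrightarrow> sh q = \<tau> q mod q" for \<tau> T E
    proof -
      obtain q where "q \<in> T" "j = \<tau> q" using h(1,2) by blast
      then show ?thesis using dn[of q] h(3,4) by auto
    qed
    have cov1: ?thesis if "j \<in> E1"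
      using cov[OF that T1a(2)] sh1 by (auto simp: S_def)
    have cov2: ?thesis if "j \<in> E2"
      using cov[OF that T2(2)] sh2 by (auto simp: S_def)
    have cov3: ?thesis if "j \<in> E3"
      using cov[OF that T3(2)] sh3 by (auto simp: S_def)
    have cov4: ?thesis if "j \<in> E4"
      using cov[OF that T4(2)] sh4 by (auto simp: S_def)
    have cov5: ?thesis if "j \<in> E5"
      using cov[OF that T5(2)] sh5 by (auto simp: S_def)
    have sm: "j \<in> smooth_upto (W \<union> S) k" using False j by (auto simp: smooth_upto_def)
    have STV: "S \<subseteq> V \<union> T23 \<union> T4 \<union> T5" using T1a(1) by (auto simp: S_def V_def T23_def)
    show ?thesis
    \<comment> \<open>Since k < 2 p, the only multiple of such a prime is the prime itself, and it
      lies in the class \<open>s0\<close> of \<open>q0\<close>.\<close>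
    proof (cases "\<exists>p\<in>T5. p dvd j")
      case True
      then obtain p m where p: "p \<in> T5" "j = p * m" by (blast elim: dvdE)
      have "m = 1"
      proof (rule ccontr)
        assume "m \<noteq> 1"
        then have "m \<ge> 2" using p j by (cases m) auto
        then have "p * 2 \<le> j" unfolding p(2) by (rule mult_le_mono2)
        then show False using pT5[OF p(1)] j by simp
      qed
      then have "j mod q0 = s0" using pT5[OF p(1)] p(2) by simp
      then show ?thesis using dn[of q0] shq0 by (simp add: S_def)
    next
      case no5: False
      show ?thesis
      proof (cases "\<exists>q\<in>T4. q dvd j")
        case True
        then obtain q m where q: "q \<in> T4" "j = q * m" by (blast elim: dvdE)
        note q4 = pT4[OF q(1)]
        have mpos: "m \<ge> 1" using j q by (cases m) auto
        have Zj: "Z \<le> j" using q4 q(2) mpos by (metis le_trans mult.right_neutral mult_le_mono2)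
        have "j \<in> smooth_upto (V \<union> T23 \<union> T4) k"
          using sm no5 STV unfolding smooth_upto_def V_def by blast
        then have "j \<in> E5 \<or> k < j + Z" using Zj by (auto simp: E5_def)
        then show ?thesis
        proof
          \<comment> \<open>At distance less than \<open>Z\<close> \<le> \<open>q\<close> from
            \<open>k\<close>, \<open>j\<close> is the last multiple of \<open>q\<close>, so its
            cofactor is \<open>k div q\<close>. The prime divisor of this cofactor outside
            \<open>W\<close> is at most \<open>y2\<close> and therefore kept the class 0.\<close>
          assume c: "k < j + Z"
          have "m \<le> k div q" using q(2) j q4 UZ by (simp add: less_eq_div_iff_mult_less_eq mult.commute)
          moreover have "k div q < m + 1"
          proof -
            have "k < q * (m + 1)" using c q(2) q4 by simp
            then show ?thesis by (simp add: less_mult_imp_div_less mult.commute)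
          qed
          ultimately have m: "m = k div q" by simp
          obtain p where p: "prime p" "p \<notin> W" "p dvd k div q"
            using C4[of q] q(1) T4(1) by blast
          have "p \<le> k div q" using p(3) q4 by (intro dvd_imp_le) auto
          then have "p \<notin> S" using bigS[of p] q4 by linarith
          moreover have "p dvd j" using q(2) m p(3) by simp
          ultimately show ?thesis using False p by blast
        qed (rule cov5)
      next
        case no4: False
        have sm23: "j \<in> smooth_upto (V \<union> T23) k"
          using sm no5 no4 STV unfolding smooth_upto_def V_def by blast
        consider "Z \<le> j \<and> j + Z \<le> k" | "k < j + y4" | "j < y4"
          | "y4 \<le> j \<and> j + y4 \<le> k \<and> (j < Z \<or> k < j + Z)" by linarith
        then show ?thesis
        proof cases
          case 1
          then have "j \<in> E5" using sm23 by (auto simp: E5_def smooth_upto_def)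
          then show ?thesis by (rule cov5)
        next
          case 2
          show ?thesis
          proof (cases "\<exists>q\<in>T23. q dvd j")
            case True
            then obtain q m where q: "q \<in> T23" "j = q * m" by (blast elim: dvdE)
            note q23 = T23[OF q(1)]
            \<comment> \<open>At distance below \<open>y4\<close> \<le> \<open>U\<close> <
              \<open>q\<close> from \<open>k\<close> only the last multiple of \<open>q\<close> can
              occur.\<close>
            have "k - j = k mod q"
            proof -
              have "k = (k - j) + q * m" using q(2) j by simp
              then have "(k - j) mod q = k mod q" by (metis mod_mult_self2)
              moreover have "k - j < q" using 2 q23 ord j by linarith
              ultimately show ?thesis by simp
            qed
            then have "r dvd k - j" using q23 by simp
            then have "r dvd j" using r(4) j(2) by (metis dvd_diffD1)
            moreover have "r \<notin> W" using r(2) by (simp add: W_def)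
            moreover have "r \<notin> S" using bigS[of r] r(3) by linarith
            ultimately show ?thesis using False r(1) by blast
          next
            case no23: False
            then have "j \<in> smooth_upto V k" using sm23 by (auto simp: smooth_upto_def)
            then show ?thesis using top[of j] 2 by (simp add: V_def)
          qed
        next
          case 3
          have "j \<in> smooth_upto V k"
          proof -
            have "q \<notin> T23" if "q dvd j" for q
              using dvd_imp_le[OF that] T23[of q] 3 ord j by auto
            then show ?thesis using sm23 by (auto simp: smooth_upto_def)
          qed
          show ?thesis
          proof (cases "y2 \<le> j")
            case True
            then have "j \<in> E3" using 3 \<open>j \<in> smooth_upto V k\<close> by (auto simp: E3_def)
            then show ?thesis by (rule cov3)
          next
            case small: False
            have "j \<in> smooth_upto W k"
            proof -
              have "q \<notin> insert q0 T1" if "q dvd j" for q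
                using dvd_imp_le[OF that] T1[of q] small j by auto
              then show ?thesis using \<open>j \<in> smooth_upto V k\<close> by (auto simp: smooth_upto_def V_def)
            qed
            then have "j \<in> E1 \<or> j \<in> E2" using small by (auto simp: E1_def E2_def)
            then show ?thesis using cov1 cov2 by blast
          qed
        next
          case 4
          then have "j \<in> E4" using sm23 by (auto simp: E4_def)
          then show ?thesis by (rule cov4)
        qed
      qed
    qed
  qed
  ultimately show ?thesis by (rule that)
qed

section \<open>The choice of k\<close>

lemma card_multiples_in_interval:
  fixes Q n y H :: nat
  assumes Q: "Q > 0" and le: "n + y \<le> Q * H"
  shows "y div Q \<le> card {t. t < H \<and> n \<le> Q * t \<and> Q * t < n + y}"
proof -
  define a where "a = (n + Q - 1) div Q"
  have a: "n \<le> Q * a" "Q * a < n + Q"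
  proof -
    have "n + Q - 1 < Q * Suc a" using dividend_less_times_div[OF Q, of "n + Q - 1"] unfolding a_def by simp
    then show "n \<le> Q * a" by simp
    have "Q * a \<le> n + Q - 1" unfolding a_def by (rule times_div_less_eq_dividend)
    then show "Q * a < n + Q" using Q by linarith
  qed
  have "(\<lambda>i. a + i) ` {..<y div Q} \<subseteq> {t. t < H \<and> n \<le> Q * t \<and> Q * t < n + y}"
  proof
    fix t assume "t \<in> (\<lambda>i. a + i) ` {..<y div Q}"
    then obtain i where i: "t = a + i" "i < y div Q" by auto
    have "Q * (i + 1) \<le> Q * (y div Q)" using i(2) by (intro mult_le_mono2) simp
    also have "\<dots> \<le> y" by simp
    finally have "Q * i + Q \<le> y" by simp
    then have lt: "Q * t < n + y" using a(2) unfolding i(1) distrib_left by linarith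
    then have "Q * t < Q * H" using le by linarith
    then have "t < H" by simp
    moreover have "n \<le> Q * t" using a(1) unfolding i(1) distrib_left by linarith
    ultimately show "t \<in> {t. t < H \<and> n \<le> Q * t \<and> Q * t < n + y}" using lt by simp
  qed
  then have "card ((\<lambda>i. a + i) ` {..<y div Q}) \<le> card {t. t < H \<and> n \<le> Q * t \<and> Q * t < n + y}"
    by (intro card_mono) auto
  then show ?thesis by (simp add: card_image)
qed

text \<open>Used to recover a prime q \<ge> Z from \<open>k mod q\<close> alone: q is the only such
  divisor of \<open>k - k mod q\<close>, a number below Z^2.\<close>

lemma prime_divisor_large_unique:
  fixes q q' n Z :: nat
  assumes "prime q" "prime q'" "Z \<le> q" "Z \<le> q'" "n < Z\<^sup>2" "n > 0" "q dvd n" "q' dvd n"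
  shows "q = q'"
proof (rule ccontr)
  assume "q \<noteq> q'"
  then have "coprime q q'" using assms by (simp add: primes_coprime)
  then have "q * q' dvd n" using assms by (simp add: divides_mult)
  then have "q * q' \<le> n" using assms by (simp add: dvd_imp_le)
  moreover have "Z\<^sup>2 \<le> q * q'" using assms unfolding power2_eq_square by (intro mult_le_mono) auto
  ultimately show False using assms by linarith
qed

text \<open>
  A pair (p, q) is charged to the multiples k of Q in the interval of length y4 that starts at the least
  multiple n of q above p. At most Z * y4 pairs are charged to any k, so a k that receives more than an
  average share outside Bad sees both many p and many q.
\<close>

lemma exists_popular_multiple:
  fixes N Q y4 Z \<omega> X H q0 :: nat and \<P> \<Q> W Bad :: "nat set" and \<tau> :: real
  assumes Q: "Q > 0" and H: "H = N div Q + 1"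
    and fin: "finite \<P>" "finite \<Q>"
    and \<P>: "\<And>p. p \<in> \<P> \<Longrightarrow> prime p \<and> N < 2 * p \<and> p + Z + \<omega> + y4 \<le> N"
    and \<Q>: "\<And>q. q \<in> \<Q> \<Longrightarrow> prime q \<and> Z \<le> q \<and> q \<le> Z + \<omega>"
    and ord: "y4 \<le> Z" "2 * Z + 2 * \<omega> \<le> N" "N < Z\<^sup>2" "N div Z + 1 \<le> X"
    and Bad: "finite Bad"
    and main: "real (card Bad) * (real Z * real y4) + \<tau> * real H
      < real (card \<Q>) * (real (card \<P>) - real (X * (\<omega> + y4)) - real (card (smooth_upto W X) * (Z + \<omega>))) * real (y4 div Q)"
    and \<tau>: "\<tau> > 0" and q0: "prime q0" "2 * q0 \<le> N"
  obtains t C4 C5 s0 where "t < H" "t \<notin> Bad" "N < 2 * (Q * t)" "Q * t \<le> N"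
    "\<And>q. q \<in> C4 \<Longrightarrow> prime q \<and> Z \<le> q \<and> Q * t mod q < y4 \<and> Q * t div q \<le> X
        \<and> (\<exists>p. prime p \<and> p \<notin> W \<and> p dvd Q * t div q)"
    "\<tau> \<le> real Z * real (card C4)" "0 < s0" "s0 < q0"
    "\<And>p. p \<in> C5 \<Longrightarrow> prime p \<and> Q * t < 2 * p \<and> p \<le> Q * t \<and> Q * t < p + Z \<and> p mod q0 = s0"
    "\<tau> \<le> real y4 * (real q0 * real (card C5))"
proof -
  have Z0: "Z > 0" using ord(3) by (intro gr0I) auto
  define n where "n = (\<lambda>(p, q). q * (p div q + 1) :: nat)"
  \<comment> \<open>The remainder condition makes the next multiple of \<open>q\<close> come at most
    Z - y4 after \<open>p\<close>, as q \<le> Z + \<omega>; hence any \<open>k\<close> charged by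
    the pair stays below p + Z. The other condition supplies a prime divisor of
    \<open>k div q\<close> outside \<open>W\<close>.\<close>
  define \<V> where "\<V> = {(p, q). p \<in> \<P> \<and> q \<in> \<Q> \<and> \<omega> + y4 \<le> p mod q \<and> p div q + 1 \<notin> smooth_upto W X}"
  have \<V>sub: "\<V> \<subseteq> \<P> \<times> \<Q>" by (auto simp: \<V>_def)
  have fV: "finite \<V>" by (rule finite_subset[OF \<V>sub]) (use fin in auto)
  have divX: "p div q + 1 \<le> X" if "p \<le> N" "q \<in> \<Q>" for p q
  proof -
    have "p div q \<le> p div Z" using that \<Q>[of q] Z0 by (intro div_le_mono2) auto
    also have "\<dots> \<le> N div Z" using that by (intro div_le_mono)
    finally have "p div q \<le> N div Z" .
    then show ?thesis using ord(4) by linarith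
  qed
  have ple: "p \<le> N" if "p \<in> \<P>" for p using \<P>[OF that] by linarith
  have n_eq: "n (p, q) = p + q - p mod q" "p < n (p, q)" if "q > 0" for p q
  proof -
    have 1: "q * (p div q) + p mod q = p" by (rule mult_div_mod_eq)
    have 2: "p mod q < q" using that by simp
    have 3: "n (p, q) = q + q * (p div q)" by (simp add: n_def)
    show "n (p, q) = p + q - p mod q" "p < n (p, q)" using 1 2 3 by linarith+
  qed
  have cardV: "real (card \<Q>) * (real (card \<P>) - real (X * (\<omega> + y4)) - real (card (smooth_upto W X) * (Z + \<omega>))) \<le> real (card \<V>)"
  proof -
    have each: "real (card \<P>) - real (X * (\<omega> + y4)) - real (card (smooth_upto W X) * (Z + \<omega>))
        \<le> real (card {p \<in> \<P>. (p, q) \<in> \<V>})" if q: "q \<in> \<Q>" for q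
    proof -
      \<comment> \<open>The two ways to fail, counted by quotient and remainder modulo
        \<open>q\<close>: \<open>R1\<close> allows \<open>\<omega> + y4\<close> remainders for each
        of at most \<open>X\<close> quotients, \<open>R2\<close> allows all remainders but only
        quotients just below a smooth number.\<close>
      define R1 where "R1 = {p \<in> \<P>. p mod q < \<omega> + y4}"
      define R2 where "R2 = {p \<in> \<P>. p div q + 1 \<in> smooth_upto W X}"
      have q1: "q > 0" "q \<le> Z + \<omega>" using \<Q>[OF q] prime_gt_0_nat by auto
      have inj: "inj_on (\<lambda>p. (p div q, p mod q)) S" for S
        by (rule inj_onI) (metis Pair_inject mult_div_mod_eq)
      have "card R1 \<le> card ({..<X} \<times> {..<\<omega> + y4})"
      proof (rule card_inj_on_le[OF inj])
        show "(\<lambda>p. (p div q, p mod q)) ` R1 \<subseteq> {..<X} \<times> {..<\<omega> + y4}"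
        proof
          fix x assume "x \<in> (\<lambda>p. (p div q, p mod q)) ` R1"
          then obtain p where p: "x = (p div q, p mod q)" "p \<in> R1" by blast
          then show "x \<in> {..<X} \<times> {..<\<omega> + y4}" using divX[OF ple[of p] q] by (auto simp: R1_def)
        qed
      qed simp
      then have c1: "card R1 \<le> X * (\<omega> + y4)" by (simp add: card_cartesian_product)
      have "card R2 \<le> card ((\<lambda>m. m - 1) ` smooth_upto W X \<times> {..<q})"
      proof (rule card_inj_on_le[OF inj])
        show "(\<lambda>p. (p div q, p mod q)) ` R2 \<subseteq> (\<lambda>m. m - 1) ` smooth_upto W X \<times> {..<q}"
        proof
          fix x assume "x \<in> (\<lambda>p. (p div q, p mod q)) ` R2"
          then obtain p where p: "x = (p div q, p mod q)" "p \<in> R2" by blast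
          then have "p div q \<in> (\<lambda>m. m - 1) ` smooth_upto W X"
            by (intro image_eqI[of _ _ "p div q + 1"]) (auto simp: R2_def)
          then show "x \<in> (\<lambda>m. m - 1) ` smooth_upto W X \<times> {..<q}" using p(1) q1(1) by auto
        qed
      qed simp
      also have "\<dots> = card ((\<lambda>m. m - 1) ` smooth_upto W X) * q" by (simp add: card_cartesian_product)
      also have "\<dots> \<le> card (smooth_upto W X) * (Z + \<omega>)"
        using q1(2) by (intro mult_le_mono card_image_le) auto
      finally have c2: "card R2 \<le> card (smooth_upto W X) * (Z + \<omega>)" .
      have "\<P> \<subseteq> {p \<in> \<P>. (p, q) \<in> \<V>} \<union> (R1 \<union> R2)"
        using q by (auto simp: R1_def R2_def \<V>_def)
      then have "card \<P> \<le> card ({p \<in> \<P>. (p, q) \<in> \<V>} \<union> (R1 \<union> R2))"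
        using fin(1) by (intro card_mono) (auto simp: R1_def R2_def)
      also have "\<dots> \<le> card {p \<in> \<P>. (p, q) \<in> \<V>} + card (R1 \<union> R2)" by (rule card_Un_le)
      finally have "card \<P> \<le> card {p \<in> \<P>. (p, q) \<in> \<V>} + (X * (\<omega> + y4) + card (smooth_upto W X) * (Z + \<omega>))"
        using card_Un_le[of R1 R2] c1 c2 by linarith
      then have "real (card \<P>) \<le> real (card {p \<in> \<P>. (p, q) \<in> \<V>} + (X * (\<omega> + y4) + card (smooth_upto W X) * (Z + \<omega>)))"
        by (simp only: of_nat_le_iff)
      then show ?thesis by (simp only: of_nat_add)
    qed
    have "card \<V> = (\<Sum>q\<in>\<Q>. card {p \<in> \<P>. (p, q) \<in> \<V>})"
    proof -
      define Sg where "Sg = (SIGMA q:\<Q>. {p \<in> \<P>. (p, q) \<in> \<V>})"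
      have 1: "\<V> = (\<lambda>(q, p). (p, q)) ` Sg"
        using \<V>sub by (force simp: Sg_def)
      have 2: "inj_on (\<lambda>(q, p). (p, q)) Sg"
        by (auto simp: inj_on_def)
      have "card \<V> = card Sg" by (subst 1) (rule card_image[OF 2])
      then show ?thesis using fin by (simp add: Sg_def card_SigmaI)
    qed
    then have "real (card \<V>) = (\<Sum>q\<in>\<Q>. real (card {p \<in> \<P>. (p, q) \<in> \<V>}))" by simp
    also have "\<dots> \<ge> (\<Sum>q\<in>\<Q>. real (card \<P>) - real (X * (\<omega> + y4)) - real (card (smooth_upto W X) * (Z + \<omega>)))"
      by (rule sum_mono) (rule each)
    finally show ?thesis by (simp only: sum_constant)
  qed
  define S where "S = (\<lambda>k. {v \<in> \<V>. n v \<le> k \<and> k < n v + y4})"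
  have Sprop: "prime p \<and> N < 2 * p \<and> p < k \<and> k < p + Z \<and> prime q \<and> Z \<le> q \<and> k mod q < y4
      \<and> k div q = p div q + 1 \<and> p div q + 1 \<notin> smooth_upto W X \<and> p div q + 1 \<le> X \<and> k - k mod q = n (p, q)"
    if "(p, q) \<in> S k" for p q k
  proof -
    have v: "p \<in> \<P>" "q \<in> \<Q>" "\<omega> + y4 \<le> p mod q" "p div q + 1 \<notin> smooth_upto W X"
      and k: "n (p, q) \<le> k" "k < n (p, q) + y4" using that by (auto simp: S_def \<V>_def)
    note P = \<P>[OF v(1)] and q = \<Q>[OF v(2)]
    have q0: "q > 0" using q prime_gt_0_nat by blast
    have kp: "p < k" "k < p + Z" using n_eq[OF q0, of p] k v(3) q by linarith+
    define c where "c = k - n (p, q)"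
    have c: "c < y4" "k = c + q * (p div q + 1)" using k by (auto simp: c_def n_def)
    have "c < q" using c(1) ord(1) q by linarith
    then have aux: "(c + q * m) mod q = c \<and> (c + q * m) div q = m" for m by simp
    have "k mod q = c" "k div q = p div q + 1"
      using aux[of "p div q + 1"] unfolding c(2) by blast+
    moreover have "k - c = n (p, q)" using k by (simp add: c_def)
    ultimately show ?thesis using P q kp v c(1) divX[OF ple[OF v(1)] v(2)] by simp
  qed
  \<comment> \<open>The pair (p, q) is determined by \<open>k - p\<close> < Z and
    \<open>k mod q\<close> < y4: the first gives p, and the second gives n = k - k mod q, whose only
    prime divisor of size at least \<open>Z\<close> is q.\<close>
  have cardS: "card (S k) \<le> Z * y4" for k
  proof -
    have "inj_on (\<lambda>(p, q). (k - p, k mod q)) (S k)"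
    proof (rule inj_onI, clarify)
      fix p q p' q' assume a: "(p, q) \<in> S k" "(p', q') \<in> S k" "k - p = k - p'" "k mod q = k mod q'"
      note s = Sprop[OF a(1)] and s' = Sprop[OF a(2)]
      have p: "p = p'" using a(3) s s' by linarith
      have nn: "n (p, q) = n (p', q')" using s s' a(4) by simp
      have "q dvd n (p, q)" "q' dvd n (p', q')" by (simp_all add: n_def)
      then have "q dvd n (p, q)" "q' dvd n (p, q)" by (simp_all only: nn)
      moreover have "n (p, q) < Z\<^sup>2"
      proof -
        have "p \<in> \<P>" "q \<in> \<Q>" using a(1) by (auto simp: S_def \<V>_def)
        moreover have "n (p, q) \<le> p + q" using n_eq(1)[of q p] s prime_gt_0_nat[of q] by linarith
        ultimately show ?thesis using \<P>[of p] \<Q>[of q] ord(3) by linarith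
      qed
      moreover have "n (p, q) > 0" using n_eq(2)[of q p] s prime_gt_0_nat[of q] by linarith
      ultimately have "q = q'" using prime_divisor_large_unique[of q q' Z "n (p, q)"] s s' by blast
      then show "p = p' \<and> q = q'" using p by simp
    qed
    moreover have "(\<lambda>(p, q). (k - p, k mod q)) ` S k \<subseteq> {..<Z} \<times> {..<y4}"
    proof clarify
      fix p q assume a: "(p, q) \<in> S k"
      show "k - p \<in> {..<Z} \<and> k mod q \<in> {..<y4}" using Sprop[OF a] by auto
    qed
    ultimately have "card (S k) \<le> card ({..<Z} \<times> {..<y4})" by (intro card_inj_on_le) auto
    then show ?thesis by (simp add: card_cartesian_product)
  qed
  \<comment> \<open>Double counting: every pair is charged to at least \<open>y4 div Q\<close>
    multiples; a multiple in \<open>Bad\<close> receives at most Z y4 pairs, and if the claim failed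
    any other would receive fewer than \<tau>.\<close>
  have "\<exists>t<H. t \<notin> Bad \<and> \<tau> \<le> real (card (S (Q * t)))"
  proof (rule ccontr)
    assume "\<not> ?thesis"
    then have no: "t \<notin> Bad \<Longrightarrow> t < H \<Longrightarrow> real (card (S (Q * t))) < \<tau>" for t by force
    have "real (card \<V>) * real (y4 div Q) = (\<Sum>v\<in>\<V>. real (y4 div Q))" by simp
    also have "\<dots> \<le> (\<Sum>v\<in>\<V>. real (card {t. t < H \<and> n v \<le> Q * t \<and> Q * t < n v + y4}))"
    proof (rule sum_mono)
      fix v assume v: "v \<in> \<V>"
      obtain p q where pq: "v = (p, q)" "p \<in> \<P>" "q \<in> \<Q>" using v \<V>sub by auto
      have q0: "q > 0" using \<Q>[OF pq(3)] prime_gt_0_nat by blast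
      have "n v + y4 \<le> N" using n_eq(1)[OF q0, of p] \<P>[OF pq(2)] \<Q>[OF pq(3)] unfolding pq(1) by linarith
      also have "N \<le> Q * H" using dividend_less_times_div[OF Q, of N] by (simp add: H less_imp_le)
      finally have "y4 div Q \<le> card {t. t < H \<and> n v \<le> Q * t \<and> Q * t < n v + y4}"
        by (rule card_multiples_in_interval[OF Q])
      then show "real (y4 div Q) \<le> real (card {t. t < H \<and> n v \<le> Q * t \<and> Q * t < n v + y4})" by simp
    qed
    also have "\<dots> = (\<Sum>v\<in>\<V>. \<Sum>t<H. if n v \<le> Q * t \<and> Q * t < n v + y4 then 1 else 0)"
      by (intro sum.cong refl) (simp add: sum.If_cases Int_def lessThan_def)
    also have "\<dots> = (\<Sum>t<H. \<Sum>v\<in>\<V>. if n v \<le> Q * t \<and> Q * t < n v + y4 then 1 else 0)"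
      by (rule sum.swap)
    also have "\<dots> = (\<Sum>t<H. real (card (S (Q * t))))"
      using fV by (intro sum.cong refl) (simp add: sum.If_cases Int_def S_def)
    also have "\<dots> \<le> (\<Sum>t<H. \<tau> + (if t \<in> Bad then real Z * real y4 else 0))"
    proof (rule sum_mono)
      fix t assume t: "t \<in> {..<H}"
      have "real (card (S (Q * t))) \<le> real (Z * y4)" using cardS by (simp only: of_nat_le_iff)
      then show "real (card (S (Q * t))) \<le> \<tau> + (if t \<in> Bad then real Z * real y4 else 0)"
        using no[of t] t \<tau> by auto
    qed
    also have "\<dots> = \<tau> * real H + real (card ({..<H} \<inter> Bad)) * (real Z * real y4)"
      by (simp add: sum.distrib sum.If_cases Int_def)
    also have "\<dots> \<le> \<tau> * real H + real (card Bad) * (real Z * real y4)"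
      using card_mono[OF Bad, of "{..<H} \<inter> Bad"] by (intro add_left_mono mult_right_mono) auto
    also have "\<dots> < real (card \<Q>) * (real (card \<P>) - real (X * (\<omega> + y4)) - real (card (smooth_upto W X) * (Z + \<omega>))) * real (y4 div Q)"
      using main by linarith
    also have "\<dots> \<le> real (card \<V>) * real (y4 div Q)" using cardV by (intro mult_right_mono) auto
    finally show False by simp
  qed
  then obtain t where t: "t < H" "t \<notin> Bad" "\<tau> \<le> real (card (S (Q * t)))" by blast
  define k where "k = Q * t"
  have fS: "finite (S k)" using fV by (simp add: S_def)
  have "S k \<noteq> {}" using t(3) \<tau> by (auto simp: k_def)
  then obtain p0 qq where pq0: "(p0, qq) \<in> S k" by auto
  have kN: "N < 2 * k" using Sprop[OF pq0] by linarith
  have kN2: "k \<le> N"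
  proof -
    have "t \<le> N div Q" using t(1) by (simp add: H)
    then have "Q * t \<le> Q * (N div Q)" by (rule mult_le_mono2)
    also have "\<dots> \<le> N" by simp
    finally show ?thesis by (simp add: k_def)
  qed
  define C4 where "C4 = snd ` S k"
  define P where "P = fst ` S k"
  have C4p: "prime q \<and> Z \<le> q \<and> k mod q < y4 \<and> k div q \<le> X
        \<and> (\<exists>p. prime p \<and> p \<notin> W \<and> p dvd k div q)" if q: "q \<in> C4" for q
  proof -
    obtain p where s: "(p, q) \<in> S k" using q by (auto simp: C4_def)
    note sp = Sprop[OF s]
    have "\<exists>p. prime p \<and> p \<notin> W \<and> p dvd k div q" using sp by (auto simp: smooth_upto_def)
    then show ?thesis using sp by auto
  qed
  have Pp: "prime p \<and> N < 2 * p \<and> p < k \<and> k < p + Z" if p: "p \<in> P" for p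
  proof -
    obtain q where s: "(p, q) \<in> S k" using p by (auto simp: P_def)
    then show ?thesis using Sprop[OF s] by blast
  qed
  \<comment> \<open>The pairs at \<open>k\<close> fit into a product, so the trivial upper bound
    \<open>Z\<close> or \<open>y4\<close> for one factor yields a lower bound for the other.\<close>
  have sub: "S k \<subseteq> P \<times> C4" by (force simp: P_def C4_def)
  have fPC: "finite P" "finite C4" using fS by (auto simp: P_def C4_def)
  have "card (S k) \<le> card (P \<times> C4)" using sub fPC by (intro card_mono) auto
  then have prod: "card (S k) \<le> card P * card C4" by (simp add: card_cartesian_product)
  have cP: "card P \<le> Z"
  proof -
    have "inj_on (\<lambda>p. k - p) P" using Pp by (intro inj_onI) (metis diff_diff_cancel less_imp_le)
    moreover have "(\<lambda>p. k - p) ` P \<subseteq> {..<Z}" using Pp by force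
    ultimately have "card P \<le> card {..<Z}" by (intro card_inj_on_le) auto
    then show ?thesis by simp
  qed
  have cC4: "card C4 \<le> y4"
  proof -
    have "inj_on (\<lambda>q. k mod q) C4"
    proof (rule inj_onI)
      fix q q' assume q: "q \<in> C4" "q' \<in> C4" "k mod q = k mod q'"
      have "q dvd k - k mod q" "q' dvd k - k mod q'" by (rule dvd_minus_mod)+
      then have "q dvd k - k mod q" "q' dvd k - k mod q" by (simp_all only: q(3))
      moreover have "k - k mod q < Z\<^sup>2" using kN2 ord(3) by linarith
      moreover have "k - k mod q > 0" using C4p[OF q(1)] ord kN by linarith
      ultimately show "q = q'" using prime_divisor_large_unique[of q q' Z] C4p q by blast
    qed
    moreover have "(\<lambda>q. k mod q) ` C4 \<subseteq> {..<y4}" using C4p by force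
    ultimately have "card C4 \<le> card {..<y4}" by (intro card_inj_on_le) auto
    then show ?thesis by simp
  qed
  have tC4: "\<tau> \<le> real Z * real (card C4)"
  proof -
    have "card (S k) \<le> Z * card C4" using prod cP by (meson le_trans mult_le_mono1)
    then have "real (card (S k)) \<le> real (Z * card C4)" by (simp only: of_nat_le_iff)
    then show ?thesis using t(3) by (simp add: k_def)
  qed
  have tP: "\<tau> \<le> real y4 * real (card P)"
  proof -
    have "card (S k) \<le> y4 * card P" using prod cC4 by (metis le_trans mult.commute mult_le_mono1)
    then have "real (card (S k)) \<le> real (y4 * card P)" by (simp only: of_nat_le_iff)
    then show ?thesis using t(3) by (simp add: k_def)
  qed
  \<comment> \<open>Since 2 q0 \<le> N < 2 p, no \<open>p\<close> equals \<open>q0\<close>; so the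
    class 0 is empty and the popular class \<open>s0\<close> is nonzero.\<close>
  have Pmod: "p mod q0 \<in> {1..<q0}" if "p \<in> P" for p
  proof -
    have "\<not> q0 dvd p"
    proof
      assume "q0 dvd p"
      then have "q0 = p" using Pp[OF that] q0(1) by (simp add: primes_dvd_imp_eq)
      then show False using Pp[OF that] q0(2) by linarith
    qed
    then have "p mod q0 \<noteq> 0" by (simp add: dvd_eq_mod_eq_0)
    then show ?thesis using prime_gt_0_nat[OF q0(1)] by simp
  qed
  have "\<exists>s0\<in>{1..<q0}. card P \<le> q0 * card {p \<in> P. p mod q0 = s0}"
  proof (rule ccontr)
    assume "\<not> ?thesis"
    then have lt: "s0 \<in> {1..<q0} \<Longrightarrow> q0 * card {p \<in> P. p mod q0 = s0} < card P" for s0 by force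
    have "P = (\<Union>s0\<in>{1..<q0}. {p \<in> P. p mod q0 = s0})" using Pmod by auto
    then have "card P \<le> (\<Sum>s0\<in>{1..<q0}. card {p \<in> P. p mod q0 = s0})"
      using card_UN_le[of "{1..<q0}" "\<lambda>s0. {p \<in> P. p mod q0 = s0}"] by simp
    then have "q0 * card P \<le> (\<Sum>s0\<in>{1..<q0}. q0 * card {p \<in> P. p mod q0 = s0})"
      by (simp add: sum_distrib_left[symmetric])
    also have "\<dots> \<le> (\<Sum>s0\<in>{1..<q0}. card P)" using lt by (intro sum_mono less_imp_le)
    also have "\<dots> = (q0 - 1) * card P" by simp
    finally have "q0 * card P \<le> (q0 - 1) * card P" .
    moreover have "card P > 0" using tP \<tau> by (intro gr0I) auto
    ultimately show False using prime_gt_0_nat[OF q0(1)] by simp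
  qed
  then obtain s0 where s0: "0 < s0" "s0 < q0" "card P \<le> q0 * card {p \<in> P. p mod q0 = s0}"
    by (metis Suc_le_eq One_nat_def atLeastLessThan_iff)
  define C5 where "C5 = {p \<in> P. p mod q0 = s0}"
  have "real y4 * real (card P) \<le> real y4 * (real q0 * real (card C5))"
    using s0(3) unfolding C5_def by (intro mult_left_mono) (metis of_nat_le_iff of_nat_mult, simp)
  then have tC5: "\<tau> \<le> real y4 * (real q0 * real (card C5))" using tP by linarith
  have C5p: "prime p \<and> k < 2 * p \<and> p \<le> k \<and> k < p + Z \<and> p mod q0 = s0" if "p \<in> C5" for p
    using that Pp[of p] kN2 by (auto simp: C5_def)
  show ?thesis
    by (rule that[of t C4 s0 C5]) (use t kN kN2 C4p tC4 s0 C5p tC5 in \<open>simp_all add: k_def\<close>)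
qed

text \<open>The covering lemma speaks of \<open>k\<close>, which is known only after averaging. Here
  its hypotheses are secured for every k = Q t outside an exceptional set, by monotone bounds taken
  at \<open>N\<close> \<ge> k.\<close>

lemma covering_of_numeric_bounds:
  fixes K B \<tau> \<beta> :: real and N r q0 y1 y2 y4 U Z \<omega> X :: nat and T1 \<P> \<Q> \<Z> :: "nat set"
  defines "W \<equiv> {p. prime p \<and> real p < B}" and "Q \<equiv> r * q0 * \<Prod>T1" and "V \<equiv> {p. prime p \<and> real p < B} \<union> insert q0 T1"
    and "A \<equiv> \<lambda>y. {a. a < y \<and> r dvd a}"
  defines "H \<equiv> N div Q + 1" and "n1 \<equiv> card (smooth_upto W N)" and "n2 \<equiv> card (smooth_upto V N)"
    and "\<mu> \<equiv> \<lambda>y. \<Sum>q\<in>\<Z>. real (card (A y)) / real q"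
  defines "Bad \<equiv> \<lambda>y. {t. t < H \<and> real (card {q \<in> \<Z>. Q * t mod q \<in> A y}) < \<mu> y / 2}"
    and "M \<equiv> n2 * (n1 + n2 + 1)\<^sup>2"
  assumes K: "K \<ge> 1" "N = nat \<lfloor>K\<rfloor>"
    and finT1: "finite T1" and q0: "q0 \<notin> T1"
    and T1: "\<And>q. q \<in> insert q0 T1 \<Longrightarrow> prime q \<and> y2 < q \<and> q < U"
    and r: "prime r" "B \<le> real r" "r \<le> y2"
    and ord: "y1 \<le> y2" "y2 \<le> y4" "y4 \<le> U" "2 * U < Z" "4 * Z \<le> N" "N < U ^ 3" "N < Z\<^sup>2"
      "N div Z + 1 \<le> X" "X \<le> y2" "\<omega> \<le> Z"
    and cT1: "card (smooth_upto W y1) \<le> card T1"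
    and \<Z>: "finite \<Z>" "\<And>q. q \<in> \<Z> \<Longrightarrow> prime q \<and> U < q \<and> q \<le> 2 * U"
    and \<P>: "finite \<P>" "\<And>p. p \<in> \<P> \<Longrightarrow> prime p \<and> N < 2 * p \<and> p + Z + \<omega> + y4 \<le> N"
    and \<Q>: "finite \<Q>" "\<And>q. q \<in> \<Q> \<Longrightarrow> prime q \<and> Z \<le> q \<and> q \<le> Z + \<omega>"
    and \<mu>: "2 * real n1 \<le> \<mu> y1" "2 * (real n1 + real n2) \<le> \<mu> y2"
    and \<beta>: "real (card (Bad y1)) \<le> \<beta>" "real (card (Bad y2)) \<le> \<beta>"
    and main: "(2 * \<beta> + real n2 * real y4) * (real Z * real y4) + \<tau> * real H
      < real (card \<Q>) * (real (card \<P>) - real (X * (\<omega> + y4)) - real (card (smooth_upto W X) * (Z + \<omega>))) * real (y4 div Q)"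
    and \<tau>: "\<tau> > 0" "real Z * real M \<le> \<tau>" "real y4 * (real q0 * (real M * real (1 + N div Z))) \<le> \<tau>"
  shows "\<exists>(k::nat) (\<alpha>::nat). K / 2 < real k \<and> real k \<le> K \<and>
      (\<forall>n::nat. n > k \<and> [n = \<alpha>] (mod prime_power_modulus k) \<longrightarrow>
        (\<forall>p. prime p \<and> p \<le> k \<longrightarrow> \<not> p dvd (n choose k)) \<and>
        (\<forall>i<k. \<exists>p. prime p \<and> real p \<ge> B \<and> p dvd (n - i)))"
proof -
  have Q0: "Q > 0" unfolding Q_def using T1 r(1) finT1 prime_gt_0_nat by (auto intro!: prod_pos)
  have Z0: "Z > 0" using ord(4) by simp
  \<comment> \<open>Multiples of \<open>Q\<close> with a \<open>V\<close>-smooth number at most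
    \<open>y4\<close> below them must be avoided: nothing in the covering would reach that number.
    Such a multiple is determined by the smooth number and the distance, so there are few.\<close>
  define B3 where "B3 = {t. t < H \<and> (\<exists>j\<in>smooth_upto V N. j \<le> Q * t \<and> Q * t < j + y4)}"
  have cB3: "card B3 \<le> n2 * y4"
  proof -
    have "card B3 \<le> card (smooth_upto V N \<times> {..<y4})"
    proof (rule card_le_if_inj_on_rel[where r = "\<lambda>t v. Q * t = fst v + snd v"])
      show "\<exists>v. v \<in> smooth_upto V N \<times> {..<y4} \<and> Q * t = fst v + snd v" if tB: "t \<in> B3" for t
      proof -
        obtain j where "j \<in> smooth_upto V N" "j \<le> Q * t" "Q * t < j + y4" using tB by (auto simp: B3_def)
        then show ?thesis by (intro exI[of _ "(j, Q * t - j)"]) auto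
      qed
      show "t1 = t2" if "t1 \<in> B3" "t2 \<in> B3" "v \<in> smooth_upto V N \<times> {..<y4}"
        "Q * t1 = fst v + snd v" "Q * t2 = fst v + snd v" for t1 t2 v
        using that(4,5) Q0 by (metis mult_cancel1 less_not_refl)
    qed simp
    then show ?thesis by (simp add: card_cartesian_product n2_def)
  qed
  define BB where "BB = Bad y1 \<union> Bad y2 \<union> B3"
  have fBB: "finite BB" by (simp add: BB_def Bad_def B3_def)
  have cBB: "real (card BB) \<le> 2 * \<beta> + real n2 * real y4"
  proof -
    have "card BB \<le> card (Bad y1) + card (Bad y2) + card B3"
      unfolding BB_def by (metis add_le_mono1 card_Un_le le_trans)
    then have "real (card BB) \<le> real (card (Bad y1)) + real (card (Bad y2)) + real (card B3)"
      by linarith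
    moreover have "real (card B3) \<le> real n2 * real y4" using cB3 by (metis of_nat_le_iff of_nat_mult)
    ultimately show ?thesis using \<beta> by linarith
  qed
  have main': "real (card BB) * (real Z * real y4) + \<tau> * real H
      < real (card \<Q>) * (real (card \<P>) - real (X * (\<omega> + y4)) - real (card (smooth_upto W X) * (Z + \<omega>))) * real (y4 div Q)"
  proof -
    have "real (card BB) * (real Z * real y4) \<le> (2 * \<beta> + real n2 * real y4) * (real Z * real y4)"
      using cBB by (intro mult_right_mono) auto
    then show ?thesis using main by linarith
  qed
  have o1: "y4 \<le> Z" "2 * Z + 2 * \<omega> \<le> N" using ord by linarith+
  have pq0: "prime q0" "2 * q0 \<le> N" using T1[of q0] ord by auto
  obtain t C4 C5 s0 where t: "t < H" "t \<notin> BB" "N < 2 * (Q * t)" "Q * t \<le> N"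
    and C4: "\<And>q. q \<in> C4 \<Longrightarrow> prime q \<and> Z \<le> q \<and> Q * t mod q < y4 \<and> Q * t div q \<le> X
        \<and> (\<exists>p. prime p \<and> p \<notin> W \<and> p dvd Q * t div q)"
    and cC4: "\<tau> \<le> real Z * real (card C4)" and s0: "0 < s0" "s0 < q0"
    and C5: "\<And>p. p \<in> C5 \<Longrightarrow> prime p \<and> Q * t < 2 * p \<and> p \<le> Q * t \<and> Q * t < p + Z \<and> p mod q0 = s0"
    and cC5: "\<tau> \<le> real y4 * (real q0 * real (card C5))"
    by (rule exists_popular_multiple[OF Q0 meta_eq_to_obj_eq[OF H_def] \<P>(1) \<Q>(1) \<P>(2) \<Q>(2) o1 ord(7,8) fBB main' \<tau>(1) pq0])
      (assumption | rule that)+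
  define k where "k = Q * t"
  have k0: "k > 0" unfolding k_def using t(3) by linarith
  have kN: "k \<le> N" "N < 2 * k" using t by (simp_all add: k_def)
  have sm: "smooth_upto S k \<subseteq> smooth_upto S N" for S using kN by (intro smooth_upto_mono) auto
  have smc: "card (smooth_upto S k) \<le> card (smooth_upto S N)" for S
    by (rule card_mono[OF _ sm]) simp
  define C where "C = (\<lambda>y. {q \<in> \<Z>. k mod q \<in> A y})"
  have Cp: "prime q \<and> U < q \<and> q \<le> 2 * U \<and> k mod q < y \<and> r dvd k mod q" if "q \<in> C y" for q y
    using that \<Z>(2)[of q] by (auto simp: C_def A_def)
  have cC: "\<mu> y / 2 \<le> real (card (C y))" if "y \<in> {y1, y2}" for y
    using t(1,2) that by (auto simp: C_def BB_def Bad_def k_def)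
  have n1: "card (smooth_upto W k) \<le> n1" "card (smooth_upto V k) \<le> n2"
    unfolding n1_def n2_def by (rule smc)+
  have cC2: "card (smooth_upto W k) \<le> card (C y1)"
    using cC[of y1] \<mu>(1) n1 by simp
  have cC3: "card (smooth_upto W k) + card (smooth_upto V k) \<le> card (C y2)"
    using cC[of y2] \<mu>(2) n1 by simp
  have top: "j + y4 \<le> k" if j: "j \<in> smooth_upto V k" for j
  proof (rule ccontr)
    assume "\<not> j + y4 \<le> k"
    moreover have "j \<le> k" using j by (simp add: smooth_upto_def)
    ultimately have "t \<in> B3" using j sm[of V] t(1) by (auto simp: B3_def k_def)
    then show False using t(2) by (simp add: BB_def)
  qed
  define M' where "M' = card (smooth_upto V k) * (card (smooth_upto W k) + card (smooth_upto V k) + 1)\<^sup>2"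
  have M'_eq: "card (smooth_upto V k) * (card (smooth_upto W k) + card (smooth_upto V k) + 1)\<^sup>2 \<le> M'"
    by (simp only: M'_def)
  have M': "M' \<le> M" unfolding M'_def M_def using n1 by (intro mult_le_mono power_mono) auto
  have cM4: "M' \<le> card C4"
  proof -
    have "real Z * real M \<le> real Z * real (card C4)" using \<tau>(2) cC4 by linarith
    then have "M \<le> card C4" using Z0 by simp
    then show ?thesis using M' by linarith
  qed
  have cM5: "M' * (1 + k div Z) \<le> card C5"
  proof -
    have "real y4 * (real q0 * (real M * real (1 + N div Z))) \<le> real y4 * (real q0 * real (card C5))"
      using \<tau>(3) cC5 by linarith
    moreover have "y4 > 0" using cC5 \<tau>(1) by (intro gr0I) auto
    moreover have "q0 > 0" using s0 by simp
    ultimately have "real M * real (1 + N div Z) \<le> real (card C5)" by simp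
    then have "M * (1 + N div Z) \<le> card C5" by (metis of_nat_le_iff of_nat_mult)
    moreover have "M' * (1 + k div Z) \<le> M * (1 + N div Z)"
      using M' kN(1) by (intro mult_le_mono add_le_mono div_le_mono) auto
    ultimately show ?thesis by linarith
  qed
  have dvdk: "q dvd k" if "q \<in> insert q0 T1" for q
  proof -
    have "q dvd q0 * \<Prod>T1" using that dvd_prodI[OF finT1, of q "\<lambda>x. x"] by auto
    then have "q dvd r * (q0 * \<Prod>T1)" by (rule dvd_mult)
    then show ?thesis unfolding k_def Q_def mult.assoc[of r q0] by (rule dvd_mult2)
  qed
  have rk: "r dvd k" unfolding k_def Q_def by (simp add: mult.assoc)
  have T1': "prime q \<and> y2 < q \<and> q < U \<and> q dvd k" if "q \<in> insert q0 T1" for q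
    using T1[OF that] dvdk[OF that] by blast
  have o2: "2 * Z \<le> k" "k < U ^ 3" using ord kN by linarith+
  have cT1': "card {j \<in> smooth_upto W k. j < y1} \<le> card T1"
  proof -
    have "card {j \<in> smooth_upto W k. j < y1} \<le> card (smooth_upto W y1)"
      by (rule card_mono) (auto simp: smooth_upto_def)
    then show ?thesis using cT1 by linarith
  qed
  have C4': "prime q \<and> Z \<le> q \<and> k mod q < y4 \<and> k div q \<le> y2 \<and> (\<exists>p. prime p \<and> p \<notin> W \<and> p dvd k div q)"
    if "q \<in> C4" for q using C4[OF that] ord(9) by (auto simp: k_def)
  have VW: "V = W \<union> insert q0 T1" by (simp add: V_def W_def)
  obtain sh where sh: "\<And>p. prime p \<Longrightarrow> p \<le> k \<Longrightarrow> sh p = 0 \<or> (k mod p < sh p \<and> sh p < p)"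
    and cov: "\<And>j. 1 \<le> j \<Longrightarrow> j \<le> k \<Longrightarrow> \<exists>p. prime p \<and> p \<le> k \<and> B \<le> real p \<and> j mod p = sh p"
    by (rule covering_assignment[where B = B and k = k and Z = Z and ?y1.0 = y1 and ?y2.0 = y2 and ?y4.0 = y4
        and U = U and r = r and ?q0.0 = q0 and ?s0.0 = s0 and M = M' and ?T1.0 = T1
        and ?C2.0 = "C y1" and ?C3.0 = "C y2" and ?C4.0 = C4 and ?C5.0 = C5, folded W_def, folded VW,
        OF k0 finT1 q0 T1' r rk ord(1,2,3,4) o2 cT1' Cp cC2 Cp cC3 top C4' M'_eq cM4 s0 C5[folded k_def] cM5])
      (assumption | rule that)+
  have "\<exists>\<alpha>::nat. \<forall>n::nat. n > k \<and> [n = \<alpha>] (mod prime_power_modulus k) \<longrightarrow>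
        (\<forall>p. prime p \<and> p \<le> k \<longrightarrow> \<not> p dvd (n choose k)) \<and>
        (\<forall>i<k. \<exists>p. prime p \<and> real p \<ge> B \<and> p dvd (n - i))"
    by (rule residue_class_of_covering[OF k0 sh cov])
  moreover have "K / 2 < real k" "real k \<le> K" using kN K by linarith+
  ultimately show ?thesis by blast
qed

section \<open>Parameters\<close>

lemma card_smooth_upto_le_powr:
  fixes v w :: real
  assumes W: "finite W" "real (card W) \<le> w" and n: "real n \<le> exp v" and v: "v \<ge> 1"
  shows "real (card (smooth_upto W n)) \<le> (3 * v) powr w"
proof -
  \<comment> \<open>2^(2v) exceeds exp v because 2 ln 2 > 1, and rounding up stays within 3 v
    because v \<ge> 1.\<close>
  define e where "e = nat \<lceil>2 * v\<rceil>"
  have e: "2 * v \<le> real e" "real e \<le> 3 * v" using v unfolding e_def by linarith+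
  have "exp v < exp (2 * v * ln 2)"
    using v mult_strict_left_mono[of "1/2" "ln 2" "2 * v"] ln2_ge_two_thirds by simp
  also have "\<dots> = 2 powr (2 * v)" by (simp add: powr_def)
  also have "\<dots> \<le> 2 powr real e" using e by simp
  also have "\<dots> = 2 ^ e" by (simp add: powr_realpow)
  finally have "real n < 2 ^ e" using n by linarith
  then have "n < 2 ^ e" by simp
  then have "card (smooth_upto W n) \<le> e ^ card W" by (rule card_smooth_upto_le_power[OF W(1)])
  then have "real (card (smooth_upto W n)) \<le> real (e ^ card W)" by (simp only: of_nat_le_iff)
  also have "\<dots> = real e powr real (card W)" using e v by (simp add: powr_realpow)
  also have "\<dots> \<le> real e powr w" using e v W(2) by (intro powr_mono) auto
  also have "\<dots> \<le> (3 * v) powr w" using e v W(2) by (intro powr_mono2) auto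
  finally show ?thesis .
qed

lemma card_multiples_less_bounds:
  assumes "r > 0"
  shows "real y / real r - 1 \<le> real (card {a::nat. a < y \<and> r dvd a})"
proof -
  have "real (card {0::nat}) * (real y / real r - 1) \<le> real (card {t. t < y \<and> t mod r \<in> {0}})"
    using assms by (intro card_mod_in_bounds(2)) auto
  then show ?thesis by (simp add: dvd_eq_mod_eq_0)
qed

text \<open>The primes are at most 2 U, so \<mu> is at least card A * card \<Z> / (2 U). This bounds
  \<mu> from below, and it also bounds the incomplete-period error of the second moment by a
  multiple of U^2 \<mu>^2, which after division by \<mu>^2 leaves 64 U^2.\<close>

lemma card_residue_bad_le:
  fixes Q H U r y :: nat and \<Z> :: "nat set" and l E1 :: real
  defines "A \<equiv> {a. a < y \<and> r dvd a}"
  defines "\<mu> \<equiv> (\<Sum>q\<in>\<Z>. real (card A) / real q)"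
  assumes \<Z>: "finite \<Z>" "\<And>q. q \<in> \<Z> \<Longrightarrow> prime q \<and> U < q \<and> q \<le> 2 * U \<and> coprime Q q"
    and y: "y \<le> U" and U: "U > 0" and l: "l > 0" and E1: "E1 > 0"
    and h: "E1 / (4 * l) \<le> real (card A)" and z: "real U / (4 * l) \<le> real (card \<Z>)"
  shows "E1 / (32 * l\<^sup>2) \<le> \<mu>"
    and "real (card {t. t < H \<and> real (card {q \<in> \<Z>. Q * t mod q \<in> A}) < \<mu> / 2})
      \<le> 128 * l\<^sup>2 * real H / E1 + 64 * (real U)\<^sup>2"
proof -
  have finA: "finite A" unfolding A_def by simp
  define hz where "hz = real (card A) * real (card \<Z>)"
  have mu1: "hz / (2 * real U) \<le> \<mu>"
  proof -
    have "hz / (2 * real U) = (\<Sum>q\<in>\<Z>. real (card A) / (2 * real U))" by (simp add: hz_def)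
    also have "\<dots> \<le> \<mu>" unfolding \<mu>_def
    proof (rule sum_mono)
      fix q assume q: "q \<in> \<Z>"
      then have "0 < real q" "real q \<le> 2 * real U" using \<Z>(2)[OF q] by (auto simp: prime_gt_0_nat)
      then show "real (card A) / (2 * real U) \<le> real (card A) / real q"
        by (intro divide_left_mono) (use U in auto)
    qed
    finally show ?thesis .
  qed
  have "E1 / (4 * l) * (real U / (4 * l)) \<le> hz"
    unfolding hz_def using h z E1 l by (intro mult_mono) auto
  then have "E1 / (4 * l) * (real U / (4 * l)) / (2 * real U) \<le> hz / (2 * real U)"
    by (intro divide_right_mono) auto
  moreover have "E1 / (4 * l) * (real U / (4 * l)) / (2 * real U) = E1 / (32 * l\<^sup>2)"
    using U by (simp add: power2_eq_square)
  ultimately show mu: "E1 / (32 * l\<^sup>2) \<le> \<mu>" using mu1 by linarith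
  have mupos: "\<mu> > 0" using mu E1 l by (meson divide_pos_pos less_le_trans mult_pos_pos zero_less_numeral zero_less_power)
  define b where "b = real (card {t. t < H \<and> real (card {q \<in> \<Z>. Q * t mod q \<in> A}) < \<mu> / 2})"
  have "b * \<mu>\<^sup>2 \<le> 4 * real H * \<mu> + 16 * hz\<^sup>2"
    unfolding b_def hz_def \<mu>_def
  proof (rule residue_count_second_moment[OF \<Z>(1) _ finA])
    fix q assume "q \<in> \<Z>"
    then show "prime q \<and> coprime Q q \<and> A \<subseteq> {..<q}" using \<Z>(2)[of q] y by (auto simp: A_def)
  qed
  also have "hz\<^sup>2 \<le> (2 * real U * \<mu>)\<^sup>2"
    using mu1 U by (intro power_mono) (simp_all add: field_simps hz_def)
  finally have "b * \<mu>\<^sup>2 \<le> 4 * real H * \<mu> + 64 * (real U)\<^sup>2 * \<mu>\<^sup>2"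
    by (simp add: power_mult_distrib)
  then have "b \<le> (4 * real H * \<mu> + 64 * (real U)\<^sup>2 * \<mu>\<^sup>2) / \<mu>\<^sup>2"
    using mupos by (simp add: pos_le_divide_eq)
  also have "\<dots> = 4 * real H / \<mu> + 64 * (real U)\<^sup>2"
    using mupos by (simp add: add_divide_distrib power2_eq_square)
  also have "4 * real H / \<mu> \<le> 4 * real H / (E1 / (32 * l\<^sup>2))"
    using mu E1 l mupos by (intro divide_left_mono) auto
  also have "4 * real H / (E1 / (32 * l\<^sup>2)) = 128 * l\<^sup>2 * real H / E1" by simp
  finally show "real (card {t. t < H \<and> real (card {q \<in> \<Z>. Q * t mod q \<in> A}) < \<mu> / 2})
      \<le> 128 * l\<^sup>2 * real H / E1 + 64 * (real U)\<^sup>2" by (simp add: b_def)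
qed

text \<open>Chebyshev's bound says nothing about short intervals, but some block of length \<omega>
  must contain the average share of the primes; the position of the block is immaterial.\<close>

lemma pigeonhole_div:
  fixes D :: "nat set" and \<omega> b :: nat
  assumes "finite D" "\<And>q. q \<in> D \<Longrightarrow> q \<le> b" "\<omega> > 0"
  obtains v where "card D \<le> (b div \<omega> + 1) * card {q \<in> D. q div \<omega> = v}"
proof -
  have "\<exists>v\<in>{..b div \<omega>}. card D \<le> (b div \<omega> + 1) * card {q \<in> D. q div \<omega> = v}"
  proof (rule ccontr)
    assume "\<not> ?thesis"
    then have lt: "v \<in> {..b div \<omega>} \<Longrightarrow> (b div \<omega> + 1) * card {q \<in> D. q div \<omega> = v} < card D" for v
      by force
    have "D = (\<Union>v\<in>{..b div \<omega>}. {q \<in> D. q div \<omega> = v})"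
      using assms(2) by (auto simp: div_le_mono)
    then have "card D \<le> (\<Sum>v\<in>{..b div \<omega>}. card {q \<in> D. q div \<omega> = v})"
      using card_UN_le[of "{..b div \<omega>}" "\<lambda>v. {q \<in> D. q div \<omega> = v}"] by simp
    then have "(b div \<omega> + 1) * card D \<le> (\<Sum>v\<in>{..b div \<omega>}. (b div \<omega> + 1) * card {q \<in> D. q div \<omega> = v})"
      by (simp only: sum_distrib_left[symmetric] mult_le_mono2)
    also have "\<dots> < (\<Sum>v\<in>{..b div \<omega>}. card D)"
      using lt by (intro sum_strict_mono) auto
    finally show False by simp
  qed
  then show ?thesis using that by blast
qed

text \<open>All comparisons of growth are hypotheses in \<open>K\<close> alone, apart from the fixed
  threshold \<open>n0\<close>, which separates the integer parameters from the asymptotics.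
  \<open>E1\<close>, \<open>E2\<close>, \<open>u\<close>, \<open>g\<close> are the scales of
  \<open>y1\<close>, \<open>y2\<close>, \<open>U\<close>, \<open>y4\<close>; \<open>s\<close> bounds
  the number of exceptions, \<open>Qb\<close> bounds \<open>Q\<close>, and \<open>Zl\<close> is a
  lower bound for \<open>Z\<close>.\<close>

lemma residue_class_large:
  fixes K B :: real and n0 :: nat
  defines "l \<equiv> ln K" and "L \<equiv> ln (ln K)" and "E1 \<equiv> exp ((ln (ln K))\<^sup>2)" and "E2 \<equiv> exp (ln K powr (3/4))"
    and "s \<equiv> exp (ln K powr (1/2))" and "Qb \<equiv> exp (ln K powr (9/10))" and "u \<equiv> K powr (2/5)"
    and "g \<equiv> K powr (7/20)" and "Zl \<equiv> K / ln K ^ 3 - K / ln K ^ 5 - 1"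
  assumes PC: "\<And>n. n0 \<le> n \<Longrightarrow> real n / (4 * ln (real n)) \<le> real (card {p::nat. prime p \<and> n < p \<and> p \<le> 2 * n})"
    and B: "B \<le> 2 * sqrt L"
    and K1: "K \<ge> 10" and l1: "l \<ge> 2" and L1: "L \<ge> 1"
    and a2: "(3 * (L\<^sup>2 + 1)) powr (2 * sqrt L) \<le> l powr (1/10)"
    and a3: "(3 * (4 * L)) powr (2 * sqrt L) \<le> l powr (1/2)"
    and a3': "2 * l ^ 3 + 1 \<le> exp (4 * L)"
    and a4: "(3 * l) powr (2 * sqrt L) * (l powr (1/10) + 2) powr (l powr (1/4) + 1) \<le> s"
    and a4': "(3 * l) powr (2 * sqrt L) \<le> s"
    and a5: "(2 * l + 2) * (2 * (E2 + 1)) powr (l powr (1/10) + 1) \<le> Qb"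
    and a6: "2 * (3 * l) powr (2 * sqrt L) \<le> E1 / (32 * l\<^sup>2)"
    and a7: "4 * s \<le> E2 / (32 * l\<^sup>2)"
    and a8: "1024 * l\<^sup>2 / E1 \<le> 1 / (4000 * l ^ 4)"
    and a9: "2 * (128 * (u + 1)\<^sup>2 + s * g) \<le> K / (4000 * l ^ 4 * Qb)"
    and a10: "K / (16 * l) \<le> K / (8 * l) - 5 * K / l ^ 3 - (2 * l ^ 3 + 1) * (K / l ^ 5 + 1 + g) - l powr (1/2) * (2 * (K / l ^ 3 + 1) + (K / l ^ 5 + 1))"
    and a11: "3200 * l ^ 4 * (s * (2 * s + 1)\<^sup>2) \<le> g - 1"
    and a12: "2 * (E2 + 1) * (s * (2 * s + 1)\<^sup>2 * (2 * l ^ 3 + 1)) * (1600 * l ^ 4) \<le> K / l ^ 3"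
    and o1: "E1 + 1 \<le> E2" and o2: "E2 + 1 \<le> g - 1" and o3: "g \<le> u" and o4: "2 * u + 2 < Zl"
    and o5: "8 * (K / l ^ 3) + 8 \<le> K - 1" and o6: "K < u ^ 3" and o7: "K < Zl\<^sup>2"
    and o8: "K / Zl + 1 \<le> 2 * l ^ 3" and o9: "2 * l ^ 3 + 1 \<le> E2" and o10: "K / l ^ 5 + 1 \<le> Zl"
    and o11: "2 * E2 + 2 < u" and o12: "2 * l + 2 \<le> E2" and o13: "2 * sqrt L \<le> l"
    and p1: "E1 / (4 * l) \<le> E1 / (2 * l + 2) - 1" and p1': "E2 / (4 * l) \<le> E2 / (2 * l + 2) - 1"
    and p2: "l powr (1/10) + 1 \<le> E2 / (4 * l)"
    and p3: "2 * (K / l ^ 3 + 1) / (K / l ^ 5) + 1 \<le> 3 * l\<^sup>2"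
    and p4: "3 + (2 * (K / l ^ 3) + 2) + (K / l ^ 5 + 1) + g \<le> 5 * K / l ^ 3"
    and p5: "2 * Qb \<le> g - 1" and p6: "u + 1 \<le> K" and p7: "K / l ^ 3 + 1 \<le> K" and p8: "l + 1 \<le> K"
    and q1: "real n0 \<le> l" and q2: "l \<le> E2" and q3: "l \<le> K / l ^ 3"
  shows "\<exists>(k::nat) (\<alpha>::nat). K / 2 < real k \<and> real k \<le> K \<and>
      (\<forall>n::nat. n > k \<and> [n = \<alpha>] (mod prime_power_modulus k) \<longrightarrow>
        (\<forall>p. prime p \<and> p \<le> k \<longrightarrow> \<not> p dvd (n choose k)) \<and>
        (\<forall>i<k. \<exists>p. prime p \<and> real p \<ge> B \<and> p dvd (n - i)))"
proof -
  define W where "W = {p. prime p \<and> real p < B}"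
  define pr where "pr = (\<lambda>n. {p::nat. prime p \<and> n < p \<and> p \<le> 2 * n})"
  have finpr: "finite (pr n)" for n unfolding pr_def by simp
  have l0: "l > 0" and K0: "K > 0" using l1 K1 by linarith+
  have lK: "exp l = K" using K0 by (simp add: l_def)
  have pos: "E1 > 0" "E2 > 0" "s > 0" "Qb > 0" "u > 0" "g > 0"
    using K0 by (simp_all add: E1_def E2_def s_def Qb_def u_def g_def)
  have s1: "s \<ge> 1" unfolding s_def by simp
  have count: "real n / (4 * l) \<le> real (card (pr n))" if "n0 \<le> n" "2 \<le> n" "real n \<le> K" for n
  proof -
    have "ln (real n) \<le> l" unfolding l_def using that by (subst ln_le_cancel_iff) auto
    moreover have "ln (real n) > 0" using that by simp
    ultimately have "real n / (4 * l) \<le> real n / (4 * ln (real n))"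
      using l0 by (intro divide_left_mono mult_pos_pos) auto
    then show ?thesis using PC[OF that(1)] by (simp add: pr_def)
  qed
  have big: "n0 \<le> n \<and> 2 \<le> n" if "l \<le> real n" for n using that q1 l1 by linarith

  define N where "N = nat \<lfloor>K\<rfloor>"
  define y1 where "y1 = nat \<lceil>E1\<rceil>"
  define y2 where "y2 = nat \<lceil>E2\<rceil>"
  define U where "U = nat \<lceil>u\<rceil>"
  define y4 where "y4 = nat \<lfloor>g\<rfloor>"
  define Z0 where "Z0 = nat \<lceil>K / l ^ 3\<rceil>"
  define \<omega> where "\<omega> = nat \<lceil>K / l ^ 5\<rceil>"
  define X where "X = nat \<lceil>2 * l ^ 3\<rceil>"
  have Kl: "K / l ^ 3 > 0" "K / l ^ 5 > 0" "l ^ 3 > 0" using K0 l0 by simp_all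
  have N: "K - 1 < real N" "real N \<le> K" unfolding N_def using K0 by linarith+
  have y1: "E1 \<le> real y1" "real y1 \<le> E1 + 1" unfolding y1_def using pos by linarith+
  have y2: "E2 \<le> real y2" "real y2 \<le> E2 + 1" unfolding y2_def using pos by linarith+
  have U: "u \<le> real U" "real U \<le> u + 1" unfolding U_def using pos by linarith+
  have y4: "g - 1 \<le> real y4" "real y4 \<le> g" unfolding y4_def using pos by linarith+
  have Z0: "K / l ^ 3 \<le> real Z0" "real Z0 \<le> K / l ^ 3 + 1" unfolding Z0_def using Kl by linarith+
  have \<omega>: "K / l ^ 5 \<le> real \<omega>" "real \<omega> \<le> K / l ^ 5 + 1" unfolding \<omega>_def using Kl by linarith+
  have X: "2 * l ^ 3 \<le> real X" "real X \<le> 2 * l ^ 3 + 1" unfolding X_def using Kl by linarith+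

  have W: "finite W" "real (card W) \<le> 2 * sqrt L"
  proof -
    have sub: "W \<subseteq> {1..nat \<lfloor>B\<rfloor>}" unfolding W_def
      by (auto simp: le_nat_floor less_imp_le dest: prime_ge_1_nat)
    then show "finite W" by (rule finite_subset) simp
    have "card W \<le> nat \<lfloor>B\<rfloor>" using card_mono[OF _ sub] by simp
    moreover have "0 \<le> 2 * sqrt L" using L1 by simp
    ultimately show "real (card W) \<le> 2 * sqrt L" using B by linarith
  qed
  define n1 where "n1 = card (smooth_upto W N)"
  have n1: "real n1 \<le> (3 * l) powr (2 * sqrt L)" unfolding n1_def
    using N l1 by (intro card_smooth_upto_le_powr[OF W]) (auto simp: lK)
  define r1 where "r1 = card (smooth_upto W y1)"
  have r1: "real r1 \<le> l powr (1/10)"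
  proof -
    have "real y1 \<le> E1 + 1" by (rule y1)
    also have "\<dots> \<le> exp (L\<^sup>2) * exp 1"
    proof -
      have "E1 = exp (L\<^sup>2)" by (simp add: E1_def L_def)
      moreover have "exp 1 \<ge> (2::real)" using exp_ge_add_one_self[of 1] by simp
      then have "exp (L\<^sup>2) * 2 \<le> exp (L\<^sup>2) * exp 1" by (intro mult_left_mono) auto
      moreover have "exp (L\<^sup>2) \<ge> 1" by simp
      ultimately show ?thesis by linarith
    qed
    also have "\<dots> = exp (L\<^sup>2 + 1)" by (simp add: exp_add)
    finally have "real r1 \<le> (3 * (L\<^sup>2 + 1)) powr (2 * sqrt L)" unfolding r1_def
      by (intro card_smooth_upto_le_powr[OF W]) auto
    then show ?thesis using a2 by linarith
  qed
  define sX where "sX = card (smooth_upto W X)"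
  have sX: "real sX \<le> l powr (1/2)"
  proof -
    have "real X \<le> exp (4 * L)" using X a3' by linarith
    then have "real sX \<le> (3 * (4 * L)) powr (2 * sqrt L)" unfolding sX_def
      using L1 by (intro card_smooth_upto_le_powr[OF W]) auto
    then show ?thesis using a3 by linarith
  qed

  \<comment> \<open>A prime of size \<open>l\<close> lies above \<open>B\<close> \<le> 2 sqrt L, yet
    demanding that it divide \<open>k mod q\<close> reduces the supply of q only by a factor of
    order \<open>l\<close>.\<close>
  obtain r where r: "prime r" "nat \<lceil>l\<rceil> < r" "r \<le> 2 * nat \<lceil>l\<rceil>"
  proof -
    define x where "x = nat \<lceil>l\<rceil>"
    have x: "l \<le> real x" "real x \<le> l + 1" unfolding x_def using l0 by linarith+
    have "real x / (4 * l) \<le> real (card (pr x))" using big[OF x(1)] x p8 by (intro count) auto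
    moreover have "real x / (4 * l) > 0" using x l0 by simp
    ultimately have "pr x \<noteq> {}" by auto
    then show ?thesis using that by (auto simp: pr_def x_def)
  qed
  have rr: "l \<le> real r" "real r \<le> 2 * l + 2" using r l0 by linarith+
  obtain T1 q0 where T1: "finite T1" "card T1 = r1" "q0 \<notin> T1" "insert q0 T1 \<subseteq> pr y2"
  proof -
    have "real y2 / (4 * l) \<le> real (card (pr y2))"
      using big[of y2] y2 q2 o2 o3 p6 by (intro count) auto
    moreover have "E2 / (4 * l) \<le> real y2 / (4 * l)" using y2 l0 by (intro divide_right_mono) auto
    ultimately have "real (Suc r1) \<le> real (card (pr y2))" using p2 r1 by simp
    then have "Suc r1 \<le> card (pr y2)" by (simp only: of_nat_le_iff)
    then obtain T where T: "T \<subseteq> pr y2" "card T = Suc r1" "finite T"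
      by (rule obtain_subset_with_card_n)
    then obtain q0 T1 where "T = insert q0 T1" "q0 \<notin> T1" "card T1 = r1" "finite T1"
      by (metis card_Suc_eq finite_insert)
    then show ?thesis using that T by blast
  qed
  have T1p: "prime q \<and> y2 < q \<and> q \<le> 2 * y2" if "q \<in> insert q0 T1" for q
    using that T1(4) by (auto simp: pr_def)
  have y2U: "2 * y2 < U" using y2 U o11 by linarith
  have T1U: "prime q \<and> y2 < q \<and> q < U" if "q \<in> insert q0 T1" for q
    using T1p[OF that] y2U by linarith
  define V where "V = {p. prime p \<and> real p < B} \<union> insert q0 T1"
  define n2 where "n2 = card (smooth_upto V N)"
  have n2: "real n2 \<le> s"
  proof -
    \<comment> \<open>\<open>E2\<close> to the power l^(1/4) is exactly \<open>K\<close>; the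
      successor makes the inequality strict.\<close>
    define e where "e = nat \<lceil>l powr (1/4)\<rceil>"
    have e: "l powr (1/4) \<le> real e" "real e \<le> l powr (1/4) + 1" unfolding e_def
      using powr_ge_zero[of l "1/4"] by linarith+
    have "exp l < exp (l powr (3/4) * real (Suc e))"
    proof -
      have "l = l powr (3/4) * l powr (1/4)" using l0 by (simp add: powr_add[symmetric])
      also have "\<dots> < l powr (3/4) * real (Suc e)" using e l0 by (intro mult_strict_left_mono) auto
      finally show ?thesis by simp
    qed
    also have "\<dots> = E2 ^ Suc e" unfolding E2_def l_def by (metis exp_of_nat_mult mult.commute)
    also have "\<dots> \<le> real y2 ^ Suc e" using y2 pos by (intro power_mono) auto
    finally have "real N < real (y2 ^ Suc e)" using N lK by (simp only: of_nat_power)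
    then have Ne: "N < y2 ^ Suc e" by (simp only: of_nat_less_iff)
    have y20: "y2 > 0" using y2 pos by (intro gr0I) auto
    have "n2 \<le> n1 * card (smooth_upto (insert q0 T1) N)"
      unfolding n2_def n1_def V_def W_def by (rule card_smooth_upto_Un)
    also have "\<dots> \<le> n1 * (card (insert q0 T1) + 1) ^ e"
      using T1(1) T1p less_imp_le by (intro mult_le_mono2 card_smooth_upto_le_large[OF _ _ y20 Ne]) auto
    finally have "real n2 \<le> real (n1 * (card (insert q0 T1) + 1) ^ e)" by (simp only: of_nat_le_iff)
    also have "\<dots> = real n1 * (real r1 + 2) ^ e" using T1 by (simp add: algebra_simps)
    also have "\<dots> = real n1 * (real r1 + 2) powr real e" by (simp add: powr_realpow)
    also have "\<dots> \<le> (3 * l) powr (2 * sqrt L) * (l powr (1/10) + 2) powr (l powr (1/4) + 1)"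
    proof (intro mult_mono n1)
      have "(real r1 + 2) powr real e \<le> (real r1 + 2) powr (l powr (1/4) + 1)"
        using e by (intro powr_mono) auto
      also have "\<dots> \<le> (l powr (1/10) + 2) powr (l powr (1/4) + 1)"
        using r1 powr_ge_zero[of l "1/4"] by (intro powr_mono2) linarith+
      finally show "(real r1 + 2) powr real e \<le> (l powr (1/10) + 2) powr (l powr (1/4) + 1)" .
    qed auto
    finally show ?thesis using a4 by linarith
  qed
  have n1s: "real n1 \<le> s" using n1 a4' by linarith
  define Q where "Q = r * q0 * \<Prod>T1"
  have Qpos: "Q > 0" unfolding Q_def using r(1) T1p prime_gt_0_nat by (auto intro!: prod_pos)
  \<comment> \<open>About l^(1/10) primes of size exp(l^(3/4)) multiply to the exponential of about
    l^(17/20), within exp(l^(9/10)).\<close>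
  have Qb: "real Q \<le> Qb"
  proof -
    have "real (\<Prod>T1) = (\<Prod>q\<in>T1. real q)" by simp
    also have "\<dots> \<le> (\<Prod>q\<in>T1. 2 * (E2 + 1))"
    proof (rule prod_mono)
      fix q assume "q \<in> T1"
      then have "real q \<le> 2 * (E2 + 1)" using T1p[of q] y2 by auto
      then show "0 \<le> real q \<and> real q \<le> 2 * (E2 + 1)" by simp
    qed
    also have "\<dots> = (2 * (E2 + 1)) ^ r1" using T1 by simp
    finally have 1: "real (\<Prod>T1) \<le> (2 * (E2 + 1)) ^ r1" .
    have 2: "real q0 \<le> 2 * (E2 + 1)" using T1p[of q0] y2 by auto
    have "real Q = real r * (real q0 * real (\<Prod>T1))" by (simp add: Q_def)
    also have "\<dots> \<le> (2 * l + 2) * (2 * (E2 + 1) * (2 * (E2 + 1)) ^ r1)"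
      using rr 1 2 pos l0 by (intro mult_mono mult_nonneg_nonneg) (auto simp: prod_nonneg)
    also have "2 * (E2 + 1) * (2 * (E2 + 1)) ^ r1 = (2 * (E2 + 1)) powr real (Suc r1)"
      using pos by (subst powr_realpow) auto
    also have "(2 * l + 2) * \<dots> \<le> (2 * l + 2) * (2 * (E2 + 1)) powr (l powr (1/10) + 1)"
      using r1 pos l0 by (intro mult_left_mono powr_mono) auto
    finally show ?thesis using a5 by linarith
  qed
  define H where "H = N div Q + 1"
  have H: "real H \<le> 2 * K / real Q"
  proof -
    have "real (N div Q) \<le> real N / real Q" by (rule of_nat_div_le_of_nat)
    also have "\<dots> \<le> K / real Q" using N by (intro divide_right_mono) auto
    finally have "real (N div Q) \<le> K / real Q" .
    moreover have "1 \<le> K / real Q" using Qb Qpos p5 y4 o3 p6 pos by (simp add: le_divide_eq)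
    ultimately show ?thesis by (simp add: H_def)
  qed

  define \<Z> where "\<Z> = pr U"
  have zc: "real U / (4 * l) \<le> real (card \<Z>)" unfolding \<Z>_def
    using big[of U] U q2 o2 o3 p6 by (intro count) linarith+
  have \<Z>: "prime q \<and> U < q \<and> q \<le> 2 * U \<and> coprime Q q" if "q \<in> \<Z>" for q
  proof -
    have q: "prime q" "U < q" "q \<le> 2 * U" using that by (auto simp: \<Z>_def pr_def)
    \<comment> \<open>Every prime factor of \<open>Q\<close> is smaller than \<open>U\<close>, and
      \<open>q\<close> is larger.\<close>
    have "\<not> q dvd Q"
    proof
      assume "q dvd Q"
      then have "q dvd r \<or> q dvd q0 \<or> q dvd \<Prod>T1" using q(1) by (auto simp: Q_def prime_dvd_mult_iff)
      then have "q dvd r \<or> (\<exists>t\<in>insert q0 T1. q dvd t)"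
        using q(1) T1(1) by (auto simp: prime_dvd_prod_iff)
      then have "q = r \<or> q \<in> insert q0 T1" using q(1) r(1) T1p by (metis primes_dvd_imp_eq)
      then show False
      proof
        assume "q = r"
        then show False using q(2) rr(2) o12 y2 y2U by linarith
      next
        assume "q \<in> insert q0 T1"
        then show False using T1U q(2) by fastforce
      qed
    qed
    then have "coprime q Q" by (rule prime_imp_coprime[OF q(1)])
    then show ?thesis using q by (simp add: coprime_commute)
  qed
  define A where "A = (\<lambda>y. {a. a < y \<and> r dvd a})"
  define \<mu> where "\<mu> = (\<lambda>y. \<Sum>q\<in>\<Z>. real (card (A y)) / real q)"
  have rpos: "r > 0" using r(1) prime_gt_0_nat by blast
  have hA: "E / (4 * l) \<le> real (card (A y))"
    if "E > 0" "E \<le> real y" "E / (4 * l) \<le> E / (2 * l + 2) - 1" for E y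
  proof -
    have "E / (2 * l + 2) \<le> real y / real r" using that rr l0 rpos by (intro frac_le) auto
    then show ?thesis using card_multiples_less_bounds[OF rpos, of y] that(3) unfolding A_def by linarith
  qed
  define \<beta> where "\<beta> = 128 * l\<^sup>2 * real H / E1 + 64 * (real U)\<^sup>2"
  have y12: "y1 \<le> y2" using y1 y2 o1 by linarith
  have y2U': "y2 \<le> U" "y1 \<le> U" using y2U y12 by linarith+
  have Upos: "U > 0" using y2U by linarith
  define Bad where "Bad = (\<lambda>y. {t. t < H \<and> real (card {q \<in> \<Z>. Q * t mod q \<in> A y}) < \<mu> y / 2})"
  have h1: "E1 / (4 * l) \<le> real (card (A y1))" using y1 p1 pos by (intro hA) auto
  have h2: "E2 / (4 * l) \<le> real (card (A y2))" using y2 p1' pos by (intro hA) auto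
  \<comment> \<open>The weaker bound with \<open>E1\<close> lets the same \<beta> serve
    \<open>y2\<close>; the stronger bound with \<open>E2\<close> is kept for the lower bound on
    \<mu>.\<close>
  have h2': "E1 / (4 * l) \<le> real (card (A y2))"
  proof -
    have "E1 / (4 * l) \<le> E2 / (4 * l)" using o1 l0 by (intro divide_right_mono) auto
    then show ?thesis using h2 by linarith
  qed
  have fZ: "finite \<Z>" by (simp add: \<Z>_def finpr)
  note cb1 = card_residue_bad_le[OF fZ \<Z> y2U'(2) Upos l0 pos(1) h1[unfolded A_def] zc]
  note cb2 = card_residue_bad_le[OF fZ \<Z> y2U'(1) Upos l0 pos(1) h2'[unfolded A_def] zc]
  note cb2' = card_residue_bad_le[OF fZ \<Z> y2U'(1) Upos l0 pos(2) h2[unfolded A_def] zc]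
  have \<mu>1: "2 * real n1 \<le> \<mu> y1" using cb1(1) n1 a6 unfolding \<mu>_def A_def by linarith
  have "2 * real n1 + 2 * real n2 \<le> \<mu> y2" using cb2'(1) n1s n2 a7 unfolding \<mu>_def A_def by linarith
  then have \<mu>2: "2 * (real n1 + real n2) \<le> \<mu> y2" by simp
  have \<beta>1: "real (card (Bad y1)) \<le> \<beta>" using cb1(2) unfolding Bad_def \<mu>_def A_def \<beta>_def .
  have \<beta>2: "real (card (Bad y2)) \<le> \<beta>" using cb2(2) unfolding Bad_def \<mu>_def A_def \<beta>_def .

  have \<omega>pos: "\<omega> > 0" using \<omega> Kl by (intro gr0I) auto
  have Z0K: "real Z0 \<le> K" using Z0 p7 by linarith
  have cZ0: "real Z0 / (4 * l) \<le> real (card (pr Z0))"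
    using big[of Z0] Z0 q3 Z0K by (intro count) auto
  have Z0pos: "real Z0 > 0" using Z0 Kl by linarith
  obtain v where v: "card (pr Z0) \<le> (2 * Z0 div \<omega> + 1) * card {q \<in> pr Z0. q div \<omega> = v}"
    by (rule pigeonhole_div[OF finpr[of Z0] _ \<omega>pos, of "2 * Z0"]) (auto simp: pr_def)
  define Z where "Z = v * \<omega>"
  define \<Q> where "\<Q> = {q \<in> pr Z0. q div \<omega> = v}"
  have fQ: "finite \<Q>" by (simp add: \<Q>_def finpr)
  have \<Q>': "prime q \<and> Z0 < q \<and> q \<le> 2 * Z0 \<and> Z \<le> q \<and> q < Z + \<omega>" if "q \<in> \<Q>" for q
  proof -
    have q: "q \<in> pr Z0" "q div \<omega> = v" using that by (auto simp: \<Q>_def)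
    have "\<omega> * v + q mod \<omega> = q" unfolding q(2)[symmetric] by simp
    moreover have "q mod \<omega> < \<omega>" using \<omega>pos by simp
    ultimately show ?thesis using q(1) by (auto simp: Z_def pr_def mult.commute)
  qed
  \<comment> \<open>The 12 l^3 is 4 l from the prime count times 3 l^2, a bound for the number of
    blocks of length \<omega> up to 2 Z0.\<close>
  have cQ: "real Z0 / (12 * l ^ 3) \<le> real (card \<Q>)"
  proof -
    have "real (2 * Z0 div \<omega>) \<le> real (2 * Z0) / real \<omega>" by (rule of_nat_div_le_of_nat)
    also have "\<dots> \<le> 2 * (K / l ^ 3 + 1) / (K / l ^ 5)"
      using Z0 \<omega> Kl by (intro frac_le) auto
    finally have c: "real (2 * Z0 div \<omega> + 1) \<le> 3 * l\<^sup>2" using p3 by simp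
    have "real Z0 / (4 * l) \<le> real (card (pr Z0))" by (rule cZ0)
    also have "\<dots> \<le> real ((2 * Z0 div \<omega> + 1) * card \<Q>)" using v unfolding \<Q>_def by (simp only: of_nat_le_iff)
    also have "\<dots> = real (2 * Z0 div \<omega> + 1) * real (card \<Q>)" by (simp only: of_nat_mult)
    also have "\<dots> \<le> 3 * l\<^sup>2 * real (card \<Q>)" using c by (intro mult_right_mono) auto
    finally have "real Z0 / (4 * l) / (3 * l\<^sup>2) \<le> real (card \<Q>)" using l0 by (subst pos_divide_le_eq) (auto simp: mult_ac)
    moreover have "real Z0 / (4 * l) / (3 * l\<^sup>2) = real Z0 / (12 * l ^ 3)"
      by (simp add: power2_eq_square power3_eq_cube)
    ultimately show ?thesis by (simp only:)
  qed
  have "card \<Q> > 0"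
  proof (rule gr0I)
    assume "card \<Q> = 0"
    then have "real Z0 / (12 * l ^ 3) \<le> 0" using cQ by simp
    moreover have "real Z0 / (12 * l ^ 3) > 0" using Z0pos Kl by simp
    ultimately show False by linarith
  qed
  then have "\<Q> \<noteq> {}" by (metis card.empty less_irrefl)
  then obtain qx where qx: "qx \<in> \<Q>" by blast
  \<comment> \<open>The block contains a prime above \<open>Z0\<close> and so begins above Z0 -
    \<omega>; this is where \<open>Zl\<close> comes from.\<close>
  have ZZ0: "Zl \<le> real Z" "Z \<le> 2 * Z0"
  proof -
    have "Z0 < Z + \<omega>" "Z \<le> 2 * Z0" using \<Q>'[OF qx] by linarith+
    then show "Zl \<le> real Z" "Z \<le> 2 * Z0" using Z0 \<omega> unfolding Zl_def l_def[symmetric] by linarith+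
  qed
  have Zl0: "Zl > 0" using o4 pos by linarith
  have ZK: "real Z \<le> 2 * (K / l ^ 3) + 2" using ZZ0 Z0 by linarith
  then have ZK': "real Z \<le> 2 * (K / l ^ 3 + 1)" by simp
  have \<omega>Z: "\<omega> \<le> Z" using \<omega> o10 ZZ0 by linarith
  define h0 where "h0 = nat \<lceil>K / 2\<rceil>"
  have h0: "K / 2 \<le> real h0" "real h0 \<le> K / 2 + 1" unfolding h0_def using K0 by linarith+
  have ch0: "K / (8 * l) \<le> real (card (pr h0))"
  proof -
    have "l \<le> K / 2" using q3 o5 K0 by linarith
    then have "real h0 / (4 * l) \<le> real (card (pr h0))"
      using big[of h0] h0 K1 by (intro count) linarith+
    moreover have "(K / 2) / (4 * l) \<le> real h0 / (4 * l)" using h0 l0 by (intro divide_right_mono) auto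
    ultimately show ?thesis by simp
  qed
  define \<P> where "\<P> = {p \<in> pr h0. p + Z + \<omega> + y4 \<le> N}"
  have fP: "finite \<P>" by (simp add: \<P>_def finpr)
  have \<P>: "prime p \<and> N < 2 * p \<and> p + Z + \<omega> + y4 \<le> N" if "p \<in> \<P>" for p
  proof -
    have p: "prime p" "h0 < p" "p + Z + \<omega> + y4 \<le> N" using that by (auto simp: \<P>_def pr_def)
    have "N < 2 * p" using p(2) h0 N by linarith
    then show ?thesis using p by blast
  qed
  have cP: "K / (8 * l) - 5 * K / l ^ 3 \<le> real (card \<P>)"
  proof -
    \<comment> \<open>The primes too close to \<open>N\<close> are bounded by the length of their
      interval, which is of order K / l^3 against K / l primes in all.\<close>
    have "pr h0 \<subseteq> \<P> \<union> {N + 1 - (Z + \<omega> + y4)..2 * h0}" by (auto simp: \<P>_def pr_def)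
    then have "card (pr h0) \<le> card (\<P> \<union> {N + 1 - (Z + \<omega> + y4)..2 * h0})"
      using fP by (intro card_mono) auto
    also have "\<dots> \<le> card \<P> + card {N + 1 - (Z + \<omega> + y4)..2 * h0}" by (rule card_Un_le)
    finally have "card (pr h0) \<le> card \<P> + (2 * h0 + 1 - (N + 1 - (Z + \<omega> + y4)))" by simp
    moreover have "real (2 * h0 + 1 - (N + 1 - (Z + \<omega> + y4))) \<le> 3 + (2 * (K / l ^ 3) + 2) + (K / l ^ 5 + 1) + g"
      using h0 N ZK \<omega> y4 by linarith
    ultimately show ?thesis using ch0 p4 by linarith
  qed
  \<comment> \<open>The exponents 3 and 5 in Z and \<omega> are balanced here: X \<omega> is about 2
    K / l^2 and \<open>sX\<close> times Z is at most of order K / l^(5/2), both of smaller order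
    than K / l.\<close>
  define D where "D = real (card \<P>) - real (X * (\<omega> + y4)) - real (sX * (Z + \<omega>))"
  have D: "K / (16 * l) \<le> D"
  proof -
    have "real (X * (\<omega> + y4)) \<le> (2 * l ^ 3 + 1) * (K / l ^ 5 + 1 + g)"
      using X \<omega> y4 Kl by (simp only: of_nat_mult of_nat_add, intro mult_mono) auto
    moreover have "real (sX * (Z + \<omega>)) \<le> l powr (1/2) * (2 * (K / l ^ 3 + 1) + (K / l ^ 5 + 1))"
      using sX ZK' \<omega> by (simp only: of_nat_mult of_nat_add, intro mult_mono add_mono) auto
    ultimately show ?thesis unfolding D_def using cP a10 by linarith
  qed
  \<comment> \<open>The constants leave a margin: the product of the lower bounds is
    \<open>G / 384\<close> with 384 = 12 * 16 * 2, while this \<tau> costs \<open>G / 800\<close>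
    and the exceptional multiples cost \<open>G / 2000\<close>.\<close>
  define \<tau> where "\<tau> = real Z0 * real y4 / (1600 * l ^ 4)"
  have y4pos: "real y4 > 0" using y4 p5 pos by linarith
  have \<tau>pos: "\<tau> > 0" unfolding \<tau>_def using Z0pos y4pos l0 by simp
  define G where "G = real Z0 * real y4 * (K / (l ^ 4 * real Q))"
  have Gpos: "G > 0" unfolding G_def using Z0pos y4pos l0 K0 Qpos by simp
  have rhs: "G / 384 \<le> real (card \<Q>) * D * real (y4 div Q)"
  proof -
    have yQ: "real y4 / (2 * real Q) \<le> real (y4 div Q)"
    proof -
      have "real y4 / real Q - 1 \<le> real (y4 div Q)"
      proof -
        have "y4 < Q * (y4 div Q) + Q" using dividend_less_times_div[OF Qpos, of y4] by simp
        then have "real y4 \<le> real Q * (real (y4 div Q) + 1)"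
          by (metis distrib_left less_imp_le mult.right_neutral of_nat_add of_nat_le_iff of_nat_mult)
        then show ?thesis using Qpos by (simp add: pos_divide_le_eq diff_le_eq mult.commute)
      qed
      moreover have "1 \<le> real y4 / (2 * real Q)" using Qb p5 y4 Qpos by (simp add: le_divide_eq)
      moreover have "real y4 / real Q = 2 * (real y4 / (2 * real Q))" by simp
      ultimately show ?thesis by linarith
    qed
    have "G / 384 = real Z0 / (12 * l ^ 3) * (K / (16 * l)) * (real y4 / (2 * real Q))"
      unfolding G_def by (simp add: power4_eq_xxxx power3_eq_cube mult_ac)
    also have "\<dots> \<le> real (card \<Q>) * D * real (y4 div Q)"
      using cQ D yQ K0 l0 by (intro mult_mono mult_nonneg_nonneg) (auto intro: order_trans[OF _ D])
    finally show ?thesis .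
  qed
  have lhs1: "\<tau> * real H \<le> G / 800"
  proof -
    have "\<tau> * real H \<le> \<tau> * (2 * K / real Q)" using H \<tau>pos by (intro mult_left_mono) auto
    also have "\<dots> = G / 800" unfolding \<tau>_def G_def by (simp add: mult_ac)
    finally show ?thesis .
  qed
  have lhs2: "(2 * \<beta> + real n2 * real y4) * (real Z * real y4) \<le> G / 2000"
  proof -
    \<comment> \<open>\<open>E1\<close> exceeds every power of \<open>l\<close>, which settles the
      variance term. The remaining terms are of order K^(4/5) at most, below K / Qb.\<close>
    have "2 * \<beta> = 256 * l\<^sup>2 / E1 * real H + 128 * (real U)\<^sup>2" unfolding \<beta>_def by simp
    also have "\<dots> \<le> 256 * l\<^sup>2 / E1 * (2 * K / real Q) + 128 * (u + 1)\<^sup>2"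
      using H U pos by (intro add_mono mult_left_mono power_mono) auto
    finally have "2 * \<beta> \<le> 512 * l\<^sup>2 / E1 * (K / real Q) + 128 * (u + 1)\<^sup>2" by simp
    moreover have "real n2 * real y4 \<le> s * g" using n2 y4 pos by (intro mult_mono) auto
    ultimately have "2 * \<beta> + real n2 * real y4 \<le> 512 * l\<^sup>2 / E1 * (K / real Q) + (128 * (u + 1)\<^sup>2 + s * g)"
      by linarith
    then have "2 * (2 * \<beta> + real n2 * real y4) \<le> 2 * (512 * l\<^sup>2 / E1 * (K / real Q) + (128 * (u + 1)\<^sup>2 + s * g))"
      by (rule mult_left_mono) simp
    also have "\<dots> = 1024 * l\<^sup>2 / E1 * (K / real Q) + 2 * (128 * (u + 1)\<^sup>2 + s * g)"
      by (subst distrib_left) simp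
    also have "\<dots> \<le> 1 / (4000 * l ^ 4) * (K / real Q) + K / (4000 * l ^ 4 * real Q)"
    proof (intro add_mono mult_right_mono a8)
      have "K / (4000 * l ^ 4 * Qb) \<le> K / (4000 * l ^ 4 * real Q)"
        using K0 l0 Qpos Qb pos by (intro divide_left_mono mult_left_mono mult_pos_pos) auto
      then show "2 * (128 * (u + 1)\<^sup>2 + s * g) \<le> K / (4000 * l ^ 4 * real Q)" using a9 by linarith
    qed (use K0 in auto)
    also have "\<dots> = K / (l ^ 4 * real Q) / 2000" by (simp add: mult_ac)
    finally have 1: "2 * (2 * \<beta> + real n2 * real y4) \<le> K / (l ^ 4 * real Q) / 2000" .
    have \<beta>0: "0 \<le> 2 * \<beta> + real n2 * real y4" unfolding \<beta>_def using pos by simp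
    have "(2 * \<beta> + real n2 * real y4) * (real Z * real y4) \<le> (2 * \<beta> + real n2 * real y4) * (2 * real Z0 * real y4)"
      using ZZ0(2) \<beta>0 by (intro mult_left_mono mult_right_mono) auto
    also have "\<dots> = 2 * (2 * \<beta> + real n2 * real y4) * (real Z0 * real y4)" by (simp only: mult.assoc mult.left_commute)
    also have "\<dots> \<le> K / (l ^ 4 * real Q) / 2000 * (real Z0 * real y4)" using 1 by (intro mult_right_mono) auto
    also have "\<dots> = G / 2000" unfolding G_def by (simp add: mult_ac)
    finally show ?thesis .
  qed
  have main: "(2 * \<beta> + real n2 * real y4) * (real Z * real y4) + \<tau> * real H
      < real (card \<Q>) * (real (card \<P>) - real (X * (\<omega> + y4)) - real (card (smooth_upto W X) * (Z + \<omega>))) * real (y4 div Q)"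
    using rhs lhs1 lhs2 Gpos unfolding D_def sX_def by linarith
  define M where "M = n2 * (n1 + n2 + 1)\<^sup>2"
  have M: "real M \<le> s * (2 * s + 1)\<^sup>2"
  proof -
    have "real M = real n2 * (real n1 + real n2 + 1)\<^sup>2" by (simp add: M_def)
    also have "\<dots> \<le> s * (2 * s + 1)\<^sup>2" using n2 n1s pos by (intro mult_mono power_mono) auto
    finally show ?thesis .
  qed
  have NZ: "real (N div Z) + 1 \<le> 2 * l ^ 3"
  proof -
    have "real (N div Z) \<le> real N / real Z" by (rule of_nat_div_le_of_nat)
    also have "\<dots> \<le> K / Zl" using N ZZ0 Zl0 K0 by (intro frac_le) auto
    finally show ?thesis using o8 by linarith
  qed
  \<comment> \<open>Up to powers of \<open>l\<close>, \<tau> is Z y4. So \<open>C4\<close> is large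
    enough because y4 dominates \<open>M\<close>, and \<open>C5\<close> because Z dominates q0 M (1
    + N / Z).\<close>
  have t2: "real Z * real M \<le> \<tau>"
  proof -
    have "1600 * l ^ 4 * (real Z * real M) \<le> 1600 * l ^ 4 * (2 * real Z0 * (s * (2 * s + 1)\<^sup>2))"
      using ZZ0 M l0 by (intro mult_left_mono mult_mono) auto
    also have "\<dots> = real Z0 * (3200 * l ^ 4 * (s * (2 * s + 1)\<^sup>2))" by simp
    also have "\<dots> \<le> real Z0 * real y4" using a11 y4 by (intro mult_left_mono) auto
    finally show ?thesis unfolding \<tau>_def using l0 by (simp add: pos_le_divide_eq mult.commute)
  qed
  have t3: "real y4 * (real q0 * (real M * real (1 + N div Z))) \<le> \<tau>"
  proof -
    have q0: "real q0 \<le> 2 * (E2 + 1)" using T1p[of q0] y2 by auto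
    have "real q0 * (real M * real (1 + N div Z)) \<le> 2 * (E2 + 1) * (s * (2 * s + 1)\<^sup>2 * (2 * l ^ 3 + 1))"
      using q0 M NZ pos by (intro mult_mono mult_nonneg_nonneg) auto
    then have "real q0 * (real M * real (1 + N div Z)) * (1600 * l ^ 4) \<le> 2 * (E2 + 1) * (s * (2 * s + 1)\<^sup>2 * (2 * l ^ 3 + 1)) * (1600 * l ^ 4)"
      using l0 by (intro mult_right_mono) auto
    also have "\<dots> \<le> real Z0" using a12 Z0 by linarith
    finally have "real y4 * (real q0 * (real M * real (1 + N div Z)) * (1600 * l ^ 4)) \<le> real y4 * real Z0"
      by (intro mult_left_mono) auto
    then show ?thesis unfolding \<tau>_def using l0 by (simp add: pos_le_divide_eq mult_ac)
  qed
  have ord1: "y2 \<le> y4" "y4 \<le> U" using y2 y4 U o2 o3 by linarith+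
  have ord2: "2 * U < Z" using U o4 ZZ0 by linarith
  have ord3: "4 * Z \<le> N" using ZK o5 N by linarith
  have ord4: "N < U ^ 3"
  proof -
    have "u ^ 3 \<le> real U ^ 3" using U pos by (intro power_mono) auto
    then have "real N < real (U ^ 3)" unfolding of_nat_power using N o6 by linarith
    then show ?thesis by (simp only: of_nat_less_iff)
  qed
  have ord5: "N < Z\<^sup>2"
  proof -
    have "Zl\<^sup>2 \<le> (real Z)\<^sup>2" using ZZ0 Zl0 by (intro power_mono) auto
    then have "real N < real (Z\<^sup>2)" unfolding of_nat_power using N o7 by linarith
    then show ?thesis by (simp only: of_nat_less_iff)
  qed
  have ord6: "N div Z + 1 \<le> X" using NZ X by linarith
  have ord7: "X \<le> y2" using X y2 o9 by linarith
  have ry: "B \<le> real r" "r \<le> y2" using rr B o13 o12 y2 by linarith+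
  have \<Z>2: "prime q \<and> U < q \<and> q \<le> 2 * U" if "q \<in> \<Z>" for q using \<Z>[OF that] by blast
  have \<Q>2: "prime q \<and> Z \<le> q \<and> q \<le> Z + \<omega>" if "q \<in> \<Q>" for q using \<Q>'[OF that] by auto
  have cT1: "card (smooth_upto W y1) \<le> card T1" by (simp add: T1(2) r1_def)
  have K1': "K \<ge> 1" using K1 by simp
  show ?thesis
    by (rule covering_of_numeric_bounds[OF K1' N_def T1(1,3) T1U r(1) ry y12 ord1 ord2 ord3 ord4 ord5
          ord6 ord7 \<omega>Z cT1[unfolded W_def] fZ \<Z>2 fP \<P> fQ \<Q>2
          \<mu>1[unfolded \<mu>_def A_def n1_def W_def] \<mu>2[unfolded \<mu>_def A_def n1_def n2_def V_def W_def]
          \<beta>1[unfolded Bad_def \<mu>_def A_def H_def Q_def] \<beta>2[unfolded Bad_def \<mu>_def A_def H_def Q_def]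
          main[unfolded n2_def V_def H_def Q_def W_def] \<tau>pos
          t2[unfolded M_def n1_def n2_def V_def W_def] t3[unfolded M_def n1_def n2_def V_def W_def]])
qed

theorem theorem5p1:
  assumes "GRH"
  shows "\<exists>C::real. \<forall>B0\<ge>C. \<exists>K0::real. \<forall>K\<ge>K0. \<forall>B::real.
    B0 \<le> B \<and> B \<le> 2 * sqrt (ln (ln K)) \<longrightarrow>
    (\<exists>(k::nat) (\<alpha>::nat). K / 2 < real k \<and> real k \<le> K \<and>
      (\<forall>n::nat. n > k \<and> [n = \<alpha>] (mod prime_power_modulus k) \<longrightarrow>
        (\<forall>p. prime p \<and> p \<le> k \<longrightarrow> \<not> p dvd (n choose k)) \<and>
        (\<forall>i<k. \<exists>p. prime p \<and> real p \<ge> B \<and> p dvd (n - i))))"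
proof -
  obtain n0 where n0: "real n / (4 * ln (real n)) \<le> real (card {p::nat. prime p \<and> n < p \<and> p \<le> 2 * n})"
    if "n0 \<le> n" for n
    using eventually_card_primes_dyadic unfolding eventually_at_top_linorder by blast
  \<comment> \<open>Listed in the order of the numeric hypotheses of
    \<open>residue_class_large\<close>, to which they are handed over by position.\<close>
  have evs:
    "eventually (\<lambda>K::real. K \<ge> 10) at_top"
    "eventually (\<lambda>K::real. ln K \<ge> 2) at_top"
    "eventually (\<lambda>K::real. ln (ln K) \<ge> 1) at_top"
    "eventually (\<lambda>K::real. (3 * ((ln (ln K))\<^sup>2 + 1)) powr (2 * sqrt (ln (ln K)))
      \<le> ln K powr (1/10)) at_top"
    "eventually (\<lambda>K::real. (3 * (4 * ln (ln K))) powr (2 * sqrt (ln (ln K)))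
      \<le> ln K powr (1/2)) at_top"
    "eventually (\<lambda>K::real. 2 * ln K ^ 3 + 1 \<le> exp (4 * ln (ln K))) at_top"
    "eventually (\<lambda>K::real. (3 * ln K) powr (2 * sqrt (ln (ln K))) * (ln K powr (1/10) + 2) powr (ln K powr (1/4) + 1)
      \<le> exp (ln K powr (1/2))) at_top"
    "eventually (\<lambda>K::real. (3 * ln K) powr (2 * sqrt (ln (ln K))) \<le> exp (ln K powr (1/2))) at_top"
    "eventually (\<lambda>K::real. (2 * ln K + 2) * (2 * (exp (ln K powr (3/4)) + 1)) powr (ln K powr (1/10) + 1)
      \<le> exp (ln K powr (9/10))) at_top"
    "eventually (\<lambda>K::real. 2 * (3 * ln K) powr (2 * sqrt (ln (ln K)))
      \<le> exp ((ln (ln K))\<^sup>2) / (32 * (ln K)\<^sup>2)) at_top"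
    "eventually (\<lambda>K::real. 4 * exp (ln K powr (1/2))
      \<le> exp (ln K powr (3/4)) / (32 * (ln K)\<^sup>2)) at_top"
    "eventually (\<lambda>K::real. 1024 * (ln K)\<^sup>2 / exp ((ln (ln K))\<^sup>2)
      \<le> 1 / (4000 * ln K ^ 4)) at_top"
    "eventually (\<lambda>K::real. 2 * (128 * (K powr (2/5) + 1)\<^sup>2 + exp (ln K powr (1/2)) * K powr (7/20))
      \<le> K / (4000 * ln K ^ 4 * exp (ln K powr (9/10)))) at_top"
    "eventually (\<lambda>K::real. K / (16 * ln K)
      \<le> K / (8 * ln K) - 5 * K / ln K ^ 3 - (2 * ln K ^ 3 + 1) * (K / ln K ^ 5 + 1 + K powr (7/20)) - ln K powr (1/2) * (2 * (K / ln K ^ 3 + 1) + (K / ln K ^ 5 + 1))) at_top"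
    "eventually (\<lambda>K::real. 3200 * ln K ^ 4 * (exp (ln K powr (1/2)) * (2 * exp (ln K powr (1/2)) + 1)\<^sup>2)
      \<le> K powr (7/20) - 1) at_top"
    "eventually (\<lambda>K::real. 2 * (exp (ln K powr (3/4)) + 1) * (exp (ln K powr (1/2)) * (2 * exp (ln K powr (1/2)) + 1)\<^sup>2 * (2 * ln K ^ 3 + 1)) * (1600 * ln K ^ 4)
      \<le> K / ln K ^ 3) at_top"
    "eventually (\<lambda>K::real. exp ((ln (ln K))\<^sup>2) + 1 \<le> exp (ln K powr (3/4))) at_top"
    "eventually (\<lambda>K::real. exp (ln K powr (3/4)) + 1 \<le> K powr (7/20) - 1) at_top"
    "eventually (\<lambda>K::real. K powr (7/20) \<le> K powr (2/5)) at_top"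
    "eventually (\<lambda>K::real. 2 * K powr (2/5) + 2 < (K / ln K ^ 3 - K / ln K ^ 5 - 1)) at_top"
    "eventually (\<lambda>K::real. 8 * (K / ln K ^ 3) + 8 \<le> K - 1) at_top"
    "eventually (\<lambda>K::real. K < (K powr (2/5)) ^ 3) at_top"
    "eventually (\<lambda>K::real. K < (K / ln K ^ 3 - K / ln K ^ 5 - 1)\<^sup>2) at_top"
    "eventually (\<lambda>K::real. K / (K / ln K ^ 3 - K / ln K ^ 5 - 1) + 1 \<le> 2 * ln K ^ 3) at_top"
    "eventually (\<lambda>K::real. 2 * ln K ^ 3 + 1 \<le> exp (ln K powr (3/4))) at_top"
    "eventually (\<lambda>K::real. K / ln K ^ 5 + 1 \<le> (K / ln K ^ 3 - K / ln K ^ 5 - 1)) at_top"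
    "eventually (\<lambda>K::real. 2 * exp (ln K powr (3/4)) + 2 < K powr (2/5)) at_top"
    "eventually (\<lambda>K::real. 2 * ln K + 2 \<le> exp (ln K powr (3/4))) at_top"
    "eventually (\<lambda>K::real. 2 * sqrt (ln (ln K)) \<le> ln K) at_top"
    "eventually (\<lambda>K::real. exp ((ln (ln K))\<^sup>2) / (4 * ln K)
      \<le> exp ((ln (ln K))\<^sup>2) / (2 * ln K + 2) - 1) at_top"
    "eventually (\<lambda>K::real. exp (ln K powr (3/4)) / (4 * ln K)
      \<le> exp (ln K powr (3/4)) / (2 * ln K + 2) - 1) at_top"
    "eventually (\<lambda>K::real. ln K powr (1/10) + 1 \<le> exp (ln K powr (3/4)) / (4 * ln K)) at_top"
    "eventually (\<lambda>K::real. 2 * (K / ln K ^ 3 + 1) / (K / ln K ^ 5) + 1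
      \<le> 3 * (ln K)\<^sup>2) at_top"
    "eventually (\<lambda>K::real. 3 + (2 * (K / ln K ^ 3) + 2) + (K / ln K ^ 5 + 1) + K powr (7/20)
      \<le> 5 * K / ln K ^ 3) at_top"
    "eventually (\<lambda>K::real. 2 * exp (ln K powr (9/10)) \<le> K powr (7/20) - 1) at_top"
    "eventually (\<lambda>K::real. K powr (2/5) + 1 \<le> K) at_top"
    "eventually (\<lambda>K::real. K / ln K ^ 3 + 1 \<le> K) at_top"
    "eventually (\<lambda>K::real. ln K + 1 \<le> K) at_top"
    "eventually (\<lambda>K::real. real n0 \<le> ln K) at_top"
    "eventually (\<lambda>K::real. ln K \<le> exp (ln K powr (3/4))) at_top"
    "eventually (\<lambda>K::real. ln K \<le> K / ln K ^ 3) at_top"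
    by real_asymp+
  have "eventually (\<lambda>K::real. \<forall>B. B \<le> 2 * sqrt (ln (ln K)) \<longrightarrow>
    (\<exists>(k::nat) (\<alpha>::nat). K / 2 < real k \<and> real k \<le> K \<and>
      (\<forall>n::nat. n > k \<and> [n = \<alpha>] (mod prime_power_modulus k) \<longrightarrow>
        (\<forall>p. prime p \<and> p \<le> k \<longrightarrow> \<not> p dvd (n choose k)) \<and>
        (\<forall>i<k. \<exists>p. prime p \<and> real p \<ge> B \<and> p dvd (n - i))))) at_top"
    using evs
  proof eventually_elim
    case (elim K)
    show ?case by (intro allI impI, rule residue_class_large[OF n0 _ elim])
  qed
  then show ?thesis unfolding eventually_at_top_linorder by blast
qed

end
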